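(* Let $X$ be one of the following with the following relations, and let $n,b,c$ be as specified: (i) $X$ is the set of generators of the Hermitian polar space ${}^2A_{2n-1}$ (totally isotropic $n$-subspaces of $\mathbb{F}_{q^2}^{2n}$ equipped with a nondegenerate Hermitian form), with relations $R_i=\{(U,W):\dim(U\cap W)=n-i\}$, $i=0,\dots,n$, and $(b,c)=(-q,-1)$; (ii) $X$ is one of the two classes $X_1$ of generators of the hyperbolic polar space $D_m$ (totally singular $m$-subspaces of $\mathbb{F}_q^{2m}$ equipped with a nondegenerate hyperbolic quadratic form), where two generators are in the same class iff the dimension of their intersection has the same parity as $m$; here $n=\lfloor m/2\rfloor$, the relations are $R_i=\{(U,W)\in X\times X:\dim(U\cap W)=m-2i\}$, $i=0,\dots,n$, and $(b,c)=(q^2,1/q)$ if $m$ is even, $(b,c)=(q^2,q)$ if $m$ is odd. A $d$-code in $X$ is a subset $Y\subseteq X$ such that no pair $(U,W)\in Y\times Y$ lies in any of $R_1,\dots,R_{d-1}$. Let $Y$ be a $d$-code in $X$ with $1\le d\le n$. If $d$ is odd, or if $X$ is as in (ii), then $$|Y|\le \frac{|X|\,(q;b)_{d-1}}{(qcb^n;b)_{d-1}}.$$ If $X$ is as in (i) and $d$ is even, then $$|Y|\le \frac{|X|\,(q;b)_{d-1}}{(qcb^n;b)_{d-1}}\cdot\frac{(b^{n-d+2}-1)+q\,\frac{b^{n+d-2}-1}{q b^{d-2}-1}\,(b^{n-d+1}-1)}{(b^{n-d+2}-1)+q\,\frac{b^{n+d-2}-1}{b^{n+d-1}-1}\,(b^{n-d+1}-1)}.$$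 Moreover, these same bounds hold for $d$-codes $Y$ (defined with respect to $R_1,\dots,R_{d-1}$) in any symmetric association scheme $(X',(R'_i)_{i=0}^n)$ whose $P$-numbers and $Q$-numbers coincide with those of the scheme $(X,(R_i))$ in (i) or (ii) (with $|X|$ in the bound; note $|X'|=|X|$).
   Context: $q$ is a prime power. $(x;b)_0=1$ and $(x;b)_i=\prod_{j=0}^{i-1}(1-xb^j)$. One has $|X|=\prod_{i=1}^n(1+q^{2i-1})$ in case (i) and $|X|=\prod_{i=1}^{m-1}(1+q^i)$ in case (ii); in both cases $(X,(R_i))$ is a symmetric association scheme with $n$ classes. A symmetric association scheme with $n$ classes is a finite set with relations $R_0,\dots,R_n$ partitioning $X\times X$, $R_0$ the identity, each $R_i$ symmetric, such that for $(x,y)\in R_k$ the number of $z$ with $(x,z)\in R_i,(z,y)\in R_j$ depends only on $i,j,k$. With $D_i$ the adjacency matrices and $E_0,\dots,E_n$ the primitive idempotents of the Bose–Mesner algebra, the $P$-numbers and $Q$-numbers are defined by $D_i=\sum_k P_i(k)E_k$ and $E_k=\frac{1}{|X|}\sum_i Q_k(i)D_i$. *)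

theory Defs
  imports "HOL-Analysis.Cartesian_Space" "HOL-Number_Theory.Prime_Powers"
begin

subsection \<open>Symmetric association schemes\<close>

definition symmetric_association_scheme ::
    "nat \<Rightarrow> 'x set \<Rightarrow> (nat \<Rightarrow> ('x \<times> 'x) set) \<Rightarrow> bool" where
  "symmetric_association_scheme n X R \<longleftrightarrow>
     finite X \<and>
     (\<forall>i\<le>n. R i \<noteq> {}) \<and>
     (\<Union>i\<le>n. R i) = X \<times> X \<and>
     (\<forall>i\<le>n. \<forall>j\<le>n. i \<noteq> j \<longrightarrow> R i \<inter> R j = {}) \<and>
     R 0 = Id_on X \<and>
     (\<forall>i\<le>n. sym (R i)) \<and>
     (\<exists>p :: nat \<Rightarrow> nat \<Rightarrow> nat \<Rightarrow> nat. \<forall>i\<le>n. \<forall>j\<le>n. \<forall>k\<le>n. \<forall>(x, y)\<in>R k.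
        card {z \<in> X. (x, z) \<in> R i \<and> (z, y) \<in> R j} = p i j k)"

text \<open>
  Matrices with rows and columns indexed by a finite set \<open>X\<close> are functions of two arguments.
  All matrices that occur below are linear combinations of adjacency matrices of relations on
  \<open>X\<close>, hence vanish outside \<open>X \<times> X\<close>, so that equality of functions is equality of matrices.
\<close>

type_synonym 'x sqmat = "'x \<Rightarrow> 'x \<Rightarrow> real"

definition mat_mult :: "'x set \<Rightarrow> 'x sqmat \<Rightarrow> 'x sqmat \<Rightarrow> 'x sqmat" where
  "mat_mult X A B = (\<lambda>x y. \<Sum>z\<in>X. A x z * B z y)"

definition adjacency :: "('x \<times> 'x) set \<Rightarrow> 'x sqmat" where
  "adjacency r = (\<lambda>x y. of_bool ((x, y) \<in> r))"

definition lin_comb :: "nat \<Rightarrow> (nat \<Rightarrow> real) \<Rightarrow> (nat \<Rightarrow> 'x sqmat) \<Rightarrow> 'x sqmat" where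
  "lin_comb n a M = (\<lambda>x y. \<Sum>i\<le>n. a i * M i x y)"

definition bose_mesner :: "nat \<Rightarrow> (nat \<Rightarrow> ('x \<times> 'x) set) \<Rightarrow> 'x sqmat set" where
  "bose_mesner n R = {lin_comb n a (\<lambda>i. adjacency (R i)) | a. True}"

definition idempotents :: "nat \<Rightarrow> 'x set \<Rightarrow> (nat \<Rightarrow> ('x \<times> 'x) set) \<Rightarrow> 'x sqmat set" where
  "idempotents n X R = {E \<in> bose_mesner n R. mat_mult X E E = E}"

definition primitive_idempotents ::
    "nat \<Rightarrow> 'x set \<Rightarrow> (nat \<Rightarrow> ('x \<times> 'x) set) \<Rightarrow> 'x sqmat set" where
  "primitive_idempotents n X R =
     {E \<in> idempotents n X R. E \<noteq> (\<lambda>x y. 0) \<and>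
        \<not> (\<exists>F\<in>idempotents n X R. \<exists>G\<in>idempotents n X R.
             F \<noteq> (\<lambda>x y. 0) \<and> G \<noteq> (\<lambda>x y. 0) \<and>
             mat_mult X F G = (\<lambda>x y. 0) \<and> mat_mult X G F = (\<lambda>x y. 0) \<and>
             E = (\<lambda>x y. F x y + G x y))}"

text \<open>
  \<open>P i k\<close> and \<open>Q k i\<close> stand for $P_i(k)$ and $Q_k(i)$. These numbers depend on the order in which
  the primitive idempotents are listed; the predicate says that \<open>P\<close> and \<open>Q\<close> are the numbers for
  some such order.
\<close>

definition PQ_numbers ::
    "nat \<Rightarrow> 'x set \<Rightarrow> (nat \<Rightarrow> ('x \<times> 'x) set) \<Rightarrow>
     (nat \<Rightarrow> nat \<Rightarrow> real) \<Rightarrow> (nat \<Rightarrow> nat \<Rightarrow> real) \<Rightarrow> bool" where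
  "PQ_numbers n X R P Q \<longleftrightarrow>
     (\<exists>E. bij_betw E {..n} (primitive_idempotents n X R) \<and>
        (\<forall>i\<le>n. adjacency (R i) = lin_comb n (P i) E) \<and>
        (\<forall>k\<le>n. E k = lin_comb n (\<lambda>i. Q k i / real (card X)) (\<lambda>i. adjacency (R i))))"

definition is_code :: "nat \<Rightarrow> 'x set \<Rightarrow> (nat \<Rightarrow> ('x \<times> 'x) set) \<Rightarrow> 'x set \<Rightarrow> bool" where
  "is_code d X R Y \<longleftrightarrow> Y \<subseteq> X \<and> (\<forall>i. 1 \<le> i \<and> i < d \<longrightarrow> (Y \<times> Y) \<inter> R i = {})"


subsection \<open>Generators of the Hermitian polar space\<close>

text \<open>Over a field with $q^2$ elements, whose involutory automorphism is $a \mapsto a^q$.\<close>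

definition hermitian_form ::
    "nat \<Rightarrow> ('f::{field,finite}^'v \<Rightarrow> 'f^'v \<Rightarrow> 'f) \<Rightarrow> bool" where
  "hermitian_form q h \<longleftrightarrow>
     (\<forall>u v w. h (u + v) w = h u w + h v w) \<and>
     (\<forall>a u w. h (a *s u) w = a * h u w) \<and>
     (\<forall>u w. h w u = h u w ^ q)"

definition nondegenerate_form :: "('f::{field,finite}^'v \<Rightarrow> 'f^'v \<Rightarrow> 'f) \<Rightarrow> bool" where
  "nondegenerate_form h \<longleftrightarrow> (\<forall>u. (\<forall>w. h u w = 0) \<longrightarrow> u = 0)"

definition totally_isotropic ::
    "('f::{field,finite}^'v \<Rightarrow> 'f^'v \<Rightarrow> 'f) \<Rightarrow> ('f^'v) set \<Rightarrow> bool" where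
  "totally_isotropic h U \<longleftrightarrow> vec.subspace U \<and> (\<forall>u\<in>U. \<forall>w\<in>U. h u w = 0)"

definition hermitian_case ::
    "nat \<Rightarrow> nat \<Rightarrow> ('f::{field,finite}^'v) set set \<Rightarrow>
     (nat \<Rightarrow> (('f^'v) set \<times> ('f^'v) set) set) \<Rightarrow> real \<Rightarrow> real \<Rightarrow> bool" where
  "hermitian_case q n X R b c \<longleftrightarrow>
     CARD('f) = q\<^sup>2 \<and> CARD('v) = 2 * n \<and>
     (\<exists>h. hermitian_form q h \<and> nondegenerate_form h \<and>
          X = {U. totally_isotropic h U \<and> vec.dim U = n}) \<and>
     R = (\<lambda>i. {(U, W) \<in> X \<times> X. vec.dim (U \<inter> W) + i = n}) \<and>
     b = - real q \<and> c = - 1"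


subsection \<open>One class of generators of the hyperbolic polar space\<close>

definition polar_form ::
    "('f::{field,finite}^'v \<Rightarrow> 'f) \<Rightarrow> 'f^'v \<Rightarrow> 'f^'v \<Rightarrow> 'f" where
  "polar_form Q u v = Q (u + v) - Q u - Q v"

definition quadratic_form :: "('f::{field,finite}^'v \<Rightarrow> 'f) \<Rightarrow> bool" where
  "quadratic_form Q \<longleftrightarrow>
     (\<forall>a u. Q (a *s u) = a\<^sup>2 * Q u) \<and>
     (\<forall>u v w. polar_form Q (u + v) w = polar_form Q u w + polar_form Q v w) \<and>
     (\<forall>a u w. polar_form Q (a *s u) w = a * polar_form Q u w)"

definition nondegenerate_quadratic :: "('f::{field,finite}^'v \<Rightarrow> 'f) \<Rightarrow> bool" where
  "nondegenerate_quadratic Q \<longleftrightarrow>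
     (\<forall>u. Q u = 0 \<and> (\<forall>w. polar_form Q u w = 0) \<longrightarrow> u = 0)"

definition totally_singular :: "('f::{field,finite}^'v \<Rightarrow> 'f) \<Rightarrow> ('f^'v) set \<Rightarrow> bool" where
  "totally_singular Q U \<longleftrightarrow> vec.subspace U \<and> (\<forall>u\<in>U. Q u = 0)"

definition witt_index :: "('f::{field,finite}^'v \<Rightarrow> 'f) \<Rightarrow> nat" where
  "witt_index Q = Max {vec.dim U | U. totally_singular Q U}"

definition same_class_rel :: "nat \<Rightarrow> ('f::{field,finite}^'v) set set \<Rightarrow>
     (('f^'v) set \<times> ('f^'v) set) set" where
  "same_class_rel m G = {(U, W) \<in> G \<times> G. even (vec.dim (U \<inter> W)) \<longleftrightarrow> even m}"

definition hyperbolic_case ::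
    "nat \<Rightarrow> nat \<Rightarrow> ('f::{field,finite}^'v) set set \<Rightarrow>
     (nat \<Rightarrow> (('f^'v) set \<times> ('f^'v) set) set) \<Rightarrow> real \<Rightarrow> real \<Rightarrow> bool" where
  "hyperbolic_case q n X R b c \<longleftrightarrow>
     (\<exists>m. CARD('f) = q \<and> CARD('v) = 2 * m \<and> n = m div 2 \<and>
        (\<exists>Q G. quadratic_form Q \<and> nondegenerate_quadratic Q \<and> witt_index Q = m \<and>
           G = {U. totally_singular Q U \<and> vec.dim U = m} \<and>
           X \<in> G // same_class_rel m G) \<and>
        R = (\<lambda>i. {(U, W) \<in> X \<times> X. vec.dim (U \<inter> W) + 2 * i = m}) \<and>
        b = (real q)\<^sup>2 \<and> c = (if even m then 1 / real q else real q))"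


subsection \<open>The bounds\<close>

definition qpoch :: "real \<Rightarrow> real \<Rightarrow> nat \<Rightarrow> real" where
  "qpoch x b i = (\<Prod>j<i. 1 - x * b ^ j)"

definition code_bound :: "nat \<Rightarrow> real \<Rightarrow> real \<Rightarrow> real \<Rightarrow> nat \<Rightarrow> nat \<Rightarrow> real" where
  "code_bound N q b c n d = real N * qpoch q b (d - 1) / qpoch (q * c * b ^ n) b (d - 1)"

text \<open>
  Only used for even \<open>d\<close> with \<open>1 \<le> d \<le> n\<close>, where the subtractions of natural numbers in the
  exponents are exact.
\<close>

definition even_factor :: "real \<Rightarrow> real \<Rightarrow> nat \<Rightarrow> nat \<Rightarrow> real" where
  "even_factor q b n d =
     ((b ^ (n - d + 2) - 1)
        + q * ((b ^ (n + d - 2) - 1) / (q * b ^ (d - 2) - 1)) * (b ^ (n - d + 1) - 1)) /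
     ((b ^ (n - d + 2) - 1)
        + q * ((b ^ (n + d - 2) - 1) / (b ^ (n + d - 1) - 1)) * (b ^ (n - d + 1) - 1))"

end

theory Submission
  imports Defs "HOL-Number_Theory.Residues" "HOL-Computational_Algebra.Polynomial"
begin

text \<open>
  Let \<open>M\<^sub>j\<close> be the element of the Bose--Mesner algebra whose entry at distance \<open>i\<close> is the Gaussian
  binomial coefficient of \<open>n - i\<close> over \<open>j\<close> to the base \<open>b\<close>. The intersection numbers of the
  distance-one graph \<open>A\<close> give \<open>A M\<^sub>j = \<theta>\<^sub>j M\<^sub>j + \<phi>\<^sub>j M\<^sub>j\<^sub>-\<^sub>1\<close>. As \<open>M\<^sub>n\<close> is the identity and \<open>M\<^sub>0\<close>
  the all-one matrix, \<open>A\<close> has the eigenvalues \<open>\<theta>\<^sub>0, \<dots>, \<theta>\<^sub>n\<close>, and \<open>M\<^sub>j\<close> acts on the eigenspace of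
  \<open>\<theta>\<^sub>k\<close> as the product of \<open>(\<theta>\<^sub>k - \<theta>\<^sub>s) / \<phi>\<^sub>s\<close> over \<open>j < s \<le> n\<close>. The entries of \<open>M\<^sub>j\<close> with
  \<open>j = n - d + 1\<close> vanish at distance at least \<open>d\<close>; if its eigenvalues are nonnegative, a multiple of
  it is a dual solution of Delsarte's linear program, whose value is the bound. For \<open>b = - q\<close> the
  eigenvalue on the eigenspace of \<open>\<theta>\<^sub>k\<close> has the sign of \<open>(- 1) ^ (k * (d - 1))\<close>, so for even \<open>d\<close> one
  takes \<open>(A - \<theta>\<^sub>1) M\<^sub>j\<^sub>+\<^sub>1\<close> instead, where \<open>\<theta>\<^sub>1\<close> is the least eigenvalue.

  The intersection numbers come from counting the singular vectors outside a generator: each of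
  them lies on a unique generator adjacent to the given one.
\<close>

section \<open>Parameters and Gaussian binomial coefficients\<close>

text \<open>Writing \<open>1 - q^(2*i)\<close> as \<open>(b^i - 1) * (- (b^i) - 1)\<close> with
  \<open>b = - q\<close> gives the intersection numbers of the Hermitian dual polar graph the same
  shape as those in case (ii), where the graph joins generators of one class at distance two in the
  dual polar graph. One set of parameters with a common denominator \<open>D\<close> then serves
  both. The price of a negative base is that the eigenvalues no longer decrease with their index.

  Since the \<open>theta k\<close> are distinct and \<open>phi\<close> does not vanish,
  \<open>M (gb (j - 1))\<close> is recovered from \<open>M (gb j)\<close> by applying
  \<open>A - theta j\<close> and dividing by \<open>phi j\<close>. This one relation yields the
  spectral decomposition, the eigenvalues of each \<open>M (gb j)\<close> and the closure of the
  Bose-Mesner algebra under products, all from the neighbour counts alone.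

  A scheme that merely shares the P- and Q-numbers has no subspaces to count. What passes to it is
  the sign of eigenvalues: a dual solution has the same coefficients on the primitive idempotents of
  both schemes.\<close>

definition gauss_binom :: "real \<Rightarrow> nat \<Rightarrow> nat \<Rightarrow> real" where
  "gauss_binom b N j = (\<Prod>r<j. (b ^ (N - r) - 1) / (b ^ (r + 1) - 1))"

lemma gauss_binom_0 [simp]: "gauss_binom b N 0 = 1"
  by (simp add: gauss_binom_def)

lemma gauss_binom_Suc_right:
  "gauss_binom b N (Suc j) = gauss_binom b N j * ((b ^ (N - j) - 1) / (b ^ Suc j - 1))"
  by (simp add: gauss_binom_def)

lemma gauss_binom_Suc_Suc:
  "gauss_binom b (Suc N) (Suc j) = (b ^ Suc N - 1) / (b ^ Suc j - 1) * gauss_binom b N j"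
proof -
  have "(\<Prod>r<Suc j. b ^ (Suc N - r) - 1) = (b ^ Suc N - 1) * (\<Prod>r<j. b ^ (N - r) - 1)"
    by (subst prod.lessThan_Suc_shift) simp
  then show ?thesis
    unfolding gauss_binom_def prod_dividef by simp
qed

lemma gauss_binom_eq_0: "N < j \<Longrightarrow> gauss_binom b N j = 0"
  unfolding gauss_binom_def by (rule prod_zero) (auto intro!: bexI[of _ N])

lemma gauss_binom_self:
  assumes "\<And>k. 1 \<le> k \<Longrightarrow> k \<le> N \<Longrightarrow> b ^ k \<noteq> 1"
  shows "gauss_binom b N N = 1"
  using assms
proof (induction N)
  case (Suc N)
  have "b ^ Suc N \<noteq> 1" by (rule Suc.prems) auto
  with Suc show ?case by (simp add: gauss_binom_Suc_Suc)
qed simp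

text \<open>The inequations keep away from zero the denominators of the Gaussian binomials, of
  \<open>phi\<close> and of the bound, as well as the differences of the \<open>theta k\<close>.
  \<open>D\<close> is \<open>1 - q^2\<close> in the Hermitian case and
  \<open>(q - 1) * (q^2 - 1)\<close> in the hyperbolic one.\<close>

locale scheme_parameters =
  fixes q b c D :: real and n :: nat
  assumes b_nonzero: "b \<noteq> 0"
    and D_nonzero: "D \<noteq> 0"
    and b_power_neq_1: "\<And>k. 1 \<le> k \<Longrightarrow> b ^ k \<noteq> 1"
    and q_b_power_neq_1: "\<And>r. q * b ^ r \<noteq> 1"
    and qc_b_power_neq_1: "\<And>k. 1 \<le> k \<Longrightarrow> q * c * b ^ k \<noteq> 1"
begin

text \<open>With \<open>num_farther\<close> and \<open>num_level\<close> below, these are the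
  intersection numbers \<open>c_i\<close>, \<open>b_i\<close>, \<open>a_i\<close> of a
  distance-regular graph; \<open>num_farther 0\<close> is the valency.\<close>

definition num_closer :: "nat \<Rightarrow> real" where
  "num_closer i = (b ^ i - 1) * (q / b * b ^ i - 1) / D"

definition num_farther :: "nat \<Rightarrow> real" where
  "num_farther i = q * b ^ (2 * i) * (b ^ (n - i) - 1) * (c * b ^ (n - i) - 1) / D"

definition num_level :: "nat \<Rightarrow> real" where
  "num_level i = num_farther 0 - num_farther i - num_closer i"

text \<open>\<open>theta 0\<close> is the valency. The exponent \<open>2 * n - k\<close> is exact
  for \<open>k \<le> n\<close>.\<close>

definition theta :: "nat \<Rightarrow> real" where
  "theta k = (q * c * b ^ (2 * n - k) + b ^ k - q * (1 + c) * b ^ n + q - 1) / D"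

text \<open>Forced by the recursion for \<open>step (gb j)\<close> read at distance
  \<open>n + 1 - j\<close>: there and one step further \<open>gb j\<close> vanishes, while
  \<open>gb j\<close> one step closer and \<open>gb (j - 1)\<close> are 1, so only
  \<open>num_closer\<close> survives.\<close>

definition phi :: "nat \<Rightarrow> real" where
  "phi j = num_closer (n + 1 - j)"

definition gb :: "nat \<Rightarrow> nat \<Rightarrow> real" where
  "gb j i = gauss_binom b (n - i) j"

text \<open>The entries of the product of \<open>A\<close> with the matrix whose entry at distance
  \<open>i\<close> is \<open>g i\<close>. The junk values \<open>g (0 - 1)\<close> and
  \<open>g (n + 1)\<close> are harmless, being multiplied by \<open>num_closer 0 = 0\<close> and
  \<open>num_farther n = 0\<close>.\<close>

definition step :: "(nat \<Rightarrow> real) \<Rightarrow> nat \<Rightarrow> real" where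
  "step g i = num_closer i * g (i - 1) + num_level i * g i + num_farther i * g (i + 1)"

definition eig :: "nat \<Rightarrow> nat \<Rightarrow> real" where
  "eig j k = (\<Prod>s = Suc j..n. (theta k - theta s) / phi s)"

lemma phi_nonzero: "1 \<le> j \<Longrightarrow> j \<le> n \<Longrightarrow> phi j \<noteq> 0"
proof -
  assume j: "1 \<le> j" "j \<le> n"
  then obtain u where u: "n + 1 - j = Suc u" by (metis Suc_diff_le Suc_eq_plus1)
  have "b ^ Suc u \<noteq> 1" "q * b ^ u \<noteq> 1"
    using b_power_neq_1[of "Suc u"] q_b_power_neq_1 by auto
  then show ?thesis
    unfolding phi_def num_closer_def u using b_nonzero D_nonzero by simp
qed

text \<open>With \<open>2 * n = k + s + e\<close> the constant terms cancel, and
  \<open>b^k - b^s\<close> is a factor of what remains,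
  \<open>(b^k - b^s) + q * c * (b^(s + e) - b^(k + e))\<close>.\<close>

lemma theta_diff:
  assumes "k \<le> n" "s \<le> n"
  shows "theta k - theta s = (b ^ k - b ^ s) * (1 - q * c * b ^ (2 * n - k - s)) / D"
proof -
  obtain e where e: "2 * n = k + s + e"
    using assms by (metis add_mono le_Suc_ex mult_2)
  then have *: "2 * n - k = s + e" "2 * n - s = k + e" "2 * n - k - s = e" by auto
  show ?thesis
    unfolding theta_def * by (simp add: power_add diff_divide_distrib[symmetric]) (simp add: algebra_simps)
qed

lemma theta_distinct:
  assumes "k < s" "s \<le> n"
  shows "theta k \<noteq> theta s"
proof -
  have "b ^ (s - k) \<noteq> 1" using assms b_power_neq_1[of "s - k"] by simp
  then have "b ^ k \<noteq> b ^ s"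
    using assms b_nonzero by (metis le_add_diff_inverse less_imp_le mult_cancel_left1 power_add power_not_zero)
  moreover have "q * c * b ^ (2 * n - k - s) \<noteq> 1"
    using assms by (intro qc_b_power_neq_1) simp
  ultimately have "theta k - theta s \<noteq> 0"
    using assms D_nonzero by (subst theta_diff) auto
  then show ?thesis by simp
qed

section \<open>The three-term recursion for Gaussian binomials\<close>

lemma gb_n: "i \<le> n \<Longrightarrow> gb n i = of_bool (i = 0)"
  using gauss_binom_self[of n b] b_power_neq_1
  by (cases "i = 0") (auto simp: gb_def gauss_binom_eq_0)

lemma gb_0 [simp]: "gb 0 i = 1"
  by (simp add: gb_def)

lemma gb_eq_0: "n < i + j \<Longrightarrow> i \<le> n \<Longrightarrow> gb j i = 0"
  by (simp add: gb_def gauss_binom_eq_0)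

lemma gb_diag: "j \<le> n \<Longrightarrow> gb j (n - j) = 1"
  using gauss_binom_self[of j b] b_power_neq_1 by (simp add: gb_def)

lemma step_gb_0: "i \<le> n \<Longrightarrow> step (gb 0) i = theta 0 * gb 0 i"
  by (simp add: step_def num_level_def theta_def num_farther_def mult_2 power_add)
     (simp add: algebra_simps diff_divide_distrib add_divide_distrib)

text \<open>For \<open>N = n - i\<close> below \<open>j\<close> everything vanishes, and at
  \<open>N = j\<close> only the closer neighbours contribute. Above \<open>j\<close> all values are
  multiples of one number \<open>y\<close>, and the claim becomes a polynomial identity, because
  \<open>b^n\<close> is the product of \<open>I\<close>, \<open>B\<close> and
  \<open>K\<close>.\<close>

lemma step_gb_Suc:
  assumes "i \<le> n" "j < n"
  shows "step (gb (Suc j)) i = theta (Suc j) * gb (Suc j) i + phi (Suc j) * gb j i"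
proof -
  define N where "N = n - i"
  have n: "n = i + N" using assms N_def by simp
  have Ni: "n - i = N" "n - Suc i = N - 1" "\<And>i'. i = Suc i' \<Longrightarrow> n - i' = Suc N"
    using assms N_def by auto
  consider "N < j" | "N = j" | k where "N = Suc j + k"
    by (metis less_iff_Suc_add linorder_neqE_nat add_Suc)
  then show ?thesis
  proof cases
    case 1
    then have "num_closer i * gb (Suc j) (i - 1) = 0"
      by (cases i) (auto simp: num_closer_def gb_def Ni gauss_binom_eq_0)
    moreover have "gb (Suc j) i = 0" "gb (Suc j) (i + 1) = 0" "gb j i = 0"
      using 1 by (auto simp: gb_def Ni gauss_binom_eq_0)
    ultimately show ?thesis by (simp add: step_def)
  next
    case 2
    then obtain i' where i': "i = Suc i'" using assms n by (cases i) auto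
    have "gb (Suc j) i = 0" "gb (Suc j) (i + 1) = 0"
      using 2 by (auto simp: gb_def Ni gauss_binom_eq_0)
    moreover have "gb j i = 1" "gb (Suc j) (i - 1) = 1"
      using gauss_binom_self[of j b] gauss_binom_self[of "Suc j" b] b_power_neq_1 2 Ni(3)[OF i'] Ni(1) i'
      by (auto simp: gb_def)
    moreover have "n + 1 - Suc j = i" using n 2 by simp
    then have "phi (Suc j) = num_closer i" by (simp only: phi_def)
    ultimately show ?thesis by (simp add: step_def)
  next
    case (3 k)
    define x where "x = gauss_binom b N j"
    define B K I where "B = b ^ Suc j" and "K = b ^ k" and "I = b ^ i"
    have bN: "b ^ N = B * K" using 3 by (simp add: B_def K_def power_add)
    have bn: "b ^ n = I * B * K" by (simp add: n power_add bN I_def)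
    have B1: "B \<noteq> 1" unfolding B_def by (rule b_power_neq_1) simp
    have BK1: "B * K \<noteq> 1" using b_power_neq_1[of N] 3 bN by simp
    have g0: "gb (Suc j) i = x * ((b * K - 1) / (B - 1))"
      using 3 by (simp add: gb_def Ni(1) gauss_binom_Suc_right Suc_diff_le K_def B_def x_def)
    have gm: "num_closer i * gb (Suc j) (i - 1) = num_closer i * ((b * (B * K) - 1) / (B - 1) * x)"
    proof (cases i)
      case (Suc i')
      then have "n - (i - 1) = Suc N" using Ni by simp
      then show ?thesis
        using bN by (simp add: gb_def gauss_binom_Suc_Suc B_def x_def)
    qed (simp add: num_closer_def)
    \<comment> \<open>The relation avoids dividing by \<open>B * K - 1\<close>, which is a factor of
      \<open>num_farther i\<close> and is absorbed there.\<close>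
    have gp: "(B * K - 1) * gb (Suc j) (i + 1) = (K - 1) * (x * ((b * K - 1) / (B - 1)))"
    proof -
      have N1: "N = Suc (j + k)" using 3 by simp
      have "gb (Suc j) i = (B * K - 1) / (B - 1) * gauss_binom b (j + k) j"
        using bN by (simp add: gb_def Ni N1 gauss_binom_Suc_Suc B_def)
      moreover have "gb (Suc j) (i + 1) = gauss_binom b (j + k) j * ((K - 1) / (B - 1))"
        by (simp add: gb_def Ni N1 gauss_binom_Suc_right K_def B_def)
      ultimately have "(B * K - 1) * gb (Suc j) (i + 1) = (K - 1) * gb (Suc j) i"
        by simp
      then show ?thesis by (simp only: g0)
    qed
    define y where "y = x / (B - 1)"
    have x: "x = y * (B - 1)" using B1 y_def by simp
    have xy: "x * ((b * K - 1) / (B - 1)) = (b * K - 1) * y" by (simp add: y_def)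
    have far: "num_farther i * gb (Suc j) (i + 1)
        = q * I ^ 2 * (c * (B * K) - 1) / D * ((K - 1) * (b * K - 1) * y)"
    proof -
      have "num_farther i = q * I ^ 2 * (c * (B * K) - 1) / D * (B * K - 1)"
        by (simp add: num_farther_def Ni bN I_def power_mult mult.commute[of 2])
      then have "num_farther i * gb (Suc j) (i + 1)
        = q * I ^ 2 * (c * (B * K) - 1) / D * ((B * K - 1) * gb (Suc j) (i + 1))" by simp
      also have "\<dots> = q * I ^ 2 * (c * (B * K) - 1) / D * ((K - 1) * (b * K - 1) * y)"
        unfolding gp xy by (simp only: mult.assoc)
      finally show ?thesis .
    qed
    have clo: "num_closer i = (I - 1) * (q / b * I - 1) / D"
      by (simp add: num_closer_def I_def)
    have lev: "num_level i = (q * (I * B * K - 1) * (c * (I * B * K) - 1)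
       - q * I ^ 2 * (B * K - 1) * (c * (B * K) - 1) - (I - 1) * (q / b * I - 1)) / D"
      unfolding num_level_def num_farther_def clo Ni bN using bn
      by (simp add: I_def[symmetric] power_mult mult.commute[of 2] diff_divide_distrib)
    have th: "theta (Suc j) = (q * c * (I ^ 2 * B * K ^ 2) + B - q * (1 + c) * (I * B * K) + q - 1) / D"
    proof -
      have "2 * n - Suc j = 2 * i + Suc j + 2 * k" using n 3 by simp
      then have "b ^ (2 * n - Suc j) = I ^ 2 * B * K ^ 2"
        by (simp only: power_add I_def B_def K_def power_mult mult.commute[of 2])
      then show ?thesis by (simp only: theta_def bn B_def[symmetric])
    qed
    have ph: "phi (Suc j) = (I * (b * K) - 1) * (q * I * K - 1) / D"
    proof -
      have "n + 1 - Suc j = i + Suc k" using n 3 by simp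
      then have "b ^ (n + 1 - Suc j) = I * (b * K)" by (simp add: power_add I_def K_def)
      then show ?thesis using b_nonzero by (simp add: phi_def num_closer_def)
    qed
    have gj: "gb j i = x" by (simp add: gb_def Ni x_def)
    have lhs: "step (gb (Suc j)) i = (I - 1) * (q / b * I - 1) / D * ((b * (B * K) - 1) * y)
       + num_level i * ((b * K - 1) * y) + q * I ^ 2 * (c * (B * K) - 1) / D * ((K - 1) * (b * K - 1) * y)"
      unfolding step_def gm far g0 unfolding clo x using B1 by simp
    have rhs: "theta (Suc j) * gb (Suc j) i + phi (Suc j) * gb j i
       = theta (Suc j) * ((b * K - 1) * y) + phi (Suc j) * (y * (B - 1))"
      unfolding g0 gj unfolding x using B1 by simp
    \<comment> \<open>Substituting \<open>q = b * p\<close> removes the quotient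
      \<open>q / b\<close>.\<close>
    define p where "p = q / b"
    have qp: "q = b * p" using b_nonzero by (simp add: p_def)
    have poly: "(I - 1) * (p * I - 1) * (b * (B * K) - 1)
        + (q * (I * B * K - 1) * (c * (I * B * K) - 1)
           - q * I ^ 2 * (B * K - 1) * (c * (B * K) - 1) - (I - 1) * (p * I - 1)) * (b * K - 1)
        + q * I ^ 2 * (c * (B * K) - 1) * ((K - 1) * (b * K - 1))
      = (q * c * (I ^ 2 * B * K ^ 2) + B - q * (1 + c) * (I * B * K) + q - 1) * (b * K - 1)
        + (I * (b * K) - 1) * (q * I * K - 1) * (B - 1)"
      unfolding qp by (simp add: algebra_simps power2_eq_square)
    have gather3: "u / D * (u' * y) + v / D * (v' * y) + w / D * (w' * y)
        = (u * u' + v * v' + w * w') * y / D" for u u' v v' w w' :: real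
      by (simp add: add_divide_distrib algebra_simps)
    have gather2: "u / D * (u' * y) + v / D * (y * v') = (u * u' + v * v') * y / D"
      for u u' v v' :: real
      by (simp add: add_divide_distrib algebra_simps)
    show ?thesis
      unfolding lhs rhs unfolding lev th ph p_def[symmetric] gather3 gather2 poly ..
  qed
qed

lemma eig_n [simp]: "eig n k = 1"
  by (simp add: eig_def)

lemma eig_rec: "j < n \<Longrightarrow> eig j k = (theta k - theta (Suc j)) / phi (Suc j) * eig (Suc j) k"
  unfolding eig_def by (subst prod.atLeast_Suc_atMost) auto

lemma eig_eq_0: "j < k \<Longrightarrow> k \<le> n \<Longrightarrow> eig j k = 0"
  unfolding eig_def by (rule prod_zero) (auto intro!: bexI[of _ k])

text \<open>Multiplied by \<open>card X\<close>, this ratio is the value of the one-term dual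
  solution. Lowering the index from \<open>Suc j\<close> to \<open>j\<close> contributes the single
  factor \<open>(1 - q * b^r) / (1 - q * c * b^(n + r))\<close>; everything else cancels.\<close>

lemma gb_over_eig:
  assumes "r \<le> n"
  shows "gb (n - r) 0 / eig (n - r) 0 = qpoch q b r / qpoch (q * c * b ^ n) b r"
  using assms
proof (induction r)
  case 0
  then show ?case by (simp add: gb_n qpoch_def)
next
  case (Suc r)
  define j where "j = n - Suc r"
  have j: "n - r = Suc j" "j < n" "n = Suc j + r" using Suc.prems by (auto simp: j_def)
  define B U where "B = b ^ Suc j" and "U = b ^ r"
  have ne: "B \<noteq> 1" "b * U \<noteq> 1" "q * U \<noteq> 1"
    using b_power_neq_1[of "Suc j"] b_power_neq_1[of "Suc r"] q_b_power_neq_1[of r]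
    by (auto simp: B_def U_def)
  have th: "theta 0 - theta (Suc j) = (1 - B) * (1 - q * c * (b ^ n * U)) / D"
  proof -
    have "2 * n - 0 - Suc j = n + r" using j by simp
    with theta_diff[of 0 "Suc j"] j(2) show ?thesis by (simp add: B_def U_def power_add)
  qed
  have ph: "phi (Suc j) = (b * U - 1) * (q * U - 1) / D"
  proof -
    have "n + 1 - Suc j = Suc r" using j by simp
    then show ?thesis using b_nonzero by (simp add: phi_def num_closer_def U_def)
  qed
  have ne2: "q * c * (b ^ n * U) \<noteq> 1"
    using qc_b_power_neq_1[of "n + r"] j(2) by (simp add: U_def power_add)
  have g: "gb j 0 = gb (Suc j) 0 * ((B - 1) / (b * U - 1))"
  proof -
    have "n - j = Suc r" using j by simp
    then show ?thesis using ne by (simp add: gb_def gauss_binom_Suc_right U_def B_def)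
  qed
  have e: "eig j 0 = (theta 0 - theta (Suc j)) / phi (Suc j) * eig (Suc j) 0"
    using j(2) by (rule eig_rec)
  have "gb j 0 / eig j 0 = gb (Suc j) 0 / eig (Suc j) 0
      * (((B - 1) / (b * U - 1)) * phi (Suc j) / (theta 0 - theta (Suc j)))"
    unfolding g e by (simp add: ac_simps)
  also have "((B - 1) / (b * U - 1)) * phi (Suc j) / (theta 0 - theta (Suc j))
      = (1 - q * U) / (1 - q * c * (b ^ n * U))"
  proof -
    have "(- x / w) * (w * v / D) / (x * z / D) = - v / z"
      if "x \<noteq> 0" "w \<noteq> 0" for x w v z :: real
      using that D_nonzero by simp
    from this[of "1 - B" "b * U - 1" "q * U - 1"] show ?thesis
      unfolding th ph using ne by simp
  qed
  also have "gb (Suc j) 0 / eig (Suc j) 0 = qpoch q b r / qpoch (q * c * b ^ n) b r"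
    using Suc j(1) by simp
  finally show ?case
    unfolding j_def[symmetric] by (simp add: qpoch_def U_def mult.assoc)
qed

end

section \<open>Bose--Mesner algebras and the linear programming bound\<close>

definition act :: "'x set \<Rightarrow> 'x sqmat \<Rightarrow> ('x \<Rightarrow> real) \<Rightarrow> 'x \<Rightarrow> real" where
  "act X M v x = (\<Sum>y\<in>X. M x y * v y)"

definition quad_form :: "'x set \<Rightarrow> 'x sqmat \<Rightarrow> ('x \<Rightarrow> real) \<Rightarrow> real" where
  "quad_form X M v = (\<Sum>x\<in>X. v x * act X M v x)"

lemma act_mat_mult: "act X (mat_mult X M N) v x = act X M (act X N v) x"
proof -
  have "act X (mat_mult X M N) v x = (\<Sum>y\<in>X. \<Sum>z\<in>X. M x z * N z y * v y)"
    by (simp add: act_def mat_mult_def sum_distrib_right)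
  also have "\<dots> = (\<Sum>z\<in>X. \<Sum>y\<in>X. M x z * N z y * v y)"
    by (rule sum.swap)
  finally show ?thesis by (simp add: act_def sum_distrib_left mult.assoc)
qed

lemma act_cong: "(\<And>y. y \<in> X \<Longrightarrow> v y = w y) \<Longrightarrow> act X M v x = act X M w x"
  by (simp add: act_def)

lemma act_scale: "act X M (\<lambda>y. a * v y) x = a * act X M v x"
  by (simp add: act_def sum_distrib_left mult.left_commute)

lemma act_diff: "act X M (\<lambda>y. v y - w y) x = act X M v x - act X M w x"
  by (simp add: act_def sum_subtractf right_diff_distrib)

lemma act_sum: "act X M (\<lambda>y. \<Sum>k\<in>K. v k y) x = (\<Sum>k\<in>K. act X M (v k) x)"
  unfolding act_def sum_distrib_left by (rule sum.swap)

lemma act_symmetric: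
  assumes "\<And>x y. M x y = M y x"
  shows "(\<Sum>x\<in>X. w x * act X M v x) = (\<Sum>x\<in>X. act X M w x * v x)"
proof -
  have "(\<Sum>x\<in>X. w x * act X M v x) = (\<Sum>x\<in>X. \<Sum>y\<in>X. w x * (M x y * v y))"
    by (simp add: act_def sum_distrib_left)
  also have "\<dots> = (\<Sum>y\<in>X. \<Sum>x\<in>X. w x * (M x y * v y))"
    by (rule sum.swap)
  also have "\<dots> = (\<Sum>y\<in>X. act X M w y * v y)"
    unfolding act_def sum_distrib_right
    by (intro sum.cong refl) (simp add: assms mult_ac)
  finally show ?thesis .
qed

lemma mat_mult_assoc:
  "mat_mult X (mat_mult X L M) N = mat_mult X L (mat_mult X M N)"
proof (intro ext)
  fix x y
  have "mat_mult X (mat_mult X L M) N x y = (\<Sum>z\<in>X. \<Sum>u\<in>X. L x u * M u z * N z y)"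
    by (simp add: mat_mult_def sum_distrib_right)
  also have "\<dots> = (\<Sum>u\<in>X. \<Sum>z\<in>X. L x u * M u z * N z y)"
    by (rule sum.swap)
  finally show "mat_mult X (mat_mult X L M) N x y = mat_mult X L (mat_mult X M N) x y"
    by (simp add: mat_mult_def sum_distrib_left mult.assoc)
qed

lemma mat_mult_diff_left:
  "mat_mult X (\<lambda>x y. M x y - M' x y) N = (\<lambda>x y. mat_mult X M N x y - mat_mult X M' N x y)"
  by (simp add: mat_mult_def sum_subtractf left_diff_distrib)

lemma mat_mult_diff_right:
  "mat_mult X M (\<lambda>x y. N x y - N' x y) = (\<lambda>x y. mat_mult X M N x y - mat_mult X M N' x y)"
  by (simp add: mat_mult_def sum_subtractf right_diff_distrib)

lemma mat_mult_transpose: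
  assumes "\<And>x y. M x y = M y x" "\<And>x y. N x y = N y x"
  shows "mat_mult X M N x y = mat_mult X N M y x"
proof -
  have "M x z * N z y = N y z * M z x" for z
    using assms(1)[of x z] assms(2)[of z y] by simp
  then show ?thesis by (simp add: mat_mult_def)
qed

section \<open>Primitive idempotents and quadratic forms\<close>

lemma bose_mesner_symmetric:
  assumes "\<And>i. i \<le> n \<Longrightarrow> sym (R i)" "E \<in> bose_mesner n R"
  shows "E x y = E y x"
proof -
  have "((x, y) \<in> R i) = ((y, x) \<in> R i)" if "i \<le> n" for i
    using assms(1)[OF that] by (auto dest: symD)
  then show ?thesis
    using assms(2) by (auto simp: bose_mesner_def lin_comb_def adjacency_def intro!: sum.cong)
qed

lemma bose_mesner_diff:
  assumes "E \<in> bose_mesner n R" "F \<in> bose_mesner n R"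
  shows "(\<lambda>x y. E x y - F x y) \<in> bose_mesner n R"
proof -
  obtain f g where "E = lin_comb n f (\<lambda>i. adjacency (R i))" "F = lin_comb n g (\<lambda>i. adjacency (R i))"
    using assms by (auto simp: bose_mesner_def)
  then have "(\<lambda>x y. E x y - F x y) = lin_comb n (\<lambda>i. f i - g i) (\<lambda>i. adjacency (R i))"
    by (simp add: lin_comb_def sum_subtractf left_diff_distrib)
  then show ?thesis by (auto simp: bose_mesner_def)
qed

text \<open>Otherwise \<open>G\<close> and \<open>E - G\<close> would split \<open>E\<close> into
  two nonzero orthogonal idempotents.\<close>

lemma primitive_idempotent_absorbs:
  assumes E: "E \<in> primitive_idempotents n X R" and G: "G \<in> idempotents n X R"
    and "mat_mult X E G = G" "mat_mult X G E = G"
  shows "G = (\<lambda>x y. 0) \<or> G = E"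
proof (rule ccontr)
  assume *: "\<not> ?thesis"
  let ?H = "\<lambda>x y. E x y - G x y"
  have EE: "mat_mult X E E = E" "E \<in> bose_mesner n R" and GG: "mat_mult X G G = G" "G \<in> bose_mesner n R"
    using E G by (auto simp: primitive_idempotents_def idempotents_def)
  have "mat_mult X ?H ?H = ?H"
    by (simp add: mat_mult_diff_left mat_mult_diff_right EE GG assms(3,4))
  then have "?H \<in> idempotents n X R"
    using bose_mesner_diff[OF EE(2) GG(2)] by (simp add: idempotents_def)
  moreover have "?H \<noteq> (\<lambda>x y. 0)"
  proof
    assume "?H = (\<lambda>x y. 0)"
    then have "E x y - G x y = 0" for x y by (rule fun_cong[THEN fun_cong])
    then have "G = E" by (intro ext) simp
    with * show False by simp
  qed
  moreover have "mat_mult X G ?H = (\<lambda>x y. 0)" "mat_mult X ?H G = (\<lambda>x y. 0)"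
    by (simp_all add: mat_mult_diff_left mat_mult_diff_right GG assms(3,4))
  moreover have "E = (\<lambda>x y. G x y + ?H x y)" by simp
  ultimately show False
    using E G * unfolding primitive_idempotents_def by blast
qed

text \<open>Symmetric matrices with a symmetric product commute, so the product is an idempotent
  absorbed by both \<open>E\<close> and \<open>F\<close>. By primitivity it is zero or equal to
  both.\<close>

lemma primitive_idempotents_orthogonal:
  assumes sym: "\<And>i. i \<le> n \<Longrightarrow> sym (R i)"
    and closed: "\<And>E F. E \<in> bose_mesner n R \<Longrightarrow> F \<in> bose_mesner n R \<Longrightarrow> mat_mult X E F \<in> bose_mesner n R"
    and E: "E \<in> primitive_idempotents n X R" and F: "F \<in> primitive_idempotents n X R"
    and "E \<noteq> F"
  shows "mat_mult X E F = (\<lambda>x y. 0)"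
proof -
  let ?G = "mat_mult X E F"
  have EB: "mat_mult X E E = E" "E \<in> bose_mesner n R" and FB: "mat_mult X F F = F" "F \<in> bose_mesner n R"
    using E F by (auto simp: primitive_idempotents_def idempotents_def)
  have comm: "mat_mult X F E = ?G"
  proof (intro ext)
    fix x y
    have "mat_mult X F E x y = ?G y x"
      by (rule mat_mult_transpose) (rule bose_mesner_symmetric[OF sym], (assumption | rule EB FB)+)+
    also have "\<dots> = ?G x y"
      by (rule bose_mesner_symmetric[OF sym closed[OF EB(2) FB(2)]])
    finally show "mat_mult X F E x y = ?G x y" .
  qed
  have 1: "mat_mult X E ?G = ?G" by (simp add: mat_mult_assoc[symmetric] EB)
  have 2: "mat_mult X ?G F = ?G" by (simp add: mat_mult_assoc FB)
  have 3: "mat_mult X ?G E = ?G" by (simp add: comm[symmetric] mat_mult_assoc EB)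
  have 4: "mat_mult X F ?G = ?G" by (simp add: comm[symmetric] mat_mult_assoc[symmetric] FB)
  have "mat_mult X ?G ?G = ?G" using 1 2 4 by (simp add: mat_mult_assoc)
  then have G: "?G \<in> idempotents n X R"
    using closed[OF EB(2) FB(2)] by (simp add: idempotents_def)
  show ?thesis
    using primitive_idempotent_absorbs[OF E G 1 3] primitive_idempotent_absorbs[OF F G 4 2] \<open>E \<noteq> F\<close>
    by auto
qed

lemma lin_comb_lin_comb:
  assumes "\<And>i. i \<le> n \<Longrightarrow> A i = lin_comb n (P i) E"
  shows "lin_comb n a A = lin_comb n (\<lambda>k. \<Sum>i\<le>n. a i * P i k) E"
proof (intro ext)
  fix x y
  have "lin_comb n a A x y = (\<Sum>i\<le>n. \<Sum>k\<le>n. a i * P i k * E k x y)"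
    by (simp add: lin_comb_def[of _ a] assms) (simp add: lin_comb_def sum_distrib_left mult.assoc)
  also have "\<dots> = (\<Sum>k\<le>n. \<Sum>i\<le>n. a i * P i k * E k x y)" by (rule sum.swap)
  finally show "lin_comb n a A x y = lin_comb n (\<lambda>k. \<Sum>i\<le>n. a i * P i k) E x y"
    by (simp add: lin_comb_def sum_distrib_right)
qed

lemma act_lin_comb: "act X (lin_comb n a A) v x = (\<Sum>i\<le>n. a i * act X (A i) v x)"
proof -
  have "act X (lin_comb n a A) v x = (\<Sum>y\<in>X. \<Sum>i\<le>n. a i * A i x y * v y)"
    by (simp add: act_def lin_comb_def sum_distrib_right)
  also have "\<dots> = (\<Sum>i\<le>n. \<Sum>y\<in>X. a i * A i x y * v y)" by (rule sum.swap)
  finally show ?thesis by (simp add: act_def sum_distrib_left mult.assoc)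
qed

lemma quad_form_lin_comb: "quad_form X (lin_comb n a A) v = (\<Sum>i\<le>n. a i * quad_form X (A i) v)"
proof -
  have "quad_form X (lin_comb n a A) v = (\<Sum>x\<in>X. \<Sum>i\<le>n. a i * (v x * act X (A i) v x))"
    by (simp add: quad_form_def act_lin_comb sum_distrib_left mult.left_commute)
  also have "\<dots> = (\<Sum>i\<le>n. \<Sum>x\<in>X. a i * (v x * act X (A i) v x))" by (rule sum.swap)
  finally show ?thesis by (simp add: quad_form_def sum_distrib_left)
qed

text \<open>The form is the squared length of \<open>act X E v\<close>.\<close>

lemma quad_form_idempotent_nonneg:
  assumes "\<And>x y. E x y = E y x" "mat_mult X E E = E"
  shows "0 \<le> quad_form X E v"
proof -
  have "quad_form X E v = (\<Sum>x\<in>X. v x * act X E (act X E v) x)"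
    by (simp add: quad_form_def act_mat_mult[symmetric] assms(2))
  also have "\<dots> = (\<Sum>x\<in>X. act X E v x * act X E v x)"
    by (rule act_symmetric) (rule assms(1))
  also have "\<dots> \<ge> 0" by (intro sum_nonneg) simp
  finally show ?thesis .
qed

text \<open>
  Positive semidefiniteness of an element of the Bose--Mesner algebra is the nonnegativity of the
  numbers \<open>\<Sum>i\<le>n. a i * P i k\<close>, hence is shared by all schemes with the same parameters.
\<close>

lemma psd_transfer:
  assumes fin: "finite X"
    and sym: "\<And>i. i \<le> n \<Longrightarrow> sym (R i)" and sym': "\<And>i. i \<le> n \<Longrightarrow> sym (R' i)"
    and supp: "\<And>i. i \<le> n \<Longrightarrow> R i \<subseteq> X \<times> X"
    and closed: "\<And>E F. E \<in> bose_mesner n R \<Longrightarrow> F \<in> bose_mesner n R \<Longrightarrow> mat_mult X E F \<in> bose_mesner n R"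
    and PQ: "PQ_numbers n X R P Q" and PQ': "PQ_numbers n X' R' P Q"
    and psd: "\<And>v. 0 \<le> quad_form X (lin_comb n a (\<lambda>i. adjacency (R i))) v"
  shows "0 \<le> quad_form X' (lin_comb n a (\<lambda>i. adjacency (R' i))) v"
proof -
  define l where "l k = (\<Sum>i\<le>n. a i * P i k)" for k
  obtain E where E: "bij_betw E {..n} (primitive_idempotents n X R)"
    "\<And>i. i \<le> n \<Longrightarrow> adjacency (R i) = lin_comb n (P i) E"
    using PQ by (auto simp: PQ_numbers_def)
  obtain E' where E': "bij_betw E' {..n} (primitive_idempotents n X' R')"
    "\<And>i. i \<le> n \<Longrightarrow> adjacency (R' i) = lin_comb n (P i) E'"
    using PQ' by (auto simp: PQ_numbers_def)
  have M: "lin_comb n a (\<lambda>i. adjacency (R i)) = lin_comb n l E"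
    unfolding l_def by (rule lin_comb_lin_comb) (rule E(2))
  have M': "lin_comb n a (\<lambda>i. adjacency (R' i)) = lin_comb n l E'"
    unfolding l_def by (rule lin_comb_lin_comb) (rule E'(2))
  have prim: "E k \<in> primitive_idempotents n X R" if "k \<le> n" for k
    using E(1) that by (auto simp: bij_betw_def)
  have l_nonneg: "0 \<le> l k" if k: "k \<le> n" for k
  proof -
    have Ek: "E k \<in> bose_mesner n R" "mat_mult X (E k) (E k) = E k" "E k \<noteq> (\<lambda>x y. 0)"
      using prim[OF k] by (auto simp: primitive_idempotents_def idempotents_def)
    then obtain x0 y0 where x0: "E k x0 y0 \<noteq> 0" by (auto simp: fun_eq_iff)
    then have "x0 \<in> X"
      using Ek(1) supp by (force simp: bose_mesner_def lin_comb_def adjacency_def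
          elim!: sum.not_neutral_contains_not_neutral)
    \<comment> \<open>A nonzero column of \<open>E k\<close> is fixed by \<open>E k\<close> and
      killed by the other idempotents, so testing with it isolates \<open>l k\<close>.\<close>
    define v where "v x = E k x y0" for x
    have Ev: "act X (E j) v x = (if j = k then v x else 0)" if "j \<le> n" for j x
    proof -
      have "act X (E j) v x = mat_mult X (E j) (E k) x y0"
        by (simp add: act_def mat_mult_def v_def)
      moreover have "mat_mult X (E j) (E k) = (\<lambda>x y. 0)" if "j \<noteq> k"
        using E(1) that \<open>j \<le> n\<close> k
        by (intro primitive_idempotents_orthogonal[OF sym closed prim prim])
           (auto simp: bij_betw_def dest: inj_onD)
      ultimately show ?thesis using Ek(2) by (simp add: v_def)
    qed
    have "0 \<le> quad_form X (lin_comb n l E) v" using psd M by simp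
    also have "\<dots> = (\<Sum>j\<le>n. l j * quad_form X (E j) v)" by (rule quad_form_lin_comb)
    also have "\<dots> = (\<Sum>j\<le>n. if j = k then l k * (\<Sum>x\<in>X. (v x)\<^sup>2) else 0)"
      by (intro sum.cong refl) (simp add: quad_form_def Ev power2_eq_square)
    also have "\<dots> = l k * (\<Sum>x\<in>X. (v x)\<^sup>2)" using k by simp
    finally have "0 \<le> l k * (\<Sum>x\<in>X. (v x)\<^sup>2)" .
    moreover have "0 < (\<Sum>x\<in>X. (v x)\<^sup>2)"
      using fin \<open>x0 \<in> X\<close> x0 by (intro sum_pos2[of _ x0]) (auto simp: v_def)
    ultimately show ?thesis by (simp add: zero_le_mult_iff)
  qed
  have "0 \<le> quad_form X' (E' k) v" if "k \<le> n" for k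
  proof -
    have "E' k \<in> primitive_idempotents n X' R'" using E'(1) that by (auto simp: bij_betw_def)
    then have *: "E' k \<in> bose_mesner n R'" "mat_mult X' (E' k) (E' k) = E' k"
      by (auto simp: primitive_idempotents_def idempotents_def)
    show ?thesis
      by (rule quad_form_idempotent_nonneg[OF _ *(2)]) (rule bose_mesner_symmetric[OF sym' *(1)])
  qed
  then show ?thesis
    unfolding M' quad_form_lin_comb by (intro sum_nonneg mult_nonneg_nonneg l_nonneg) auto
qed

lemma lin_comb_adjacency_apply:
  assumes disj: "\<And>i j. i \<le> n \<Longrightarrow> j \<le> n \<Longrightarrow> i \<noteq> j \<Longrightarrow> R i \<inter> R j = {}"
    and "i \<le> n" "(x, y) \<in> R i"
  shows "lin_comb n a (\<lambda>i. adjacency (R i)) x y = a i"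
proof -
  have "(\<Sum>j\<le>n. a j * of_bool ((x, y) \<in> R j)) = (\<Sum>j\<le>n. if j = i then a i else 0)"
    using assms disj[of i] by (intro sum.cong refl) (auto 4 3)
  then show ?thesis using assms by (simp add: lin_comb_def adjacency_def)
qed

text \<open>The linear programming bound, with \<open>f\<close> the dual feasible solution.\<close>

lemma code_card_le:
  assumes fin: "finite X" and "X \<noteq> {}"
    and part: "(\<Union>i\<le>n. R i) = X \<times> X"
    and disj: "\<And>i j. i \<le> n \<Longrightarrow> j \<le> n \<Longrightarrow> i \<noteq> j \<Longrightarrow> R i \<inter> R j = {}"
    and R0: "R 0 = Id_on X"
    and psd: "\<And>v. 0 \<le> quad_form X (lin_comb n (\<lambda>i. f i - 1) (\<lambda>i. adjacency (R i))) v"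
    and f0: "\<And>i. d \<le> i \<Longrightarrow> i \<le> n \<Longrightarrow> f i = 0"
    and "d \<le> n" and code: "is_code d X R Y"
  shows "real (card Y) \<le> f 0"
proof -
  let ?M = "lin_comb n (\<lambda>i. f i - 1) (\<lambda>i. adjacency (R i))"
  have nonempty: "real (card Z) \<le> f 0" if "is_code d X R Z" "Z \<noteq> {}" for Z
  proof -
    have ZX: "Z \<subseteq> X" and Zd: "\<And>i. 1 \<le> i \<Longrightarrow> i < d \<Longrightarrow> (Z \<times> Z) \<inter> R i = {}"
      using that by (auto simp: is_code_def)
    have finZ: "finite Z" using ZX fin by (rule finite_subset)
    \<comment> \<open>At the indicator of \<open>Z\<close> the form equals
      \<open>card Z * (f 0 - card Z)\<close>: diagonal entries are \<open>f 0 - 1\<close>, and all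
      others are -1 because distinct points of a code are at a distance where \<open>f\<close>
      vanishes.\<close>
    define v :: "'a \<Rightarrow> real" where "v x = of_bool (x \<in> Z)" for x
    have diag: "?M x x = f 0 - 1" if "x \<in> Z" for x
      using ZX that R0 by (subst lin_comb_adjacency_apply[OF disj, where i = 0]) auto
    have off: "?M x y = - 1" if xy: "x \<in> Z" "y \<in> Z" "x \<noteq> y" for x y
    proof -
      obtain i where i: "i \<le> n" "(x, y) \<in> R i" using part xy ZX by blast
      have "(x, y) \<notin> R 0" using R0 xy by auto
      then have "i \<noteq> 0" using i by (cases "i = 0") auto
      then have "d \<le> i" using Zd[of i] xy i by (cases "i < d") auto
      then show ?thesis
        using i f0 by (subst lin_comb_adjacency_apply[OF disj, where i = i]) auto
    qed
    have row: "act X ?M v x = f 0 - real (card Z)" if "x \<in> Z" for x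
    proof -
      have "act X ?M v x = (\<Sum>y\<in>Z. ?M x y)"
        unfolding act_def v_def using ZX fin
        by (intro sum.mono_neutral_cong_right) auto
      also have "\<dots> = (\<Sum>y\<in>Z. (if y = x then f 0 else 0) - 1)"
        using that by (intro sum.cong refl) (auto simp: diag off)
      also have "\<dots> = f 0 - real (card Z)"
        using that finZ by (simp add: sum_subtractf)
      finally show ?thesis .
    qed
    have "0 \<le> quad_form X ?M v" by (rule psd)
    also have "\<dots> = (\<Sum>x\<in>Z. act X ?M v x)"
      unfolding quad_form_def using ZX fin
      by (intro sum.mono_neutral_cong_right) (auto simp: v_def)
    also have "\<dots> = real (card Z) * (f 0 - real (card Z))" by (simp add: row)
    finally have "0 \<le> real (card Z) * (f 0 - real (card Z))" .
    moreover have "0 < real (card Z)" using that finZ by (simp add: card_gt_0_iff)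
    ultimately show ?thesis by (simp add: zero_le_mult_iff)
  qed
  show ?thesis
  proof (cases "Y = {}")
    case True
    \<comment> \<open>For the empty code the claim is \<open>0 \<le> f 0\<close>, which follows from
      the bound for a one-point code.\<close>
    obtain x where "x \<in> X" using \<open>X \<noteq> {}\<close> by blast
    have "is_code d X R {x}"
      unfolding is_code_def
    proof (intro conjI allI impI)
      fix i assume "1 \<le> i \<and> i < d"
      then have "R 0 \<inter> R i = {}" using \<open>d \<le> n\<close> by (intro disj) auto
      moreover have "(x, x) \<in> R 0" using R0 \<open>x \<in> X\<close> by auto
      ultimately show "{x} \<times> {x} \<inter> R i = {}" by blast
    qed (use \<open>x \<in> X\<close> in simp)
    with nonempty[of "{x}"] True show ?thesis by simp
  qed (use code nonempty in blast)
qed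


text \<open>The intersection numbers enter as one identity for an arbitrary function
  \<open>g\<close> of the distance, which is the form in which a product with \<open>A\<close> uses
  them. In the hyperbolic case \<open>del\<close> is half the distance in the dual polar
  graph.\<close>

locale distance_scheme = scheme_parameters q b c D n for q b c D :: real and n :: nat +
  fixes X :: "'x set" and del :: "'x \<Rightarrow> 'x \<Rightarrow> nat" and R :: "nat \<Rightarrow> ('x \<times> 'x) set"
  assumes finite_X: "finite X"
    and del_sym: "\<And>x y. x \<in> X \<Longrightarrow> y \<in> X \<Longrightarrow> del x y = del y x"
    and del_le: "\<And>x y. x \<in> X \<Longrightarrow> y \<in> X \<Longrightarrow> del x y \<le> n"
    and del_0_iff: "\<And>x y. x \<in> X \<Longrightarrow> y \<in> X \<Longrightarrow> del x y = 0 \<longleftrightarrow> x = y"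
    and R_eq: "\<And>i. i \<le> n \<Longrightarrow> R i = {(x, y) \<in> X \<times> X. del x y = i}"
    and neighbour_sum: "\<And>g x y. x \<in> X \<Longrightarrow> y \<in> X \<Longrightarrow>
      (\<Sum>z\<in>{z \<in> X. del y z = Suc 0}. g (del x z)) = step g (del x y)"
begin

section \<open>Matrices whose entries depend on the distance\<close>

definition M :: "(nat \<Rightarrow> real) \<Rightarrow> 'x sqmat" where
  "M g = lin_comb n g (\<lambda>i. adjacency (R i))"

definition A :: "'x sqmat" where
  "A = M (\<lambda>i. of_bool (i = Suc 0))"

lemma M_apply: "M g x y = (if x \<in> X \<and> y \<in> X then g (del x y) else 0)"
proof -
  have "M g x y = (\<Sum>i\<le>n. if del x y = i then (if x \<in> X \<and> y \<in> X then g i else 0) else 0)"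
    unfolding M_def lin_comb_def adjacency_def by (intro sum.cong refl) (auto simp: R_eq)
  then show ?thesis using del_le[of x y] by simp
qed

lemma M_cong: "(\<And>i. i \<le> n \<Longrightarrow> g i = h i) \<Longrightarrow> M g = M h"
  by (auto simp: M_apply fun_eq_iff del_le)

lemma M_symmetric: "M g x y = M g y x"
  by (auto simp: M_apply del_sym)

lemma bose_mesner_eq: "bose_mesner n R = range M"
  by (auto simp: bose_mesner_def M_def)

lemma M_step: "mat_mult X (M g) A = M (step g)"
proof (intro ext)
  fix x y
  have "mat_mult X (M g) A x y = (\<Sum>z\<in>{z \<in> X. del y z = Suc 0}. g (del x z))" if xy: "x \<in> X" "y \<in> X"
    unfolding mat_mult_def using finite_X xy
    by (intro sum.mono_neutral_cong_right) (auto simp: A_def M_apply del_sym)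
  then show "mat_mult X (M g) A x y = M (step g) x y"
    by (cases "x \<in> X \<and> y \<in> X") (auto simp: neighbour_sum M_apply mat_mult_def A_def)
qed

lemma M_step_left: "mat_mult X A (M g) = M (step g)"
proof (intro ext)
  fix x y
  have "mat_mult X A (M g) x y = mat_mult X (M g) A y x"
    unfolding A_def by (rule mat_mult_transpose) (rule M_symmetric)+
  then show "mat_mult X A (M g) x y = M (step g) x y"
    by (simp add: M_step M_symmetric[of _ y x])
qed

lemma M_add_scale: "M (\<lambda>i. r * g i + s * h i) x y = r * M g x y + s * M h x y"
  by (simp add: M_apply)

lemma M_gb_rec:
  assumes "j < n"
  shows "M (step (gb (Suc j))) x y = theta (Suc j) * M (gb (Suc j)) x y + phi (Suc j) * M (gb j) x y"
proof -
  have "M (step (gb (Suc j))) = M (\<lambda>i. theta (Suc j) * gb (Suc j) i + phi (Suc j) * gb j i)"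
    using assms by (intro M_cong step_gb_Suc)
  then show ?thesis by (simp add: M_add_scale)
qed

lemma act_M_gb_rec:
  assumes "j < n"
  shows "act X (M (step (gb (Suc j)))) v x
    = theta (Suc j) * act X (M (gb (Suc j))) v x + phi (Suc j) * act X (M (gb j)) v x"
  by (simp add: act_def M_gb_rec[OF assms] distrib_right sum.distrib sum_distrib_left mult.assoc)

lemma act_M_gb_n: "x \<in> X \<Longrightarrow> act X (M (gb n)) v x = v x"
proof -
  assume x: "x \<in> X"
  have "act X (M (gb n)) v x = (\<Sum>y\<in>X. if y = x then v x else 0)"
    unfolding act_def using x
    by (intro sum.cong refl) (auto simp: M_apply gb_n del_le del_0_iff)
  then show ?thesis using x finite_X by simp
qed

section \<open>Spectral decomposition\<close>

definition eigenvector :: "nat \<Rightarrow> ('x \<Rightarrow> real) \<Rightarrow> bool" where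
  "eigenvector k w \<longleftrightarrow> (\<forall>x\<in>X. act X A w x = theta k * w x)"

lemma eigenvector_scale: "eigenvector k w \<Longrightarrow> eigenvector k (\<lambda>x. r * w x)"
  by (simp add: eigenvector_def act_scale)

text \<open>If \<open>M (gb j) v\<close> is a sum of eigenvectors \<open>w k\<close>, then dividing
  each by \<open>theta k - theta (Suc j)\<close> and multiplying by \<open>phi (Suc j)\<close> gives
  vectors that \<open>A - theta (Suc j)\<close> maps to \<open>phi (Suc j) * w k\<close>.
  Subtracting them from \<open>M (gb (Suc j)) v\<close> leaves a vector killed by
  \<open>A - theta (Suc j)\<close>. At \<open>j = n\<close> this decomposes \<open>v\<close>
  itself.\<close>

lemma act_M_gb_decomposition:
  assumes "j \<le> n"
  shows "\<exists>w. (\<forall>k\<le>j. eigenvector k (w k)) \<and> (\<forall>x\<in>X. act X (M (gb j)) v x = (\<Sum>k\<le>j. w k x))"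
  using assms
proof (induction j)
  case 0
  have "M (step (gb 0)) = M (\<lambda>i. theta 0 * gb 0 i + 0 * gb 0 i)"
    by (intro M_cong) (simp add: step_gb_0)
  then have "act X A (act X (M (gb 0)) v) x = theta 0 * act X (M (gb 0)) v x" for x
    by (simp only: act_mat_mult[symmetric] M_step_left)
       (simp add: act_def M_apply sum_distrib_left mult.assoc)
  then show ?case
    by (intro exI[of _ "\<lambda>_. act X (M (gb 0)) v"]) (simp add: eigenvector_def del: gb_0)
next
  case (Suc j)
  then obtain w where w: "\<And>k. k \<le> j \<Longrightarrow> eigenvector k (w k)"
    "\<And>x. x \<in> X \<Longrightarrow> act X (M (gb j)) v x = (\<Sum>k\<le>j. w k x)"
    by (auto dest: Suc_leD)
  define u where "u = act X (M (gb (Suc j))) v"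
  define w' where "w' k x = phi (Suc j) / (theta k - theta (Suc j)) * w k x" for k x
  define r where "r x = u x - (\<Sum>k\<le>j. w' k x)" for x
  have eig_w': "eigenvector k (w' k)" if "k \<le> j" for k
    unfolding w'_def by (rule eigenvector_scale) (rule w(1)[OF that])
  have w'_eq: "theta k * w' k x = phi (Suc j) * w k x + theta (Suc j) * w' k x" if "k \<le> j" for k x
  proof -
    have "(theta k - theta (Suc j)) * w' k x = phi (Suc j) * w k x"
      using theta_distinct[of k "Suc j"] that Suc.prems by (simp add: w'_def)
    then show ?thesis by (simp add: algebra_simps)
  qed
  have "eigenvector (Suc j) r"
    unfolding eigenvector_def
  proof
    fix x assume x: "x \<in> X"
    have "act X A u x = theta (Suc j) * u x + phi (Suc j) * (\<Sum>k\<le>j. w k x)"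
      using Suc.prems x unfolding u_def
      by (simp only: act_mat_mult[symmetric] M_step_left) (simp add: act_M_gb_rec w(2))
    moreover have "act X A (\<lambda>x. \<Sum>k\<le>j. w' k x) x = (\<Sum>k\<le>j. theta k * w' k x)"
      unfolding act_sum using eig_w' x by (intro sum.cong refl) (auto simp: eigenvector_def)
    moreover have "\<dots> = phi (Suc j) * (\<Sum>k\<le>j. w k x) + theta (Suc j) * (\<Sum>k\<le>j. w' k x)"
      by (simp add: w'_eq sum.distrib sum_distrib_left)
    ultimately show "act X A r x = theta (Suc j) * r x"
      unfolding r_def act_diff by (simp add: algebra_simps)
  qed
  then show ?case
    using eig_w'
    by (intro exI[of _ "\<lambda>k. if k = Suc j then r else w' k"]) (auto simp: le_Suc_eq r_def u_def)
qed

lemma spectral_decomposition: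
  obtains w where "\<And>k. k \<le> n \<Longrightarrow> eigenvector k (w k)" "\<And>x. x \<in> X \<Longrightarrow> v x = (\<Sum>k\<le>n. w k x)"
  using act_M_gb_decomposition[of n v] by (auto simp: act_M_gb_n intro: that)

text \<open>Downward induction from the identity \<open>M (gb n)\<close>: \<open>phi (Suc j)\<close>
  times \<open>M (gb j)\<close> is \<open>M (gb (Suc j))\<close> multiplied by
  \<open>A - theta (Suc j)\<close>.\<close>

lemma act_M_gb_eigenvector:
  assumes "eigenvector k w" "j \<le> n" "x \<in> X"
  shows "act X (M (gb j)) w x = eig j k * w x"
  using assms(2)
proof (induction rule: inc_induct)
  case base
  then show ?case using assms by (simp add: act_M_gb_n)
next
  case (step j)
  have "act X (M (gb (Suc j))) (act X A w) x = act X (M (gb (Suc j))) (\<lambda>y. theta k * w y) x"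
    using assms(1) by (intro act_cong) (simp add: eigenvector_def)
  then have "act X (M (local.step (gb (Suc j)))) w x = theta k * (eig (Suc j) k * w x)"
    by (simp add: act_mat_mult[symmetric] M_step act_scale step.IH)
  then have "phi (Suc j) * act X (M (gb j)) w x = (theta k - theta (Suc j)) * (eig (Suc j) k * w x)"
    using step by (simp add: act_M_gb_rec algebra_simps)
  then show ?case
    using phi_nonzero[of "Suc j"] step by (simp add: eig_rec field_simps)
qed

lemma eigenvectors_orthogonal:
  assumes "eigenvector k w" "eigenvector l u" "k \<le> n" "l \<le> n" "k \<noteq> l"
  shows "(\<Sum>x\<in>X. u x * w x) = 0"
proof -
  have "(\<Sum>x\<in>X. u x * act X A w x) = (\<Sum>x\<in>X. act X A u x * w x)"
    unfolding A_def by (rule act_symmetric) (rule M_symmetric)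
  then have "theta k * (\<Sum>x\<in>X. u x * w x) = theta l * (\<Sum>x\<in>X. u x * w x)"
    using assms by (simp add: eigenvector_def sum_distrib_left mult_ac)
  moreover have "theta k \<noteq> theta l"
    using theta_distinct[of k l] theta_distinct[of l k] assms by (cases "k < l") auto
  ultimately show ?thesis by simp
qed

lemma M_gb_sum: "act X (M (\<lambda>i. \<Sum>j\<le>n. \<alpha> j * gb j i)) v x = (\<Sum>j\<le>n. \<alpha> j * act X (M (gb j)) v x)"
proof -
  have "M (\<lambda>i. \<Sum>j\<le>n. \<alpha> j * gb j i) = lin_comb n \<alpha> (\<lambda>j. M (gb j))"
    by (auto simp: fun_eq_iff lin_comb_def M_apply)
  then show ?thesis by (simp add: act_lin_comb)
qed

text \<open>The components of \<open>v\<close> in different eigenspaces are orthogonal, so the form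
  is the sum of their squared lengths weighted by the eigenvalues.\<close>

lemma psd_if_eigenvalues_nonneg:
  assumes "\<And>k. k \<le> n \<Longrightarrow> 0 \<le> (\<Sum>j\<le>n. \<alpha> j * eig j k)"
  shows "0 \<le> quad_form X (M (\<lambda>i. \<Sum>j\<le>n. \<alpha> j * gb j i)) v"
proof -
  let ?F = "M (\<lambda>i. \<Sum>j\<le>n. \<alpha> j * gb j i)"
  define l where "l k = (\<Sum>j\<le>n. \<alpha> j * eig j k)" for k
  obtain w where w: "\<And>k. k \<le> n \<Longrightarrow> eigenvector k (w k)" "\<And>x. x \<in> X \<Longrightarrow> v x = (\<Sum>k\<le>n. w k x)"
    using spectral_decomposition[of v] by metis
  have Fw: "act X ?F (w k) x = l k * w k x" if "k \<le> n" "x \<in> X" for k x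
    using that
    by (simp add: M_gb_sum act_M_gb_eigenvector[OF w(1)] l_def sum_distrib_right mult.assoc)
  have Fv: "act X ?F v x = (\<Sum>k\<le>n. l k * w k x)" if "x \<in> X" for x
  proof -
    have "act X ?F v x = act X ?F (\<lambda>y. \<Sum>k\<le>n. w k y) x" by (rule act_cong) (rule w(2))
    then show ?thesis using that by (simp add: act_sum Fw)
  qed
  have "quad_form X ?F v = (\<Sum>x\<in>X. (\<Sum>m\<le>n. w m x) * (\<Sum>k\<le>n. l k * w k x))"
    by (simp add: quad_form_def Fv w(2))
  also have "\<dots> = (\<Sum>x\<in>X. \<Sum>k\<le>n. \<Sum>m\<le>n. l k * (w m x * w k x))"
    by (simp add: sum_distrib_left sum_distrib_right mult_ac)
  also have "\<dots> = (\<Sum>k\<le>n. \<Sum>m\<le>n. \<Sum>x\<in>X. l k * (w m x * w k x))"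
    by (subst sum.swap) (intro sum.cong refl sum.swap)
  also have "\<dots> = (\<Sum>k\<le>n. \<Sum>m\<le>n. if m = k then l k * (\<Sum>x\<in>X. (w k x)\<^sup>2) else 0)"
    by (intro sum.cong refl)
      (auto simp: sum_distrib_left[symmetric] power2_eq_square eigenvectors_orthogonal[OF w(1) w(1)])
  also have "\<dots> = (\<Sum>k\<le>n. l k * (\<Sum>x\<in>X. (w k x)\<^sup>2))" by simp
  also have "\<dots> \<ge> 0"
    using assms by (intro sum_nonneg mult_nonneg_nonneg) (auto simp: l_def)
  finally show ?thesis .
qed

text \<open>The constant vector is an eigenvector for the valency \<open>theta 0\<close>, and the
  all-one matrix \<open>M (gb 0)\<close> multiplies it by \<open>card X\<close>.\<close>

lemma eig_0_0: "X \<noteq> {} \<Longrightarrow> eig 0 0 = real (card X)"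
proof -
  assume "X \<noteq> {}"
  then obtain x where x: "x \<in> X" by blast
  have "M (step (gb 0)) = M (\<lambda>i. theta 0 * gb 0 i + 0 * gb 0 i)"
    by (intro M_cong) (simp add: step_gb_0)
  then have A1: "mat_mult X A (M (gb 0)) y y = theta 0" if "y \<in> X" for y
    using that unfolding M_step_left by (simp add: M_apply)
  have "act X A (\<lambda>_. 1) y = mat_mult X A (M (gb 0)) y y" if "y \<in> X" for y
    using that by (simp add: act_def mat_mult_def M_apply)
  then have "eigenvector 0 (\<lambda>_. 1)" using A1 by (simp add: eigenvector_def)
  from act_M_gb_eigenvector[OF this _ x, of 0] show ?thesis
    using x by (simp add: act_def M_apply)
qed

text \<open>The functions \<open>gb j\<close> are triangular: \<open>gb (n - m)\<close> is 1 at
  \<open>m\<close> and vanishes beyond. The induction is on a bound for the support of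
  \<open>f\<close>.\<close>

lemma gb_spanning: "\<exists>\<alpha>. \<forall>i\<le>n. f i = (\<Sum>j\<le>n. \<alpha> j * gb j i)"
proof -
  have "\<exists>\<alpha>. \<forall>i\<le>n. f i = (\<Sum>j\<le>n. \<alpha> j * gb j i)"
    if "m \<le> Suc n" "\<And>i. m \<le> i \<Longrightarrow> i \<le> n \<Longrightarrow> f i = 0" for f m
    using that
  proof (induction m arbitrary: f)
    case 0
    then show ?case by (intro exI[of _ "\<lambda>_. 0"]) simp
  next
    case (Suc m)
    define h where "h i = f i - f m * gb (n - m) i" for i
    have "h i = 0" if "m \<le> i" "i \<le> n" for i
    proof (cases "i = m")
      case True
      then show ?thesis using gb_diag[of "n - m"] that by (simp add: h_def)
    next
      case False
      then show ?thesis using that Suc.prems by (simp add: h_def gb_eq_0)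
    qed
    then obtain \<alpha> where \<alpha>: "\<And>i. i \<le> n \<Longrightarrow> h i = (\<Sum>j\<le>n. \<alpha> j * gb j i)"
      using Suc.IH[of h] Suc.prems by auto
    have "f i = (\<Sum>j\<le>n. (\<alpha> j + (if j = n - m then f m else 0)) * gb j i)" if "i \<le> n" for i
    proof -
      have "(\<Sum>j\<le>n. (\<alpha> j + (if j = n - m then f m else 0)) * gb j i)
         = (\<Sum>j\<le>n. \<alpha> j * gb j i) + (\<Sum>j\<le>n. if j = n - m then f m * gb j i else 0)"
        by (simp add: distrib_right sum.distrib if_distrib[of "\<lambda>x. x * _"] cong: if_cong)
      also have "\<dots> = f i" using \<alpha>[OF that] by (simp add: h_def)
      finally show ?thesis by simp
    qed
    then show ?case
      by (intro exI[of _ "\<lambda>j. \<alpha> j + (if j = n - m then f m else 0)"]) simp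
  qed
  from this[of "Suc n"] show ?thesis by simp
qed

text \<open>Downward induction from the identity \<open>M (gb n)\<close>; the extra factor
  \<open>A\<close> that appears when the index drops is moved onto \<open>M g\<close>, where it acts
  as \<open>step\<close>.\<close>

lemma M_gb_mult: "j \<le> n \<Longrightarrow> \<exists>h. mat_mult X (M (gb j)) (M g) = M h"
proof (induction arbitrary: g rule: inc_induct)
  case base
  have "mat_mult X (M (gb n)) (M g) x y = M g x y" for x y
  proof (cases "x \<in> X")
    case True
    then show ?thesis using act_M_gb_n[of x "\<lambda>z. M g z y"] by (simp add: act_def mat_mult_def)
  qed (simp add: mat_mult_def M_apply)
  then show ?case by blast
next
  case (step j)
  obtain h1 where h1: "mat_mult X (M (gb (Suc j))) (M (local.step g)) = M h1" using step.IH by blast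
  obtain h2 where h2: "mat_mult X (M (gb (Suc j))) (M g) = M h2" using step.IH by blast
  have ph: "phi (Suc j) \<noteq> 0" using phi_nonzero[of "Suc j"] step by simp
  have "mat_mult X (M (gb j)) (M g) x y
      = M (\<lambda>i. 1 / phi (Suc j) * h1 i + - theta (Suc j) / phi (Suc j) * h2 i) x y" for x y
  proof -
    have "mat_mult X (M (local.step (gb (Suc j)))) (M g) x y
        = theta (Suc j) * mat_mult X (M (gb (Suc j))) (M g) x y + phi (Suc j) * mat_mult X (M (gb j)) (M g) x y"
      using step by (simp add: mat_mult_def M_gb_rec distrib_right sum.distrib sum_distrib_left mult.assoc)
    moreover have "mat_mult X (M (local.step (gb (Suc j)))) (M g) = M h1"
      by (simp only: M_step[of "gb (Suc j)", symmetric] mat_mult_assoc M_step_left h1)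
    ultimately have "M h1 x y = theta (Suc j) * M h2 x y + phi (Suc j) * mat_mult X (M (gb j)) (M g) x y"
      by (simp add: h2)
    then show ?thesis unfolding M_add_scale using ph by (simp add: field_simps)
  qed
  then show ?case by blast
qed

lemma bose_mesner_closed:
  assumes "E \<in> bose_mesner n R" "F \<in> bose_mesner n R"
  shows "mat_mult X E F \<in> bose_mesner n R"
proof -
  obtain f g where E: "E = M f" and F: "F = M g" using assms by (auto simp: bose_mesner_eq)
  obtain \<alpha> where \<alpha>: "\<And>i. i \<le> n \<Longrightarrow> f i = (\<Sum>j\<le>n. \<alpha> j * gb j i)" using gb_spanning[of f] by blast
  have "\<forall>j\<in>{..n}. \<exists>h. mat_mult X (M (gb j)) (M g) = M h" using M_gb_mult by simp
  then obtain h where "\<forall>j\<in>{..n}. mat_mult X (M (gb j)) (M g) = M (h j)"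
    unfolding bchoice_iff ..
  then have h: "\<And>j. j \<le> n \<Longrightarrow> mat_mult X (M (gb j)) (M g) = M (h j)" by simp
  have "mat_mult X E F x y = M (\<lambda>i. \<Sum>j\<le>n. \<alpha> j * h j i) x y" for x y
  proof -
    have "mat_mult X E F x y = (\<Sum>z\<in>X. (\<Sum>j\<le>n. \<alpha> j * M (gb j) x z) * M g z y)"
      unfolding E F mat_mult_def by (intro sum.cong refl) (auto simp: M_apply \<alpha> del_le)
    also have "\<dots> = (\<Sum>z\<in>X. \<Sum>j\<le>n. \<alpha> j * (M (gb j) x z * M g z y))"
      by (simp add: sum_distrib_right mult.assoc)
    also have "\<dots> = (\<Sum>j\<le>n. \<Sum>z\<in>X. \<alpha> j * (M (gb j) x z * M g z y))" by (rule sum.swap)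
    also have "\<dots> = (\<Sum>j\<le>n. \<alpha> j * M (h j) x y)"
      by (simp add: h[symmetric] mat_mult_def sum_distrib_left)
    also have "\<dots> = M (\<lambda>i. \<Sum>j\<le>n. \<alpha> j * h j i) x y" by (auto simp: M_apply)
    finally show ?thesis .
  qed
  then have "mat_mult X E F = M (\<lambda>i. \<Sum>j\<le>n. \<alpha> j * h j i)" by (intro ext)
  then show ?thesis by (simp add: bose_mesner_eq)
qed

section \<open>Bounds for codes from dual solutions\<close>

lemma R_sym: "i \<le> n \<Longrightarrow> sym (R i)"
  by (auto simp: R_eq del_sym intro!: symI)

lemma code_bound_from_certificate:
  assumes psd: "\<And>v. 0 \<le> quad_form X (M (\<lambda>i. f i - 1)) v"
    and f0: "\<And>i. d \<le> i \<Longrightarrow> i \<le> n \<Longrightarrow> f i = 0"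
    and "d \<le> n" and "is_code d X R Y" and "X = {} \<Longrightarrow> 0 \<le> f 0"
  shows "real (card Y) \<le> f 0"
proof (cases "X = {}")
  case True
  with assms show ?thesis by (simp add: is_code_def)
next
  case False
  show ?thesis
  proof (rule code_card_le[where R = R and n = n and X = X])
    show "(\<Union>i\<le>n. R i) = X \<times> X" using del_le by (auto simp: R_eq)
    show "R i \<inter> R j = {}" if "i \<le> n" "j \<le> n" "i \<noteq> j" for i j using that by (auto simp: R_eq)
    show "R 0 = Id_on X" by (auto simp: R_eq del_0_iff)
  qed (use assms finite_X False in \<open>auto simp: M_def\<close>)
qed

lemma code_bound_from_certificate_transfer:
  fixes X' :: "'y set"
  assumes psd: "\<And>v. 0 \<le> quad_form X (M (\<lambda>i. f i - 1)) v"
    and f0: "\<And>i. d \<le> i \<Longrightarrow> i \<le> n \<Longrightarrow> f i = 0"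
    and "d \<le> n" and scheme: "symmetric_association_scheme n X' R'"
    and PQ: "PQ_numbers n X R P Q" "PQ_numbers n X' R' P Q"
    and "is_code d X' R' Y"
  shows "real (card Y) \<le> f 0"
proof (rule code_card_le[where R = R' and n = n and X = X'])
  have *: "finite X'" "\<And>i. i \<le> n \<Longrightarrow> R' i \<noteq> {}" "(\<Union>i\<le>n. R' i) = X' \<times> X'"
     "\<And>i j. i \<le> n \<Longrightarrow> j \<le> n \<Longrightarrow> i \<noteq> j \<Longrightarrow> R' i \<inter> R' j = {}" "R' 0 = Id_on X'" "\<And>i. i \<le> n \<Longrightarrow> sym (R' i)"
    using scheme by (auto simp: symmetric_association_scheme_def)
  show "finite X'" "(\<Union>i\<le>n. R' i) = X' \<times> X'" "R' 0 = Id_on X'"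
    "\<And>i j. i \<le> n \<Longrightarrow> j \<le> n \<Longrightarrow> i \<noteq> j \<Longrightarrow> R' i \<inter> R' j = {}" by fact+
  have "R' 0 \<noteq> {}" by (rule *(2)) simp
  then show "X' \<noteq> {}" using *(5) by auto
  show "0 \<le> quad_form X' (lin_comb n (\<lambda>i. f i - 1) (\<lambda>i. adjacency (R' i))) v" for v
    by (rule psd_transfer[OF finite_X R_sym *(6) _ bose_mesner_closed PQ psd[unfolded M_def]])
       (auto simp: R_eq)
qed (use assms in auto)

end

section \<open>Dual solutions of the linear program\<close>

context scheme_parameters
begin

lemma theta_diff_over_phi:
  assumes "k < s" "s \<le> n"
  shows "(theta k - theta s) / phi s
    = (b ^ k - b ^ s) * (1 - q * c * b ^ (2 * n - k - s)) / ((b ^ Suc (n - s) - 1) * (q * b ^ (n - s) - 1))"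
proof -
  have "phi s = (b ^ Suc (n - s) - 1) * (q * b ^ (n - s) - 1) / D"
    using b_nonzero assms by (simp add: phi_def num_closer_def Suc_diff_le)
  then show ?thesis
    using assms D_nonzero by (simp add: theta_diff)
qed

text \<open>In each factor both parts of the numerator are negative and both parts of the
  denominator positive. The exponent \<open>2 * n - k - s\<close> is at least 1 because
  \<open>k < s \<le> n\<close>, which gives strictness even when \<open>q * c = 1\<close>.\<close>

lemma eig_pos_of_positive_base:
  assumes "1 < b" "1 < q" "1 \<le> q * c" "k \<le> j" "j \<le> n"
  shows "0 < eig j k"
  unfolding eig_def
proof (rule prod_pos)
  fix s assume "s \<in> {Suc j..n}"
  then have s: "k < s" "s \<le> n" using assms by auto
  define e where "e = 2 * n - k - s"
  have "1 < b ^ e" using s assms by (intro one_less_power) (auto simp: e_def)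
  then have "1 * 1 < q * c * b ^ e" using assms by (intro mult_le_less_imp_less) auto
  moreover have "b ^ k < b ^ s" using s assms by (intro power_strict_increasing) auto
  ultimately have num: "0 < (b ^ k - b ^ s) * (1 - q * c * b ^ e)"
    by (intro mult_neg_neg) auto
  have "1 < b ^ Suc (n - s)" using assms by (intro one_less_power) auto
  moreover have "1 * 1 < q * b ^ (n - s)" using assms by (intro mult_less_le_imp_less one_le_power) auto
  ultimately show "0 < (theta k - theta s) / phi s"
    unfolding theta_diff_over_phi[OF s] e_def[symmetric] by (intro divide_pos_pos[OF num] mult_pos_pos) auto
qed

end

locale negative_base_parameters = scheme_parameters q b c D n for q b c D :: real and n :: nat +
  assumes b_eq: "b = - q" and c_eq: "c = - 1" and q_gt_1: "1 < q" and D_neg: "D < 0"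
begin

lemma q_eq: "q = - b"
  using b_eq by simp

lemma q_over_b: "q / b = - 1"
  using b_eq q_gt_1 by simp

lemma qc_eq: "q * c = b"
  using b_eq c_eq by simp

text \<open>For \<open>q / b = - 1\<close> the numerator is \<open>1 - q^(2 * u)\<close>, which is
  negative like \<open>D\<close>.\<close>

lemma phi_pos:
  assumes "1 \<le> s" "s \<le> n"
  shows "0 < phi s"
proof -
  define u where "u = n + 1 - s"
  have "1 < q ^ (2 * u)" using assms q_gt_1 by (intro one_less_power) (auto simp: u_def)
  then have "1 < b ^ (2 * u)" by (simp add: b_eq power_mult)
  then have "(b ^ u - 1) * (- (b ^ u) - 1) < 0"
    by (simp add: power_mult mult.commute[of 2] power2_eq_square algebra_simps)
  then have "0 < (b ^ u - 1) * (- (b ^ u) - 1) / D" using D_neg by (rule divide_neg_neg)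
  then show ?thesis unfolding phi_def num_closer_def u_def[symmetric] q_over_b by simp
qed

text \<open>Powers of \<open>b\<close> with larger exponents dominate, so \<open>b^s - b^k\<close>
  has the sign of \<open>(-1)^s\<close> and \<open>1 - b^(e + 1)\<close> that of
  \<open>(-1)^e\<close>. As \<open>e + k + s\<close> is even and \<open>D\<close> is negative, the
  sign of the difference depends on \<open>k\<close> alone.\<close>

lemma theta_diff_sign:
  assumes "k < s" "s \<le> n"
  shows "0 < (-1) ^ k * (theta k - theta s)"
proof -
  define e where "e = 2 * n - k - s"
  have 1: "0 < (-1) ^ s * (b ^ s - b ^ k)"
  proof -
    have "(-1) ^ s * b ^ s = (- 1 * b) ^ s" by (rule power_mult_distrib[symmetric])
    then have "(-1) ^ s * b ^ s = q ^ s" by (simp add: b_eq)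
    moreover have "\<bar>(-1) ^ s * b ^ k\<bar> = q ^ k" using q_gt_1 by (simp add: b_eq power_abs abs_mult)
    moreover have "q ^ k < q ^ s" using assms q_gt_1 by (intro power_strict_increasing) auto
    ultimately show ?thesis by (simp add: right_diff_distrib)
  qed
  have 2: "0 < (-1) ^ e * (1 - b ^ Suc e)"
  proof -
    have "(-1) ^ e * b ^ Suc e = b * (- 1 * b) ^ e" by (simp only: power_mult_distrib power_Suc ac_simps)
    then have "(-1) ^ e * b ^ Suc e = - (q ^ Suc e)" by (simp add: b_eq)
    moreover have "1 < q ^ Suc e" using q_gt_1 by (intro one_less_power) auto
    moreover have "- 1 \<le> (-1::real) ^ e" by (cases "even e") auto
    ultimately show ?thesis by (simp add: right_diff_distrib)
  qed
  have "2 * n = e + k + s" using assms by (simp add: e_def)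
  then have "even (e + k + s)" by (metis dvd_triv_left)
  then have sg: "(-1::real) ^ s * (-1) ^ e = (-1) ^ k"
    by (cases "even e"; cases "even s"; cases "even k") auto
  have "0 < ((-1) ^ s * (b ^ s - b ^ k)) * ((-1) ^ e * (1 - b ^ Suc e)) / (- D)"
    using D_neg by (intro divide_pos_pos mult_pos_pos[OF 1 2]) auto
  also have "\<dots> = ((-1) ^ s * (-1) ^ e) * ((b ^ k - b ^ s) * (1 - b ^ Suc e) / D)"
    using D_nonzero by (simp add: field_simps)
  also have "\<dots> = (-1) ^ k * (theta k - theta s)"
    unfolding sg using assms by (simp add: theta_diff e_def qc_eq)
  finally show ?thesis .
qed

text \<open>Each of the \<open>n - j\<close> factors has the sign of \<open>(-1)^k\<close>.\<close>

lemma eig_sign: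
  assumes "k \<le> j" "j \<le> n"
  shows "0 < (-1) ^ (k * (n - j)) * eig j k"
  using assms(2,1)
proof (induction rule: inc_induct)
  case base
  then show ?case by simp
next
  case (step j)
  have "n - j = Suc (n - Suc j)" using step by simp
  then have "(-1) ^ (k * (n - j)) * eig j k
     = (-1) ^ k * (theta k - theta (Suc j)) / phi (Suc j) * ((-1) ^ (k * (n - Suc j)) * eig (Suc j) k)"
    using step by (simp add: eig_rec power_add)
  also have "\<dots> > 0"
    using step phi_pos[of "Suc j"] theta_diff_sign[of k "Suc j"]
    by (intro mult_pos_pos[OF divide_pos_pos]) auto
  finally show ?case .
qed

lemma eig_pos:
  assumes "even (n - j)" "k \<le> j" "j \<le> n"
  shows "0 < eig j k"
  using eig_sign[OF assms(2,3)] assms(1) by simp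

lemma theta_1_minimal:
  assumes "1 \<le> n" "k \<le> n"
  shows "theta 1 \<le> theta k"
proof -
  consider "k = 0" | "k = 1" | "1 < k" by linarith
  then show ?thesis
    using theta_diff_sign[of 0 1] theta_diff_sign[of 1 k] assms by cases auto
qed

end

section \<open>Feasible dual solutions\<close>

context distance_scheme
begin

text \<open>Subtracting the all-one matrix \<open>M (gb 0)\<close> changes only the eigenvalue at
  \<open>theta 0\<close>, which drops by \<open>card X\<close>. The third hypothesis makes that
  eigenvalue exactly zero.\<close>

lemma psd_two_terms:
  assumes "j \<le> n" "s \<le> n"
    and "X \<noteq> {} \<Longrightarrow> \<gamma> * eig j 0 + \<delta> * eig s 0 = real (card X)"
    and "\<And>k. 1 \<le> k \<Longrightarrow> k \<le> n \<Longrightarrow> 0 \<le> \<gamma> * eig j k + \<delta> * eig s k"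
  shows "0 \<le> quad_form X (M (\<lambda>i. \<gamma> * gb j i + \<delta> * gb s i - 1)) v"
proof (cases "X = {}")
  case True
  then show ?thesis by (simp add: quad_form_def)
next
  case False
  \<comment> \<open>Adding indicators lets \<open>j\<close>, \<open>s\<close> and 0 coincide; the
    one-term solution below uses \<open>s = 0\<close>.\<close>
  define \<alpha> :: "nat \<Rightarrow> real" where "\<alpha> t = (if t = j then \<gamma> else 0) + (if t = s then \<delta> else 0)
    - (if t = 0 then 1 else 0)" for t
  have *: "(\<Sum>t\<le>n. \<alpha> t * F t) = \<gamma> * F j + \<delta> * F s - F 0" for F :: "nat \<Rightarrow> real"
  proof -
    have "(\<Sum>t\<le>n. \<alpha> t * F t) = (\<Sum>t\<le>n. (if t = j then \<gamma> * F j else 0)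
       + (if t = s then \<delta> * F s else 0) - (if t = 0 then F 0 else 0))"
      by (intro sum.cong refl) (auto simp: \<alpha>_def algebra_simps)
    also have "\<dots> = \<gamma> * F j + \<delta> * F s - F 0"
      using assms(1,2) by (simp add: sum_subtractf sum.distrib)
    finally show ?thesis .
  qed
  have "0 \<le> (\<Sum>t\<le>n. \<alpha> t * eig t k)" if "k \<le> n" for k
    using assms(3)[OF False] assms(4)[of k] eig_0_0[OF False] eig_eq_0[of 0 k] that
    unfolding * by (cases "k = 0") auto
  then have "0 \<le> quad_form X (M (\<lambda>i. \<Sum>t\<le>n. \<alpha> t * gb t i)) v"
    by (rule psd_if_eigenvalues_nonneg)
  then show ?thesis by (simp add: *)
qed

lemma code_bound_value:
  assumes "1 \<le> d" "d \<le> n"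
  shows "real (card X) / eig (n - (d - 1)) 0 * gb (n - (d - 1)) 0 = code_bound (card X) q b c n d"
proof -
  have "real (card X) / eig (n - (d - 1)) 0 * gb (n - (d - 1)) 0
      = real (card X) * (gb (n - (d - 1)) 0 / eig (n - (d - 1)) 0)" by simp
  also have "gb (n - (d - 1)) 0 / eig (n - (d - 1)) 0 = qpoch q b (d - 1) / qpoch (q * c * b ^ n) b (d - 1)"
    using assms by (intro gb_over_eig) simp
  finally show ?thesis by (simp add: code_bound_def)
qed

text \<open>The last clause settles the empty scheme, where there is no one-point code to show that
  \<open>f 0\<close> is nonnegative.\<close>

definition certificate :: "nat \<Rightarrow> (nat \<Rightarrow> real) \<Rightarrow> bool" where
  "certificate d f \<longleftrightarrow> (\<forall>v. 0 \<le> quad_form X (M (\<lambda>i. f i - 1)) v) \<and>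
     (\<forall>i. d \<le> i \<and> i \<le> n \<longrightarrow> f i = 0) \<and> (X = {} \<longrightarrow> f 0 = 0)"

lemma certificate_bound:
  assumes "certificate d f" "d \<le> n"
  shows "is_code d X R Y \<Longrightarrow> real (card Y) \<le> f 0"
    and "symmetric_association_scheme n X' R' \<Longrightarrow> PQ_numbers n X R P Q \<Longrightarrow> PQ_numbers n X' R' P Q \<Longrightarrow>
      is_code d X' R' Y' \<Longrightarrow> real (card Y') \<le> f 0"
  using assms code_bound_from_certificate[of f d Y] code_bound_from_certificate_transfer[of f d X' R' P Q Y']
  unfolding certificate_def by (metis order_refl)+

lemma certificate_bounds:
  assumes "\<exists>f. certificate d f \<and> f 0 = \<beta>" "d \<le> n"
  shows "(\<forall>Y. is_code d X R Y \<longrightarrow> real (card Y) \<le> \<beta>) \<and>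
    (\<forall>(X' :: 'y set) R' P Q Y. symmetric_association_scheme n X' R' \<and>
       PQ_numbers n X R P Q \<and> PQ_numbers n X' R' P Q \<and> is_code d X' R' Y \<longrightarrow> real (card Y) \<le> \<beta>)"
proof -
  obtain f where f: "certificate d f" "f 0 = \<beta>" using assms by blast
  show ?thesis
    using certificate_bound(1)[OF f(1) assms(2)] certificate_bound(2)[OF f(1) assms(2)]
    unfolding f(2) by blast
qed

lemma single_term_certificate:
  assumes d: "1 \<le> d" "d \<le> n"
    and pos: "\<And>k. k \<le> n - (d - 1) \<Longrightarrow> 0 < eig (n - (d - 1)) k"
  shows "\<exists>f. certificate d f \<and> f 0 = code_bound (card X) q b c n d"
proof -
  define j where "j = n - (d - 1)"
  \<comment> \<open>Scales the eigenvalue at \<open>theta 0\<close> to \<open>card X\<close>, that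
    of the all-one matrix.\<close>
  define \<gamma> where "\<gamma> = real (card X) / eig j 0"
  have j: "j \<le> n" by (simp add: j_def)
  have pos: "0 < eig j k" if "k \<le> j" for k using pos that by (simp add: j_def)
  have "0 \<le> quad_form X (M (\<lambda>i. \<gamma> * gb j i + 0 * gb 0 i - 1)) v" for v
  proof (rule psd_two_terms)
    show "\<gamma> * eig j 0 + 0 * eig 0 0 = real (card X)" using pos[of 0] by (simp add: \<gamma>_def)
    show "0 \<le> \<gamma> * eig j k + 0 * eig 0 k" if "1 \<le> k" "k \<le> n" for k
      using pos[of 0] pos[of k] eig_eq_0[of j k] that by (cases "k \<le> j") (auto simp: \<gamma>_def)
  qed (use j in auto)
  then have "certificate d (\<lambda>i. \<gamma> * gb j i)"
    using d gb_eq_0[of _ j] by (auto simp: certificate_def j_def \<gamma>_def)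
  moreover have "\<gamma> * gb j 0 = code_bound (card X) q b c n d"
    using code_bound_value[OF d] by (simp add: \<gamma>_def j_def)
  ultimately show ?thesis by blast
qed

end

locale negative_base_scheme = negative_base_parameters q b c D n + distance_scheme q b c D n X del R
  for q b c D :: real and n :: nat and X :: "'x set" and del R
begin

text \<open>The denominator of \<open>even_factor\<close> is
  \<open>(b^s - 1) * (theta 0 - theta 1) / (theta 0 - theta s)\<close>, and its numerator
  \<open>Num\<close> satisfies \<open>(theta s - theta 1) * gb s 0 + phi s * gb j 0 = phi s * gb j 0
  * Num / (b^s - 1)\<close>. The claim is the quotient of these two facts.\<close>

lemma even_factor_value:
  assumes d: "2 \<le> d" "d \<le> n"
  defines "s \<equiv> n - (d - 2)" and "j \<equiv> n - (d - 1)"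
  shows "(theta s - theta 1) * gb s 0 + phi s * gb j 0
    = (theta 0 - theta 1) * (phi s / (theta 0 - theta s) * gb j 0 * even_factor q b n d)"
proof -
  \<comment> \<open>All exponents reduce to these two, since \<open>b^s = b * C\<close> and
    \<open>b^n = b * C * U\<close>.\<close>
  define U C where "U = b ^ (d - 2)" and "C = b ^ (s - 1)"
  have s: "s = Suc j" "n = s + (d - 2)" "1 \<le> s" "s \<le> n" "s - 1 = j" "2 \<le> s" using d by (auto simp: s_def j_def)
  have bs: "b ^ s = b * C" using s by (simp add: C_def power_eq_if)
  have "b ^ n = b ^ s * b ^ (d - 2)" by (metis s(2) power_add)
  then have bn: "b ^ n = b * C * U" by (simp only: bs U_def)
  have e1: "b ^ (n - d + 2) = b * C"
  proof -
    have "n - d + 2 = s" using d by (simp add: s_def)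
    then show ?thesis by (simp only: bs)
  qed
  have e2: "b ^ (n - d + 1) = C"
  proof -
    have "n - d + 1 = s - 1" using d by (simp add: s_def)
    then show ?thesis by (simp only: C_def)
  qed
  have e3: "b ^ (n + d - 2) = b * C * U * U"
  proof -
    have "n + d - 2 = n + (d - 2)" using d by simp
    then show ?thesis by (simp only: power_add bn U_def)
  qed
  have e4: "b ^ (n + d - 1) = b * (b * C * U * U)"
  proof -
    have "n + d - 1 = Suc (n + d - 2)" using d by simp
    then show ?thesis by (simp only: power_Suc e3)
  qed
  have e5: "b ^ (2 * n) = (b * C * U)\<^sup>2" by (simp only: bn[symmetric] power_mult mult.commute[of 2])
  have t0s: "theta 0 - theta s = (1 - b * C) * (1 - b * (b * C * U * U)) / D"
  proof -
    have "2 * n - 0 - s = n + d - 2" using d by (simp add: s_def)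
    then show ?thesis using theta_diff[of 0 s] s(4) by (simp add: e3 bs qc_eq)
  qed
  have ts1: "theta s - theta 1 = (b * C - b) * (1 - b * C * U * U) / D"
  proof -
    have "Suc (2 * n - s - 1) = n + d - 2" using d by (simp add: s_def)
    then have "b * b ^ (2 * n - s - 1) = b * C * U * U" using e3 by (metis power_Suc)
    then show ?thesis using theta_diff[of s 1] s(3,4) by (simp add: bs qc_eq)
  qed
  have t01: "theta 0 - theta 1 = (1 - b) * (1 - (b * C * U)\<^sup>2) / D"
  proof -
    have "Suc (2 * n - 0 - 1) = 2 * n" using d by simp
    then have "b * b ^ (2 * n - 0 - 1) = (b * C * U)\<^sup>2" using e5 by (metis power_Suc)
    then show ?thesis using theta_diff[of 0 1] d by (simp add: qc_eq)
  qed
  have ph: "phi s = (b * U - 1) * (- (b * U) - 1) / D"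
  proof -
    have "n + 1 - s = Suc (d - 2)" using d by (simp add: s_def)
    then show ?thesis unfolding phi_def num_closer_def q_over_b by (simp add: U_def)
  qed
  have gs: "gb s 0 = gb j 0 * ((b * U - 1) / (b * C - 1))"
  proof -
    have "n - j = Suc (d - 2)" using d by (simp add: j_def)
    then show ?thesis using bs by (simp add: s(1) gb_def gauss_binom_Suc_right U_def)
  qed
  have ne: "b * C - 1 \<noteq> 0" "b - 1 \<noteq> 0" "b * (b * C * U * U) - 1 \<noteq> 0" "(b * C * U)\<^sup>2 - 1 \<noteq> 0" "b * U + 1 \<noteq> 0"
  proof -
    show "b * C - 1 \<noteq> 0" using b_power_neq_1[OF s(3)] by (simp only: bs)
    show "b - 1 \<noteq> 0" using b_power_neq_1[of 1] by simp
    show "b * (b * C * U * U) - 1 \<noteq> 0" using b_power_neq_1[of "n + d - 1"] d by (simp only: e4) simp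
    show "(b * C * U)\<^sup>2 - 1 \<noteq> 0" using b_power_neq_1[of "2 * n"] d by (simp only: e5) simp
    show "b * U + 1 \<noteq> 0" using q_b_power_neq_1[of "d - 2"] by (simp add: q_eq U_def)
  qed
  define Num where "Num = (b * C - 1) + b * ((b * C * U * U - 1) / (b * U + 1)) * (C - 1)"
  have num: "(b * C - 1) + q * ((b * C * U * U - 1) / (q * U - 1)) * (C - 1) = Num"
  proof -
    have "q * U - 1 = - (b * U + 1)" by (simp add: q_eq)
    then show ?thesis
      unfolding Num_def
      by (simp only: q_eq divide_minus_right mult_minus_left mult_minus_right minus_minus)
  qed
  have den: "(b * C - 1) + q * ((b * C * U * U - 1) / (b * (b * C * U * U) - 1)) * (C - 1)
     = (b - 1) * ((b * C * U)\<^sup>2 - 1) / (b * (b * C * U * U) - 1)"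
    using ne(3) unfolding q_eq by (simp add: divide_simps) (simp add: algebra_simps power2_eq_square)
  have ef: "even_factor q b n d = Num / ((b - 1) * ((b * C * U)\<^sup>2 - 1) / (b * (b * C * U * U) - 1))"
    unfolding even_factor_def e1 e2 e3 e4 U_def[symmetric] num den ..
  have Num': "(b * U + 1) * Num = (b * U + 1) * (b * C - 1) + b * (b * C * U * U - 1) * (C - 1)"
    using ne(5) by (simp add: Num_def distrib_left)
  have lhs: "(theta s - theta 1) * gb s 0 + phi s * gb j 0
      = - ((b * U - 1) * ((b * U + 1) * Num) / ((b * C - 1) * D)) * gb j 0"
    unfolding ts1 ph gs Num' using ne D_nonzero
    by (simp add: divide_simps) (simp add: algebra_simps)
  have "(theta 0 - theta 1) * (phi s / (theta 0 - theta s) * gb j 0 * even_factor q b n d)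
     = ((1 - b) * (1 - (b * C * U)\<^sup>2) / D) * (((b * U - 1) * (- (b * U) - 1) / D)
       / ((1 - b * C) * (1 - b * (b * C * U * U)) / D) * gb j 0 *
       (Num / ((b - 1) * ((b * C * U)\<^sup>2 - 1) / (b * (b * C * U * U) - 1))))"
    unfolding t01 ph t0s ef ..
  also have "\<dots> = - ((b * U - 1) * ((b * U + 1) * Num) / ((b * C - 1) * D)) * gb j 0"
  proof -
    have "(- w * - y / D) * ((p * - m / D) / ((- x) * (- z) / D) * g * (N / (w * y / z)))
       = - (p * (m * N) / (x * D)) * g"
      if "w \<noteq> 0" "y \<noteq> 0" "x \<noteq> 0" "z \<noteq> 0" for w y p m x z N g :: real
      using that D_nonzero by (simp add: ac_simps)
    from this[OF ne(2) ne(4) ne(1) ne(3), of "b * U - 1" "b * U + 1" "gb j 0" Num]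
    show ?thesis by simp
  qed
  finally show ?thesis using lhs by simp
qed

lemma even_certificate:
  assumes d: "even d" "1 \<le> d" "d \<le> n"
  shows "\<exists>f. certificate d f \<and> f 0 = code_bound (card X) q b c n d * even_factor q b n d"
proof -
  have d2: "2 \<le> d" using d by (cases "d = 1") auto
  define s j where "s = n - (d - 2)" and "j = n - (d - 1)"
  have sj: "s = Suc j" "s \<le> n" "1 < s" "even (n - s)" using d d2 by (auto simp: s_def j_def)
  define \<gamma> where "\<gamma> = real (card X) / (eig s 0 * (theta 0 - theta 1))"
  \<comment> \<open>The entries of \<open>A - theta 1\<close> times \<open>M (gb s)\<close>,
    expanded by the recursion and scaled. As \<open>n - s = d - 2\<close> is even,
    \<open>M (gb s)\<close> has nonnegative eigenvalues; its entries vanish from distance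
    \<open>d - 1\<close> on, and the factor \<open>A\<close> costs one step.\<close>
  define f where "f i = \<gamma> * (theta s - theta 1) * gb s i + \<gamma> * phi s * gb j i" for i
  have t01: "0 < theta 0 - theta 1" using theta_diff_sign[of 0 1] d by simp
  have eig_s: "0 < eig s k" if "k \<le> s" for k using eig_pos[of s k] sj that by simp
  have ev: "\<gamma> * (theta s - theta 1) * eig s k + \<gamma> * phi s * eig j k = \<gamma> * eig s k * (theta k - theta 1)" for k
  proof -
    have "phi s * eig j k = (theta k - theta s) * eig s k"
      using phi_nonzero[of s] sj by (simp add: eig_rec)
    then have "\<gamma> * phi s * eig j k = \<gamma> * ((theta k - theta s) * eig s k)" by simp
    then show ?thesis by (simp add: algebra_simps)
  qed
  have "0 \<le> quad_form X (M (\<lambda>i. f i - 1)) v" for v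
    unfolding f_def
  proof (rule psd_two_terms)
    show "\<gamma> * (theta s - theta 1) * eig s 0 + \<gamma> * phi s * eig j 0 = real (card X)"
      unfolding ev using eig_s[of 0] t01 by (simp add: \<gamma>_def)
    show "0 \<le> \<gamma> * (theta s - theta 1) * eig s k + \<gamma> * phi s * eig j k" if k: "1 \<le> k" "k \<le> n" for k
    proof -
      have "0 \<le> eig s k" using eig_s[of k] eig_eq_0[of s k] k by (cases "k \<le> s") auto
      moreover have "0 \<le> theta k - theta 1" using theta_1_minimal[of k] k d by simp
      moreover have "0 \<le> \<gamma>" using eig_s[of 0] t01 by (simp add: \<gamma>_def)
      ultimately show ?thesis unfolding ev by simp
    qed
  qed (use sj in auto)
  moreover have "f i = 0" if "d \<le> i" "i \<le> n" for i
    using that d gb_eq_0[of i s] gb_eq_0[of i j] by (simp add: f_def s_def j_def)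
  ultimately have "certificate d f"
    by (simp add: certificate_def f_def \<gamma>_def)
  moreover have "f 0 = code_bound (card X) q b c n d * even_factor q b n d"
  proof -
    have ph: "phi s \<noteq> 0" using phi_nonzero[of s] sj by simp
    have t0s: "theta 0 - theta s \<noteq> 0" using theta_distinct[of 0 s] sj by simp
    have "code_bound (card X) q b c n d = real (card X) / eig j 0 * gb j 0"
      using code_bound_value[of d] d by (simp add: j_def)
    also have "eig j 0 = (theta 0 - theta s) / phi s * eig s 0" using sj by (simp add: eig_rec)
    finally have cb: "code_bound (card X) q b c n d
        = real (card X) / eig s 0 * (phi s / (theta 0 - theta s) * gb j 0)" by (simp add: ac_simps)
    have "f 0 = \<gamma> * ((theta s - theta 1) * gb s 0 + phi s * gb j 0)"
      by (simp add: f_def algebra_simps)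
    also have "\<dots> = \<gamma> * ((theta 0 - theta 1) * (phi s / (theta 0 - theta s) * gb j 0 * even_factor q b n d))"
      using even_factor_value[OF d2 d(3)] by (simp add: s_def j_def)
    also have "\<dots> = real (card X) / eig s 0 * (phi s / (theta 0 - theta s) * gb j 0) * even_factor q b n d"
      using t01 by (simp add: \<gamma>_def)
    finally show ?thesis by (simp add: cb)
  qed
  ultimately show ?thesis by blast
qed

lemma odd_certificate:
  assumes d: "odd d" "1 \<le> d" "d \<le> n"
  shows "\<exists>f. certificate d f \<and> f 0 = code_bound (card X) q b c n d"
  using assms by (intro single_term_certificate eig_pos) auto

end

section \<open>Generators of a formed space\<close>

lemma CARD_field_gt_1: "1 < CARD('f::{field,finite})"
proof -
  have "card {0, 1::'f} \<le> CARD('f)" by (intro card_mono) auto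
  then show ?thesis by simp
qed

lemma card_span_independent:
  fixes B :: "('f::{field,finite} ^ 'v::finite) set"
  assumes "finite B" "vec.independent B"
  shows "card (vec.span B) = CARD('f) ^ card B"
  using assms
proof (induction B)
  case empty
  then show ?case by simp
next
  case (insert b B)
  have b: "b \<notin> vec.span B" and ind: "vec.independent B"
    using insert by (simp_all add: vec.independent_insert)
  let ?f = "\<lambda>(k, v). v + k *s b"
  have "bij_betw ?f (UNIV \<times> vec.span B) (vec.span (insert b B))"
    unfolding bij_betw_def
  proof
    show "inj_on ?f (UNIV \<times> vec.span B)"
    proof (rule inj_onI, clarsimp)
      fix k v k' v' assume *: "v \<in> vec.span B" "v' \<in> vec.span B" "v + k *s b = v' + k' *s b"
      have "(k - k') *s b = v' - v" using *(3) by (simp add: vec.scale_left_diff_distrib algebra_simps)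
      then have "(k - k') *s b \<in> vec.span B" using * by (simp add: vec.span_diff)
      then have "(1 / (k - k')) *s ((k - k') *s b) \<in> vec.span B" by (rule vec.span_scale)
      then have "k = k'" using b by (cases "k = k'") auto
      with * show "k = k' \<and> v = v'" by simp
    qed
    show "?f ` (UNIV \<times> vec.span B) = vec.span (insert b B)"
    proof (rule equalityI; rule subsetI)
      fix x assume "x \<in> vec.span (insert b B)"
      then obtain k where "x - k *s b \<in> vec.span B" by (auto simp: vec.span_breakdown_eq)
      then show "x \<in> ?f ` (UNIV \<times> vec.span B)"
        by (intro image_eqI[of _ _ "(k, x - k *s b)"]) auto
    next
      fix x assume "x \<in> ?f ` (UNIV \<times> vec.span B)"
      then obtain k v where "x = v + k *s b" "v \<in> vec.span B" by auto
      then show "x \<in> vec.span (insert b B)"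
        by (auto simp: vec.span_breakdown_eq intro!: exI[of _ k])
    qed
  qed
  then have "card (vec.span (insert b B)) = CARD('f) * card (vec.span B)"
    by (simp add: bij_betw_same_card[symmetric] card_cartesian_product)
  then show ?case using insert ind by simp
qed

lemma card_subspace:
  fixes U :: "('f::{field,finite} ^ 'v::finite) set"
  assumes "vec.subspace U"
  shows "card U = CARD('f) ^ vec.dim U"
proof -
  obtain B where B: "B \<subseteq> U" "vec.independent B" "U \<subseteq> vec.span B" "card B = vec.dim U"
    by (rule vec.basis_exists)
  have "vec.span B = U" using B assms by (metis vec.span_minimal subset_antisym)
  moreover have "finite B" by simp
  ultimately show ?thesis using card_span_independent B by metis
qed

text \<open>\<open>Z\<close> is the direct sum of the kernel and the line spanned by
  \<open>z0\<close>.\<close>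

lemma functional_kernel_card:
  fixes f :: "'f::{field,finite} ^ 'v::finite \<Rightarrow> 'f"
  assumes Z: "vec.subspace Z" and add: "\<And>u v. f (u + v) = f u + f v"
    and scale: "\<And>a u. f (a *s u) = a * f u" and z0: "z0 \<in> Z" "f z0 \<noteq> 0"
  shows "CARD('f) * card {z \<in> Z. f z = 0} = card Z"
proof -
  let ?h = "\<lambda>(a, z). z + a *s z0"
  have "bij_betw ?h (UNIV \<times> {z \<in> Z. f z = 0}) Z"
    unfolding bij_betw_def
  proof
    show "inj_on ?h (UNIV \<times> {z \<in> Z. f z = 0})"
    proof (rule inj_onI, clarsimp)
      fix a z a' z' assume *: "f z = 0" "f z' = 0" "z + a *s z0 = z' + a' *s z0"
      have "a = a'" using arg_cong[OF *(3), of f] *(1,2) z0 by (simp add: add scale)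
      with * show "a = a' \<and> z = z'" by simp
    qed
    show "?h ` (UNIV \<times> {z \<in> Z. f z = 0}) = Z"
    proof (rule equalityI; rule subsetI)
      fix x assume x: "x \<in> Z"
      define a where "a = f x / f z0"
      have "x - a *s z0 = x + (- a) *s z0" by simp
      then have "f (x - a *s z0) = 0" using z0 by (simp only: add scale) (simp add: a_def)
      moreover have "x - a *s z0 \<in> Z" using x z0 Z by (simp add: vec.subspace_diff vec.subspace_scale)
      ultimately show "x \<in> ?h ` (UNIV \<times> {z \<in> Z. f z = 0})"
        by (intro image_eqI[of _ _ "(a, x - a *s z0)"]) auto
    next
      fix x assume "x \<in> ?h ` (UNIV \<times> {z \<in> Z. f z = 0})"
      then show "x \<in> Z" using z0 Z by (auto intro!: vec.subspace_add vec.subspace_scale)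
    qed
  qed
  from bij_betw_same_card[OF this] show ?thesis by (simp add: card_cartesian_product)
qed

lemma sum_card_swap:
  assumes "finite A" "finite B"
  shows "(\<Sum>a\<in>A. card {b \<in> B. P a b}) = (\<Sum>b\<in>B. card {a \<in> A. P a b})"
proof -
  have "(\<Sum>a\<in>A. card {b \<in> B. P a b}) = (\<Sum>a\<in>A. \<Sum>b\<in>B. of_bool (P a b))"
    using assms by (simp add: sum.inter_filter[symmetric] of_bool_def)
  also have "\<dots> = (\<Sum>b\<in>B. \<Sum>a\<in>A. of_bool (P a b))" by (rule sum.swap)
  also have "\<dots> = (\<Sum>b\<in>B. card {a \<in> A. P a b})"
    using assms by (simp add: sum.inter_filter[symmetric] of_bool_def)
  finally show ?thesis .
qed

text \<open>
  The common features of a nondegenerate Hermitian or quadratic form: \<open>S\<close> is the set of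
  isotropic (respectively singular) vectors, \<open>B\<close> the Hermitian (respectively polar) form, and
  \<open>e + 1\<close> the number of generators through a hyperplane of a generator.
\<close>

locale formed_space =
  fixes B :: "'f::{field,finite} ^ 'v::finite \<Rightarrow> 'f ^ 'v \<Rightarrow> 'f"
    and S :: "'f ^ 'v \<Rightarrow> bool" and n e :: nat
  assumes CARD_v: "CARD('v) = 2 * n"
    and B_add: "B (u + v) w = B u w + B v w"
    and B_scale: "B (a *s u) w = a * B u w"
    and B_refl: "B u w = 0 \<Longrightarrow> B w u = 0"
    and S_scale: "S u \<Longrightarrow> S (a *s u)"
    and S_add: "S u \<Longrightarrow> S v \<Longrightarrow> B u v = 0 \<Longrightarrow> S (u + v)"
    and S_B: "S u \<Longrightarrow> B u u = 0"
    and nondegenerate: "S u \<Longrightarrow> (\<And>w. B u w = 0) \<Longrightarrow> u = 0"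
    and card_pencil: "S w \<Longrightarrow> B w z \<noteq> 0 \<Longrightarrow> card {a. S (z + a *s w)} = e"
begin

lemma Q_gt_1: "1 < CARD('f)"
  by (rule CARD_field_gt_1)

lemma B_zero_left [simp]: "B 0 w = 0"
  using B_scale[of 0 0 w] by simp

lemma B_zero_right [simp]: "B w 0 = 0"
  by (rule B_refl) simp

text \<open>A Hermitian form is only semilinear on the right, so here and in the next lemma
  linearity is transported by reflexivity, for the value zero.\<close>

lemma B_add_right: "B w u = 0 \<Longrightarrow> B w v = 0 \<Longrightarrow> B w (u + v) = 0"
  by (rule B_refl) (simp add: B_add B_refl)

lemma B_scale_right: "B w u = 0 \<Longrightarrow> B w (a *s u) = 0"
  by (rule B_refl) (simp add: B_scale B_refl)

section \<open>Orthogonal complements and generators\<close>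

definition perp :: "('f ^ 'v) set \<Rightarrow> ('f ^ 'v) set" where
  "perp T = {z. \<forall>t\<in>T. B z t = 0}"

lemma subspace_perp: "vec.subspace (perp T)"
  by (rule vec.subspaceI) (auto simp: perp_def B_add B_scale)

definition TS :: "('f ^ 'v) set \<Rightarrow> bool" where
  "TS U \<longleftrightarrow> vec.subspace U \<and> (\<forall>u\<in>U. S u) \<and> (\<forall>u\<in>U. \<forall>w\<in>U. B u w = 0)"

definition gens :: "('f ^ 'v) set set" where
  "gens = {U. TS U \<and> vec.dim U = n}"

lemma TS_D:
  assumes "TS U"
  shows "vec.subspace U" "\<And>u. u \<in> U \<Longrightarrow> S u" "\<And>u w. u \<in> U \<Longrightarrow> w \<in> U \<Longrightarrow> B u w = 0"
  using assms by (auto simp: TS_def)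

lemma gens_D: "U \<in> gens \<Longrightarrow> TS U" "U \<in> gens \<Longrightarrow> vec.dim U = n" "U \<in> gens \<Longrightarrow> vec.subspace U"
  by (auto simp: gens_def TS_def)

lemma card_gen: "U \<in> gens \<Longrightarrow> card U = CARD('f) ^ n"
  using card_subspace[of U] gens_D by metis

lemma dim_eqI: "vec.subspace (U :: ('f ^ 'v) set) \<Longrightarrow> card U = CARD('f) ^ k \<Longrightarrow> vec.dim U = k"
  using card_subspace[of U] Q_gt_1 by simp

text \<open>Orthogonal pairs \<open>(z, t)\<close> with \<open>t\<close> in \<open>T\<close> are
  counted twice. A nonzero \<open>t\<close> is singular, hence orthogonal to exactly one part in
  \<open>CARD('f)\<close> of the space; a vector \<open>z\<close> is orthogonal to all of
  \<open>T\<close> or to that same fraction of it.\<close>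

lemma card_perp:
  assumes T: "TS T"
  shows "card (perp T) * card T = CARD('f) ^ (2 * n)"
proof -
  let ?V = "CARD('f) ^ (2 * n)"
  have V: "card (UNIV :: ('f ^ 'v) set) = ?V" by (simp add: CARD_v)
  note T' = TS_D[OF T]
  have finT: "finite T" by simp
  have 0: "0 \<in> T" using T'(1) by (rule vec.subspace_0)
  have t: "CARD('f) * card {z \<in> UNIV. B z t = 0} = (if t = 0 then CARD('f) * ?V else ?V)" if "t \<in> T" for t
  proof (cases "t = 0")
    case False
    then obtain z where "B t z \<noteq> 0" using nondegenerate[of t] T'(2)[OF \<open>t \<in> T\<close>] by blast
    then have "B z t \<noteq> 0" using B_refl[of z t] by blast
    then show ?thesis
      using functional_kernel_card[of UNIV "\<lambda>z. B z t" z] False V by (simp add: B_add B_scale)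
  qed (simp add: CARD_v)
  have z: "CARD('f) * card {t \<in> T. B z t = 0} = (if z \<in> perp T then CARD('f) * card T else card T)" for z
  proof (cases "z \<in> perp T")
    case True
    then have "{t \<in> T. B z t = 0} = T" by (auto simp: perp_def)
    with True show ?thesis by simp
  next
    case False
    then obtain t where "t \<in> T" "B t z \<noteq> 0" using B_refl by (auto simp: perp_def)
    moreover have "{t \<in> T. B z t = 0} = {t \<in> T. B t z = 0}" using B_refl by auto
    ultimately show ?thesis
      using functional_kernel_card[OF T'(1), of "\<lambda>t. B t z" t] False by (simp add: B_add B_scale)
  qed
  have "(\<Sum>t\<in>T. CARD('f) * card {z \<in> UNIV. B z t = 0}) = (\<Sum>z\<in>UNIV. CARD('f) * card {t \<in> T. B z t = 0})"
    unfolding sum_distrib_left[symmetric] by (subst sum_card_swap) auto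
  moreover have "(\<Sum>t\<in>T. CARD('f) * card {z \<in> UNIV. B z t = 0}) = CARD('f) * ?V + (card T - 1) * ?V"
  proof -
    have "(\<Sum>t\<in>T. CARD('f) * card {z \<in> UNIV. B z t = 0}) = (\<Sum>t\<in>T. if t = 0 then CARD('f) * ?V else ?V)"
      by (intro sum.cong refl t)
    also have "\<dots> = CARD('f) * ?V + (\<Sum>t\<in>T - {0}. ?V)"
      using 0 finT by (subst sum.remove[of _ 0]) auto
    finally show ?thesis using 0 by simp
  qed
  moreover have "(\<Sum>z\<in>UNIV. CARD('f) * card {t \<in> T. B z t = 0})
      = card (perp T) * (CARD('f) * card T) + (?V - card (perp T)) * card T"
  proof -
    have "(\<Sum>z\<in>UNIV. CARD('f) * card {t \<in> T. B z t = 0})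
        = (\<Sum>z\<in>UNIV. if z \<in> perp T then CARD('f) * card T else card T)"
      by (simp only: z)
    also have "\<dots> = (\<Sum>z\<in>perp T. CARD('f) * card T) + (\<Sum>z\<in>- perp T. card T)"
      by (subst sum.If_cases) auto
    finally show ?thesis using V by (simp add: Compl_eq_Diff_UNIV card_Diff_subset CARD_v)
  qed
  ultimately have "CARD('f) * ?V + (card T - 1) * ?V
      = card (perp T) * (CARD('f) * card T) + (?V - card (perp T)) * card T" by simp
  moreover have "1 \<le> card T" using 0 finT by (metis One_nat_def Suc_leI card_gt_0_iff empty_iff)
  moreover have "card (perp T) \<le> ?V" unfolding V[symmetric] by (rule card_mono) auto
  \<comment> \<open>Over the integers the differences can be expanded, and the product of
    \<open>card T\<close> and the size of the space cancels.\<close>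
  ultimately have "int CARD('f) * ?V + (int (card T) - 1) * ?V
      = card (perp T) * (int CARD('f) * card T) + (int ?V - card (perp T)) * card T"
    by (metis (no_types, lifting) of_nat_add of_nat_diff of_nat_mult of_nat_1)
  then have "(int CARD('f) - 1) * (card (perp T) * card T) = (int CARD('f) - 1) * ?V"
    by (simp add: algebra_simps)
  then have "int (card (perp T) * card T) = int ?V" using Q_gt_1 by simp
  then show ?thesis by (simp only: of_nat_eq_iff)
qed

lemma perp_gen:
  assumes "W \<in> gens"
  shows "perp W = W"
proof -
  have "card (perp W) * CARD('f) ^ n = CARD('f) ^ n * CARD('f) ^ n"
    using card_perp[OF gens_D(1)[OF assms]] card_gen[OF assms] by (simp add: mult_2 power_add)
  then have "card (perp W) = card W" using card_gen[OF assms] by simp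
  moreover have "W \<subseteq> perp W" using TS_D(3)[OF gens_D(1)[OF assms]] by (auto simp: perp_def)
  ultimately show ?thesis by (metis card_subset_eq finite)
qed

lemma exists_nonorthogonal:
  assumes "W \<in> gens" "z \<notin> W"
  obtains w where "w \<in> W" "B w z \<noteq> 0"
proof -
  have "z \<notin> perp W" using assms perp_gen by simp
  then obtain w where "w \<in> W" "B z w \<noteq> 0" by (auto simp: perp_def)
  then show thesis using that B_refl by blast
qed

lemma card_hyperplane:
  assumes "W \<in> gens" "z \<notin> W"
  shows "CARD('f) * card {h \<in> W. B h z = 0} = CARD('f) ^ n"
proof -
  obtain w where "w \<in> W" "B w z \<noteq> 0" using exists_nonorthogonal assms by blast
  then show ?thesis
    using functional_kernel_card[OF gens_D(3)[OF assms(1)], of "\<lambda>h. B h z"] card_gen[OF assms(1)]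
    by (simp add: B_add B_scale)
qed

text \<open>For singular \<open>z\<close> outside the generator \<open>W\<close>, this is the unique
  generator adjacent to \<open>W\<close> that contains \<open>z\<close>.\<close>

definition join :: "('f ^ 'v) set \<Rightarrow> 'f ^ 'v \<Rightarrow> ('f ^ 'v) set" where
  "join W z = {h + a *s z | h a. h \<in> W \<and> B h z = 0}"

lemma join_gen:
  assumes W: "W \<in> gens" and z: "S z" "z \<notin> W"
  shows "join W z \<in> gens" "z \<in> join W z" "W \<inter> join W z = {h \<in> W. B h z = 0}"
proof -
  note W' = TS_D[OF gens_D(1)[OF W]]
  let ?H = "{h \<in> W. B h z = 0}"
  have sub: "vec.subspace (join W z)"
  proof (rule vec.subspaceI)
    show "0 \<in> join W z"
      using vec.subspace_0[OF W'(1)] by (auto simp: join_def intro!: exI[of _ 0])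
  next
    fix x y assume "x \<in> join W z" "y \<in> join W z"
    then obtain h a h' a' where "x = h + a *s z" "y = h' + a' *s z" "h \<in> W" "h' \<in> W" "B h z = 0" "B h' z = 0"
      by (auto simp: join_def)
    then show "x + y \<in> join W z"
      unfolding join_def using vec.subspace_add[OF W'(1), of h h']
      by (intro CollectI exI[of _ "h + h'"] exI[of _ "a + a'"]) (auto simp: B_add vec.scale_left_distrib)
  next
    fix r x assume "x \<in> join W z"
    then obtain h a where "x = h + a *s z" "h \<in> W" "B h z = 0" by (auto simp: join_def)
    then show "r *s x \<in> join W z"
      unfolding join_def using vec.subspace_scale[OF W'(1), of h r]
      by (intro CollectI exI[of _ "r *s h"] exI[of _ "r * a"]) (auto simp: B_scale vec.scale_right_distrib)
  qed
  have a0: "a = 0" if "h \<in> W" "h + a *s z \<in> W" for h a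
  proof (rule ccontr)
    assume "a \<noteq> 0"
    have "h + a *s z - h \<in> W" using W'(1) that by (intro vec.subspace_diff)
    then have "a *s z \<in> W" by simp
    then have "(1 / a) *s (a *s z) \<in> W" by (rule vec.subspace_scale[OF W'(1)])
    then show False using z \<open>a \<noteq> 0\<close> by simp
  qed
  have "bij_betw (\<lambda>(a, h). h + a *s z) (UNIV \<times> ?H) (join W z)"
    unfolding bij_betw_def
  proof
    show "inj_on (\<lambda>(a, h). h + a *s z) (UNIV \<times> ?H)"
    proof (rule inj_onI, clarsimp)
      fix a h a' h' assume *: "h \<in> W" "h' \<in> W" "h + a *s z = h' + a' *s z"
      have "h + (a - a') *s z = h'" using *(3) by (simp add: vec.scale_left_diff_distrib algebra_simps)
      then have "a - a' = 0" using a0[of h "a - a'"] * by simp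
      with * show "a = a' \<and> h = h'" by simp
    qed
  qed (auto simp: join_def)
  from bij_betw_same_card[OF this] have "card (join W z) = CARD('f) ^ n"
    using card_hyperplane[OF W z(2)] by (simp add: card_cartesian_product)
  then have dim: "vec.dim (join W z) = n" using sub by (rule dim_eqI[rotated])
  have B_az: "B h (a *s z) = 0" if "B h z = 0" for h a using that by (rule B_scale_right)
  have "S x" if "x \<in> join W z" for x
    using that W'(2) z(1) by (auto simp: join_def intro!: S_add S_scale B_az)
  moreover have "B x y = 0" if xy: "x \<in> join W z" "y \<in> join W z" for x y
  proof -
    obtain h a h' a' where *: "x = h + a *s z" "y = h' + a' *s z" "h \<in> W" "h' \<in> W" "B h z = 0" "B h' z = 0"
      using xy by (auto simp: join_def)
    have "B h y = 0" unfolding * using * W'(3) by (intro B_add_right B_az) auto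
    moreover have "B z y = 0" unfolding * using *(6) S_B[OF z(1)] by (intro B_add_right B_az) (auto intro: B_refl)
    ultimately show ?thesis unfolding *(1) by (simp add: B_add B_scale)
  qed
  ultimately show "join W z \<in> gens" using sub dim by (auto simp: gens_def TS_def)
  show "z \<in> join W z"
    unfolding join_def using vec.subspace_0[OF W'(1)]
    by (intro CollectI) (rule exI[of _ 0], rule exI[of _ 1], simp)
  show "W \<inter> join W z = ?H"
  proof (rule equalityI; rule subsetI)
    fix x assume "x \<in> W \<inter> join W z"
    then obtain h a where *: "x = h + a *s z" "h \<in> W" "B h z = 0" "x \<in> W" by (auto simp: join_def)
    then have "a = 0" using a0[of h a] by simp
    with * show "x \<in> ?H" by simp
  next
    fix x assume "x \<in> ?H"
    then show "x \<in> W \<inter> join W z"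
      unfolding join_def by (intro IntI CollectI) (simp, rule exI[of _ x], rule exI[of _ 0], simp)
  qed
qed

section \<open>Neighbours of a generator\<close>

definition nbrs :: "('f ^ 'v) set \<Rightarrow> ('f ^ 'v) set set" where
  "nbrs W = {W' \<in> gens. vec.dim (W \<inter> W') + 1 = n}"

lemma card_nbr_Int:
  assumes "W \<in> gens" "W' \<in> nbrs W"
  shows "CARD('f) * card (W \<inter> W') = CARD('f) ^ n"
proof -
  have "vec.subspace (W \<inter> W')" using assms by (auto simp: nbrs_def intro: vec.subspace_inter gens_D)
  then have "card (W \<inter> W') = CARD('f) ^ vec.dim (W \<inter> W')" by (rule card_subspace)
  moreover have "vec.dim (W \<inter> W') + 1 = n" using assms by (simp add: nbrs_def)
  ultimately show ?thesis by (metis Suc_eq_plus1 power_Suc)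
qed

lemma join_in_nbrs:
  assumes W: "W \<in> gens" and z: "S z" "z \<notin> W"
  shows "join W z \<in> nbrs W"
proof -
  have sub: "vec.subspace (W \<inter> join W z)"
    by (rule vec.subspace_inter[OF gens_D(3)[OF W] gens_D(3)[OF join_gen(1)[OF assms]]])
  have "CARD('f) ^ Suc (vec.dim (W \<inter> join W z)) = CARD('f) ^ n"
    using card_hyperplane[OF W z(2)] card_subspace[OF sub] unfolding join_gen(3)[OF assms] by simp
  then have "Suc (vec.dim (W \<inter> join W z)) = n" using Q_gt_1 by (simp only: power_inject_exp)
  then show ?thesis using join_gen[OF assms] by (simp add: nbrs_def)
qed

text \<open>\<open>W \<inter> W'\<close> lies in the part of \<open>W\<close> orthogonal to
  \<open>z\<close>, and both are hyperplanes of \<open>W\<close>, hence equal. Then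
  \<open>join W z\<close> is contained in \<open>W'\<close> and has the same size.\<close>

lemma nbr_eq_join:
  assumes W: "W \<in> gens" and W': "W' \<in> nbrs W" and z: "z \<in> W'" "z \<notin> W"
  shows "W' = join W z"
proof -
  have gW': "W' \<in> gens" using W' by (simp add: nbrs_def)
  note * = TS_D[OF gens_D(1)[OF gW']]
  have "W \<inter> W' \<subseteq> {h \<in> W. B h z = 0}" using *(3) z by auto
  moreover have "card (W \<inter> W') = card {h \<in> W. B h z = 0}"
  proof -
    have "CARD('f) * card (W \<inter> W') = CARD('f) * card {h \<in> W. B h z = 0}"
      using card_nbr_Int[OF W W'] card_hyperplane[OF W z(2)] by simp
    then show ?thesis by simp
  qed
  ultimately have "W \<inter> W' = {h \<in> W. B h z = 0}" by (intro card_subset_eq) auto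
  then have "join W z \<subseteq> W'"
    using *(1) z by (auto simp: join_def intro!: vec.subspace_add vec.subspace_scale)
  moreover have "card (join W z) = card W'"
    using card_gen[OF gW'] card_gen[OF join_gen(1)[OF W *(2)[OF z(1)] z(2)]] by simp
  ultimately show ?thesis by (metis card_subset_eq finite)
qed

text \<open>A vector outside \<open>W\<close> lies on at most one neighbour, so the parts are
  disjoint. \<open>U\<close> is later the whole space or a second generator.\<close>

lemma card_UN_nbrs:
  assumes W: "W \<in> gens" and P: "P \<subseteq> nbrs W"
    and k: "\<And>W'. W' \<in> P \<Longrightarrow> card (W' \<inter> U - W) = k"
  shows "card (\<Union>W'\<in>P. W' \<inter> U - W) = card P * k"
proof -
  have "(W' \<inter> U - W) \<inter> (W'' \<inter> U - W) = {}" if "W' \<in> P" "W'' \<in> P" "W' \<noteq> W''" for W' W''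
  proof (rule ccontr)
    assume "(W' \<inter> U - W) \<inter> (W'' \<inter> U - W) \<noteq> {}"
    then obtain z where "z \<in> W'" "z \<in> W''" "z \<notin> W" by blast
    then have "W' = join W z" "W'' = join W z" using nbr_eq_join[OF W] P that by blast+
    with that show False by simp
  qed
  then have "card (\<Union>W'\<in>P. W' \<inter> U - W) = (\<Sum>W'\<in>P. card (W' \<inter> U - W))"
    by (intro card_UN_disjoint) auto
  then show ?thesis using k by simp
qed

text \<open>The coset \<open>z + W\<close> is covered by lines in the direction of a fixed
  \<open>w0\<close> not orthogonal to \<open>z\<close>, and each such line carries \<open>e\<close>
  singular vectors. Counting pairs \<open>(w, a)\<close> uses that \<open>W\<close> is invariant
  under translation by multiples of \<open>w0\<close>.\<close>

lemma card_singular_coset: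
  assumes W: "W \<in> gens" and z: "z \<notin> W"
  shows "CARD('f) * card {w \<in> W. S (z + w)} = e * card W"
proof -
  note W' = TS_D[OF gens_D(1)[OF W]]
  obtain w0 where w0: "w0 \<in> W" "B w0 z \<noteq> 0" using exists_nonorthogonal[OF W z] .
  have "(\<Sum>w\<in>W. card {a \<in> UNIV. S (z + w + a *s w0)}) = (\<Sum>a\<in>UNIV. card {w \<in> W. S (z + w + a *s w0)})"
    by (rule sum_card_swap) auto
  moreover have "card {a \<in> UNIV. S (z + w + a *s w0)} = e" if "w \<in> W" for w
  proof -
    have "B z w0 \<noteq> 0" using w0 B_refl by blast
    then have "B (z + w) w0 \<noteq> 0" using W'(3)[OF that w0(1)] by (simp add: B_add)
    then have "B w0 (z + w) \<noteq> 0" using B_refl by blast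
    then show ?thesis using card_pencil[OF W'(2)[OF w0(1)]] by simp
  qed
  moreover have "card {w \<in> W. S (z + w + a *s w0)} = card {w \<in> W. S (z + w)}" for a
  proof (rule bij_betw_same_card[of "\<lambda>w. w + a *s w0"])
    have aw: "a *s w0 \<in> W" using W'(1) w0 by (intro vec.subspace_scale)
    show "bij_betw (\<lambda>w. w + a *s w0) {w \<in> W. S (z + w + a *s w0)} {w \<in> W. S (z + w)}"
      using aw W'(1)
      by (intro bij_betw_byWitness[where f' = "\<lambda>w. w - a *s w0"])
         (auto simp: add.assoc intro: vec.subspace_add vec.subspace_diff)
  qed
  ultimately show ?thesis by (simp add: mult.commute)
qed

text \<open>\<open>perp T\<close> contains \<open>W\<close>, so \<open>perp T - W\<close> is a union
  of cosets of \<open>W\<close>, each with the same proportion of singular vectors.\<close>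

lemma card_singular_perp:
  assumes W: "W \<in> gens" and T: "T \<subseteq> W"
  shows "CARD('f) * card {z \<in> perp T - W. S z} = e * card (perp T - W)"
proof -
  note W' = TS_D[OF gens_D(1)[OF W]]
  have WP: "W \<subseteq> perp T" using T W'(3) by (auto simp: perp_def)
  have "(\<Sum>z\<in>perp T - W. CARD('f) * card {w \<in> W. S (z + w)}) = (\<Sum>w\<in>W. CARD('f) * card {z \<in> perp T - W. S (z + w)})"
    unfolding sum_distrib_left[symmetric] by (subst sum_card_swap) auto
  moreover have "(\<Sum>z\<in>perp T - W. CARD('f) * card {w \<in> W. S (z + w)}) = card (perp T - W) * (e * card W)"
    by (simp add: card_singular_coset[OF W])
  moreover have "card {z \<in> perp T - W. S (z + w)} = card {z \<in> perp T - W. S z}" if w: "w \<in> W" for w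
  proof (rule bij_betw_same_card[of "\<lambda>z. z + w"])
    have P: "z + w \<in> perp T" "z - w \<in> perp T" if "z \<in> perp T" for z
      using that w WP vec.subspace_add[OF subspace_perp] vec.subspace_diff[OF subspace_perp] by auto
    have N1: "z \<in> W" if "z + w \<in> W" for z
      using that w vec.subspace_diff[OF W'(1), of "z + w" w] by simp
    have N2: "z \<in> W" if "z - w \<in> W" for z
      using that w vec.subspace_add[OF W'(1), of "z - w" w] by simp
    show "bij_betw (\<lambda>z. z + w) {z \<in> perp T - W. S (z + w)} {z \<in> perp T - W. S z}"
      by (intro bij_betw_byWitness[where f' = "\<lambda>z. z - w"]) (auto simp: P dest: N1 N2)
  qed
  ultimately have "card (perp T - W) * (e * card W) = card W * (CARD('f) * card {z \<in> perp T - W. S z})"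
    by simp
  then have "card W * (e * card (perp T - W)) = card W * (CARD('f) * card {z \<in> perp T - W. S z})"
    by (simp add: ac_simps)
  moreover have "card W \<noteq> 0" using card_gen[OF W] Q_gt_1 by simp
  ultimately show ?thesis by simp
qed

text \<open>The neighbours through \<open>T\<close> partition the singular vectors of
  \<open>perp T - W\<close>, each taking the complement of a hyperplane in a generator.\<close>

lemma card_nbrs_above:
  assumes W: "W \<in> gens" and T: "T \<subseteq> W" "vec.subspace T" and i: "vec.dim T + i = n"
  shows "real (card {W' \<in> nbrs W. T \<subseteq> W'}) = real e * (real CARD('f) ^ i - 1) / (real CARD('f) - 1)"
proof -
  note W' = TS_D[OF gens_D(1)[OF W]]
  let ?P = "{W' \<in> nbrs W. T \<subseteq> W'}"
  have TST: "TS T" using T W'(2,3) unfolding TS_def by blast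
  have WP: "W \<subseteq> perp T" using T W'(3) by (auto simp: perp_def)
  have "card (perp T) * CARD('f) ^ vec.dim T = CARD('f) ^ (2 * n)" using card_perp[OF TST] card_subspace[OF T(2)] by simp
  also have "2 * n = (n + i) + vec.dim T" using i by simp
  finally have perp: "card (perp T) = CARD('f) ^ (n + i)" using Q_gt_1 by (simp add: power_add)
  have un: "(\<Union>W'\<in>?P. W' \<inter> UNIV - W) = {z \<in> perp T - W. S z}"
  proof (rule equalityI; rule subsetI)
    fix z assume "z \<in> (\<Union>W'\<in>?P. W' \<inter> UNIV - W)"
    then obtain W1 where "W1 \<in> nbrs W" "T \<subseteq> W1" "z \<in> W1" "z \<notin> W" by blast
    then have "W1 \<in> gens" by (simp add: nbrs_def)
    then have *: "S z" "\<And>t. t \<in> T \<Longrightarrow> B z t = 0"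
      using TS_D[OF gens_D(1)] \<open>T \<subseteq> W1\<close> \<open>z \<in> W1\<close> by blast+
    then show "z \<in> {z \<in> perp T - W. S z}" using \<open>z \<notin> W\<close> by (auto simp: perp_def)
  next
    fix z assume z: "z \<in> {z \<in> perp T - W. S z}"
    then have "T \<subseteq> {h \<in> W. B h z = 0}" using T B_refl by (auto simp: perp_def)
    then have "T \<subseteq> join W z" using join_gen(3)[OF W] z by blast
    then show "z \<in> (\<Union>W'\<in>?P. W' \<inter> UNIV - W)"
      using join_in_nbrs[OF W] join_gen(2)[OF W] z by blast
  qed
  \<comment> \<open>The size of a hyperplane of a generator. The division is known to be exact only
    once a neighbour exists, hence the later split on \<open>?P = {}\<close>.\<close>
  define h where "h = CARD('f) ^ n div CARD('f)"
  have k: "card (W1 \<inter> UNIV - W) = CARD('f) ^ n - h" and hn: "CARD('f) * h = CARD('f) ^ n" if W1: "W1 \<in> nbrs W" for W1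
  proof -
    have *: "CARD('f) * card (W \<inter> W1) = CARD('f) ^ n" using card_nbr_Int[OF W W1] .
    then have "card (W \<inter> W1) = h" using Q_gt_1 unfolding h_def by (metis nonzero_mult_div_cancel_left not_one_less_zero)
    with * show "CARD('f) * h = CARD('f) ^ n" by simp
    have "W1 - W = W1 - (W \<inter> W1)" by auto
    then show "card (W1 \<inter> UNIV - W) = CARD('f) ^ n - h"
      using W1 \<open>card (W \<inter> W1) = h\<close> by (simp add: card_Diff_subset nbrs_def card_gen)
  qed
  have "card ?P * (CARD('f) ^ n - h) = card {z \<in> perp T - W. S z}"
    using card_UN_nbrs[OF W, of ?P UNIV "CARD('f) ^ n - h"] k un by auto
  then have main: "CARD('f) * (card ?P * (CARD('f) ^ n - h)) = e * (CARD('f) ^ (n + i) - CARD('f) ^ n)"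
    using card_singular_perp[OF W T(1)] WP perp card_gen[OF W] by (simp add: card_Diff_subset)
  have le: "CARD('f) ^ n \<le> CARD('f) ^ (n + i)" using Q_gt_1 by (intro power_increasing) auto
  show ?thesis
  proof (cases "?P = {}")
    case True
    have "e * (CARD('f) ^ (n + i) - CARD('f) ^ n) = 0" using main unfolding True by simp
    moreover have "CARD('f) ^ n < CARD('f) ^ (n + i)" if "i \<noteq> 0"
      using Q_gt_1 that by (intro power_strict_increasing) auto
    ultimately have "e = 0 \<or> i = 0" by fastforce
    with True show ?thesis by auto
  next
    case False
    then have hn: "CARD('f) * h = CARD('f) ^ n" using hn by blast
    have *: "CARD('f) * CARD('f) ^ n - CARD('f) ^ n = CARD('f) * (CARD('f) ^ n - h)"
      by (simp add: right_diff_distrib' hn)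
    have "card ?P * (CARD('f) * CARD('f) ^ n - CARD('f) ^ n) = CARD('f) * (card ?P * (CARD('f) ^ n - h))"
      unfolding * by (rule mult.left_commute)
    also note main
    finally have "real (card ?P * (CARD('f) * CARD('f) ^ n - CARD('f) ^ n)) = real (e * (CARD('f) ^ (n + i) - CARD('f) ^ n))" by simp
    then have "real (card ?P) * (real CARD('f) * real CARD('f) ^ n - real CARD('f) ^ n) = real e * (real CARD('f) ^ (n + i) - real CARD('f) ^ n)"
      using le Q_gt_1 by (simp add: of_nat_diff)
    then have "real CARD('f) ^ n * (real (card ?P) * (real CARD('f) - 1)) = real CARD('f) ^ n * (real e * (real CARD('f) ^ i - 1))"
      by (simp add: algebra_simps power_add)
    then have "real (card ?P) * (real CARD('f) - 1) = real e * (real CARD('f) ^ i - 1)" using Q_gt_1 by simp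
    then show ?thesis using Q_gt_1 by (simp add: field_simps)
  qed
qed

lemma nbr_not_subset:
  assumes "W \<in> gens" "W' \<in> nbrs W"
  obtains z where "z \<in> W'" "z \<notin> W"
proof -
  have "\<not> W' \<subseteq> W"
  proof
    assume "W' \<subseteq> W"
    then have "W \<inter> W' = W'" by blast
    then show False using assms gens_D(2)[of W'] by (auto simp: nbrs_def)
  qed
  then show thesis using that by blast
qed

text \<open>A vector \<open>u\<close> of \<open>U \<inter> W'\<close> outside \<open>W\<close> would
  make \<open>W \<inter> W'\<close> the part of \<open>W\<close> orthogonal to \<open>u\<close>,
  which contains \<open>U \<inter> W\<close>. So \<open>U \<inter> W'\<close> lies in
  \<open>W\<close> and is the hyperplane of \<open>U \<inter> W\<close> orthogonal to some
  \<open>z\<close>.\<close>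

lemma nbr_farther:
  assumes U: "U \<in> gens" and W: "W \<in> gens" and W': "W' \<in> nbrs W" and T: "\<not> U \<inter> W \<subseteq> W'"
  shows "vec.dim (U \<inter> W') + 1 = vec.dim (U \<inter> W)"
proof -
  note U' = TS_D[OF gens_D(1)[OF U]] and W1 = TS_D[OF gens_D(1)[OF W]]
  have gW': "W' \<in> gens" using W' by (simp add: nbrs_def)
  note W2 = TS_D[OF gens_D(1)[OF gW']]
  have H: "W \<inter> W' = {h \<in> W. B h z = 0}" if "z \<in> W'" "z \<notin> W" for z
    using nbr_eq_join[OF W W' that] join_gen(3)[OF W W2(2)[OF that(1)] that(2)] by simp
  have sub: "U \<inter> W' \<subseteq> W"
  proof (rule ccontr)
    assume "\<not> U \<inter> W' \<subseteq> W"
    then obtain u where u: "u \<in> U" "u \<in> W'" "u \<notin> W" by blast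
    have "U \<inter> W \<subseteq> {h \<in> W. B h u = 0}" using U'(3) u(1) by blast
    with H[OF u(2,3)] T show False by blast
  qed
  obtain z where z: "z \<in> W'" "z \<notin> W" using nbr_not_subset[OF W W'] .
  have eq: "U \<inter> W' = {t \<in> U \<inter> W. B t z = 0}" using H[OF z] sub by blast
  obtain t where "t \<in> U \<inter> W" "B t z \<noteq> 0" using T H[OF z] by blast
  then have "CARD('f) * card {t \<in> U \<inter> W. B t z = 0} = card (U \<inter> W)"
    using vec.subspace_inter[OF U'(1) W1(1)]
    by (intro functional_kernel_card[of _ _ t]) (auto simp: B_add B_scale)
  then have "CARD('f) ^ Suc (vec.dim (U \<inter> W')) = CARD('f) ^ vec.dim (U \<inter> W)"
    using card_subspace[OF vec.subspace_inter[OF U'(1) W2(1)]]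
      card_subspace[OF vec.subspace_inter[OF U'(1) W1(1)]] eq by simp
  then have "Suc (vec.dim (U \<inter> W')) = vec.dim (U \<inter> W)" using Q_gt_1 by (simp only: power_inject_exp)
  then show ?thesis by simp
qed

text \<open>The dimension formula for \<open>U \<inter> W'\<close> and the hyperplane
  \<open>W \<inter> W'\<close> of \<open>W'\<close>, which meet in \<open>U \<inter> W\<close>,
  allows a gain of at most one.\<close>

lemma nbr_not_farther:
  assumes U: "U \<in> gens" and W: "W \<in> gens" and W': "W' \<in> nbrs W" and T: "U \<inter> W \<subseteq> W'"
  shows "vec.dim (U \<inter> W') = (if U \<inter> W' \<subseteq> W then vec.dim (U \<inter> W) else vec.dim (U \<inter> W) + 1)"
proof (cases "U \<inter> W' \<subseteq> W")
  case True
  then have "U \<inter> W' = U \<inter> W" using T by blast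
  with True show ?thesis by simp
next
  case False
  have gW': "W' \<in> gens" using W' by (simp add: nbrs_def)
  note sU = gens_D(3)[OF U] and sW = gens_D(3)[OF W] and sW' = gens_D(3)[OF gW']
  have s1: "vec.subspace (U \<inter> W')" and s2: "vec.subspace (W \<inter> W')" and s3: "vec.subspace (U \<inter> W)"
    using sU sW sW' by (auto intro: vec.subspace_inter)
  have "(U \<inter> W') \<inter> (W \<inter> W') = U \<inter> W" using T by blast
  then have "vec.dim {x + y | x y. x \<in> U \<inter> W' \<and> y \<in> W \<inter> W'} + vec.dim (U \<inter> W)
      = vec.dim (U \<inter> W') + vec.dim (W \<inter> W')"
    using vec.dim_sums_Int[OF s1 s2] by simp
  moreover have "vec.dim {x + y | x y. x \<in> U \<inter> W' \<and> y \<in> W \<inter> W'} \<le> vec.dim W'"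
    using sW' by (intro vec.dim_subset) (auto intro: vec.subspace_add)
  moreover have "vec.dim (W \<inter> W') + 1 = n" "vec.dim W' = n" using W' gens_D(2) by (auto simp: nbrs_def)
  moreover have "vec.dim (U \<inter> W) < vec.dim (U \<inter> W')"
  proof -
    have "U \<inter> W \<subset> U \<inter> W'" using T False by blast
    then have "card (U \<inter> W) < card (U \<inter> W')" by (intro psubset_card_mono) auto
    then show ?thesis
      using Q_gt_1 by (simp add: card_subspace[OF s1] card_subspace[OF s3])
  qed
  ultimately show ?thesis using False by simp
qed

text \<open>These neighbours partition \<open>U - W\<close>: for \<open>z\<close> in it,
  \<open>join W z\<close> contains \<open>z\<close>, and also \<open>U \<inter> W\<close> because
  \<open>U\<close> is totally isotropic.\<close>

lemma card_nbrs_closer: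
  assumes U: "U \<in> gens" and W: "W \<in> gens" and i: "vec.dim (U \<inter> W) + i = n"
  shows "real (card {W' \<in> nbrs W. U \<inter> W \<subseteq> W' \<and> \<not> U \<inter> W' \<subseteq> W}) = (real CARD('f) ^ i - 1) / (real CARD('f) - 1)"
proof -
  note U' = TS_D[OF gens_D(1)[OF U]]
  let ?P = "{W' \<in> nbrs W. U \<inter> W \<subseteq> W' \<and> \<not> U \<inter> W' \<subseteq> W}"
  define t where "t = vec.dim (U \<inter> W)"
  have cT: "card (U \<inter> W) = CARD('f) ^ t"
    unfolding t_def using gens_D(3)[OF U] gens_D(3)[OF W] by (intro card_subspace vec.subspace_inter)
  have k: "card (W' \<inter> U - W) = CARD('f) * CARD('f) ^ t - CARD('f) ^ t" if "W' \<in> ?P" for W'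
  proof -
    have "W' \<in> gens" using that by (simp add: nbrs_def)
    then have "card (U \<inter> W') = CARD('f) ^ Suc t"
      using nbr_not_farther[OF U W, of W'] that card_subspace[OF vec.subspace_inter[OF gens_D(3)[OF U] gens_D(3)]]
      by (simp add: t_def)
    moreover have "W' \<inter> U - W = U \<inter> W' - U \<inter> W" by blast
    ultimately show ?thesis using that cT by (simp add: card_Diff_subset)
  qed
  have "(\<Union>W'\<in>?P. W' \<inter> U - W) = U - W"
  proof (rule equalityI; rule subsetI)
    fix z assume z: "z \<in> U - W"
    then have Sz: "S z" using U'(2) by blast
    have "U \<inter> W \<subseteq> {h \<in> W. B h z = 0}" using U'(3) z by blast
    then have "U \<inter> W \<subseteq> join W z" using join_gen(3)[OF W Sz] z by blast
    moreover have "z \<in> join W z" "join W z \<in> nbrs W" using join_gen(2)[OF W Sz] join_in_nbrs[OF W Sz] z by auto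
    ultimately show "z \<in> (\<Union>W'\<in>?P. W' \<inter> U - W)" using z by blast
  qed auto
  then have "card ?P * (CARD('f) * CARD('f) ^ t - CARD('f) ^ t) = card (U - W)"
    using card_UN_nbrs[OF W, of ?P U] k by auto
  also have "U - W = U - U \<inter> W" by blast
  also have "card \<dots> = CARD('f) ^ n - CARD('f) ^ t" using cT card_gen[OF U] by (simp add: card_Diff_subset)
  finally have "real (card ?P * (CARD('f) * CARD('f) ^ t - CARD('f) ^ t)) = real (CARD('f) ^ n - CARD('f) ^ t)"
    by simp
  moreover have "CARD('f) ^ t \<le> CARD('f) ^ n" using Q_gt_1 i by (intro power_increasing) (auto simp: t_def)
  ultimately have "real (card ?P) * (real CARD('f) * real CARD('f) ^ t - real CARD('f) ^ t)
      = real CARD('f) ^ n - real CARD('f) ^ t"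
    using Q_gt_1 by (simp add: of_nat_diff)
  moreover have "real CARD('f) ^ n = real CARD('f) ^ t * real CARD('f) ^ i"
    using i by (simp add: t_def power_add[symmetric])
  ultimately have "real CARD('f) ^ t * (real (card ?P) * (real CARD('f) - 1)) = real CARD('f) ^ t * (real CARD('f) ^ i - 1)"
    by (simp add: algebra_simps)
  then have "real (card ?P) * (real CARD('f) - 1) = real CARD('f) ^ i - 1" using Q_gt_1 by simp
  then show ?thesis using Q_gt_1 by (simp add: field_simps)
qed

section \<open>Distances and intersection numbers\<close>

definition del :: "('f ^ 'v) set \<Rightarrow> ('f ^ 'v) set \<Rightarrow> nat" where
  "del U W = n - vec.dim (U \<inter> W)"

lemma dim_Int_le: "U \<in> gens \<Longrightarrow> vec.dim (U \<inter> W) \<le> n"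
  using vec.dim_subset[of "U \<inter> W" U] gens_D(2)[of U] by simp

lemma dim_Int_del: "U \<in> gens \<Longrightarrow> vec.dim (U \<inter> W) + del U W = n"
  using dim_Int_le[of U W] by (simp add: del_def)

lemma del_sym: "del U W = del W U"
  by (simp add: del_def Int_commute)

lemma del_le: "del U W \<le> n"
  by (simp add: del_def)

lemma del_0_iff:
  assumes "U \<in> gens" "W \<in> gens"
  shows "del U W = 0 \<longleftrightarrow> U = W"
proof
  assume "del U W = 0"
  then have "vec.dim (U \<inter> W) = n" using dim_Int_del[OF assms(1), of W] by simp
  then have "card (U \<inter> W) = CARD('f) ^ n"
    using card_subspace[OF vec.subspace_inter[OF gens_D(3)[OF assms(1)] gens_D(3)[OF assms(2)]]] by simp
  then have "U \<inter> W = U" "U \<inter> W = W"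
    using card_gen[OF assms(1)] card_gen[OF assms(2)]
      card_subset_eq[of U "U \<inter> W"] card_subset_eq[of W "U \<inter> W"] by auto
  then show "U = W" by blast
qed (use gens_D(2)[OF assms(1)] in \<open>simp add: del_def\<close>)

lemma nbrs_eq:
  assumes "W \<in> gens"
  shows "nbrs W = {W' \<in> gens. del W W' = Suc 0}"
proof -
  have "vec.dim (W \<inter> W') + 1 = n \<longleftrightarrow> del W W' = Suc 0" for W'
    using dim_Int_del[OF assms, of W'] by arith
  then show ?thesis by (simp add: nbrs_def)
qed

lemma neighbour_sum:
  fixes g :: "nat \<Rightarrow> real"
  assumes U: "U \<in> gens" and W: "W \<in> gens"
  defines "i \<equiv> del U W"
  shows "(\<Sum>W'\<in>{W' \<in> gens. del W W' = Suc 0}. g (del U W'))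
    = (real CARD('f) ^ i - 1) / (real CARD('f) - 1) * g (i - 1)
    + (real e - 1) * (real CARD('f) ^ i - 1) / (real CARD('f) - 1) * g i
    + real e * (real CARD('f) ^ n - real CARD('f) ^ i) / (real CARD('f) - 1) * g (i + 1)"
proof -
  let ?q = "real CARD('f)"
  let ?T = "U \<inter> W"
  define P1 where "P1 = {W' \<in> nbrs W. ?T \<subseteq> W' \<and> \<not> U \<inter> W' \<subseteq> W}"
  define P2 where "P2 = {W' \<in> nbrs W. ?T \<subseteq> W' \<and> U \<inter> W' \<subseteq> W}"
  define P3 where "P3 = {W' \<in> nbrs W. \<not> ?T \<subseteq> W'}"
  have i: "vec.dim ?T + i = n" unfolding i_def using U by (rule dim_Int_del)
  have sT: "vec.subspace ?T" using gens_D(3)[OF U] gens_D(3)[OF W] by (rule vec.subspace_inter)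
  have c1: "real (card P1) = (?q ^ i - 1) / (?q - 1)"
    unfolding P1_def using U W i by (rule card_nbrs_closer)
  have "{W' \<in> nbrs W. ?T \<subseteq> W'} = P1 \<union> P2" "P1 \<inter> P2 = {}" by (auto simp: P1_def P2_def)
  then have "real (card P1) + real (card P2) = real (card {W' \<in> nbrs W. ?T \<subseteq> W'})"
    by (simp add: card_Un_disjoint)
  also have "\<dots> = real e * (?q ^ i - 1) / (?q - 1)"
    by (rule card_nbrs_above[OF W _ sT i]) blast
  finally have c12: "real (card P1) + real (card P2) = real e * (?q ^ i - 1) / (?q - 1)" .
  have "nbrs W = {W' \<in> nbrs W. {0} \<subseteq> W'}"
    using vec.subspace_0 gens_D(3) by (auto simp: nbrs_def)
  then have "real (card (nbrs W)) = real e * (?q ^ n - 1) / (?q - 1)"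
    using card_nbrs_above[OF W, of "{0}" n] vec.subspace_0[OF gens_D(3)[OF W]] by simp
  moreover have split: "nbrs W = P1 \<union> P2 \<union> P3" "(P1 \<union> P2) \<inter> P3 = {}" "P1 \<inter> P2 = {}"
    by (auto simp: P1_def P2_def P3_def)
  then have "real (card (nbrs W)) = real (card P1) + real (card P2) + real (card P3)"
    by (simp add: card_Un_disjoint)
  ultimately have c3: "real (card P3) = real e * (?q ^ n - 1) / (?q - 1) - real e * (?q ^ i - 1) / (?q - 1)"
    using c12 by simp
  have d1: "del U W' = i - 1" if "W' \<in> P1" for W'
    using nbr_not_farther[OF U W, of W'] that i by (simp add: P1_def del_def)
  have d2: "del U W' = i" if "W' \<in> P2" for W'
    using nbr_not_farther[OF U W, of W'] that i by (simp add: P2_def del_def)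
  have d3: "del U W' = i + 1" if "W' \<in> P3" for W'
    using nbr_farther[OF U W, of W'] that i by (simp add: P3_def del_def)
  have "(\<Sum>W'\<in>{W' \<in> gens. del W W' = Suc 0}. g (del U W')) = (\<Sum>W'\<in>P1 \<union> P2 \<union> P3. g (del U W'))"
    by (simp only: nbrs_eq[OF W, symmetric] split(1)[symmetric])
  also have "\<dots> = (\<Sum>W'\<in>P1. g (del U W')) + (\<Sum>W'\<in>P2. g (del U W')) + (\<Sum>W'\<in>P3. g (del U W'))"
    using split by (simp add: sum.union_disjoint)
  also have "\<dots> = real (card P1) * g (i - 1) + real (card P2) * g i + real (card P3) * g (i + 1)"
    by (simp add: d1 d2 d3)
  also have "real (card P2) = (real e - 1) * (?q ^ i - 1) / (?q - 1)"
    using c12 c1 by (simp add: left_diff_distrib diff_divide_distrib)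
  also have "real (card P3) = real e * (?q ^ n - ?q ^ i) / (?q - 1)"
    unfolding c3 by (simp add: right_diff_distrib diff_divide_distrib)
  finally show ?thesis by (simp only: c1)
qed

end

section \<open>The Hermitian and the hyperbolic scheme\<close>

lemma finite_field_power_card:
  fixes x :: "'f::{field,finite}"
  shows "x ^ CARD('f) = x"
proof (cases "x = 0")
  case True
  then show ?thesis by (simp add: zero_power)
next
  case False
  let ?U = "UNIV - {0 :: 'f}"
  have "(\<Prod>y\<in>?U. y) = (\<Prod>y\<in>?U. x * y)"
    by (rule prod.reindex_bij_witness[of _ "\<lambda>y. x * y" "\<lambda>y. y / x"]) (use False in auto)
  also have "\<dots> = x ^ card ?U * (\<Prod>y\<in>?U. y)" by (simp add: prod.distrib)
  finally have "x ^ card ?U = 1" by (simp add: prod_zero_iff)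
  moreover have "CARD('f) = Suc (card ?U)" by (simp add: card_Diff_subset)
  ultimately show ?thesis by (metis mult.right_neutral power_Suc)
qed

lemma finite_field_frobenius:
  fixes x y :: "'f::{field,finite}"
  assumes "primepow q" "CARD('f) = q\<^sup>2"
  shows "(x + y) ^ q = x ^ q + y ^ q"
proof -
  obtain p k where p: "prime p" "q = p ^ k" using assms(1) by (auto simp: primepow_def)
  have char: "prime CHAR('f)"
    using finite_imp_CHAR_pos[where 'a = 'f] by (intro prime_CHAR_semidom) simp
  have "CHAR('f) dvd (p ^ k)\<^sup>2" using CHAR_dvd_CARD[where 'a = 'f] assms(2) p(2) by simp
  then have "CHAR('f) dvd p" using char prime_dvd_power by blast
  then have "CHAR('f) = p" using char p(1) primes_dvd_imp_eq by blast
  then show ?thesis using char p by (intro freshmans_dream'[of q k]) simp_all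
qed

text \<open>The trace maps into the fixed set \<open>K\<close> of the Frobenius map. Kernel and
  \<open>K\<close> are root sets of polynomials of degree \<open>q\<close>, so neither exceeds
  \<open>q\<close>; as the field has \<open>q * q\<close> elements, kernel and image both have
  exactly \<open>q\<close>, and the trace is onto \<open>K\<close>.\<close>

lemma card_trace_fibre:
  fixes s :: "'f::{field,finite}"
  assumes q: "primepow q" "CARD('f) = q\<^sup>2" and s: "s ^ q = s"
  shows "card {x. x ^ q + x = s} = q"
proof -
  have q1: "1 < q" using primepow_gt_Suc_0[OF q(1)] by simp
  note frob = finite_field_frobenius[OF q]
  define tr :: "'f \<Rightarrow> 'f" where "tr x = x ^ q + x" for x
  have tr_add: "tr (x + y) = tr x + tr y" for x y by (simp add: tr_def frob)
  define K where "K = {x::'f. x ^ q = x}"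
  have roots: "card {x::'f. x ^ q + c * x = 0} \<le> q" for c
  proof -
    let ?p = "monom 1 q + monom c 1"
    have "coeff ?p q = 1" using q1 by simp
    then have "?p \<noteq> 0" by (metis coeff_0 zero_neq_one)
    moreover have "degree ?p \<le> q"
      using q1 by (intro degree_add_le order.trans[OF degree_monom_le]) auto
    moreover have "{x. poly ?p x = 0} = {x. x ^ q + c * x = 0}" by (simp add: poly_monom)
    ultimately show ?thesis using card_poly_roots_bound[of ?p] by simp
  qed
  have ker: "card {x. tr x = 0} \<le> q" using roots[of 1] by (simp add: tr_def)
  have "K = {x. x ^ q + (- 1) * x = 0}" by (auto simp: K_def)
  then have K: "card K \<le> q" using roots[of "- 1"] by simp
  have tr_K: "tr x \<in> K" for x
  proof -
    have "x ^ q ^ 2 = x" using finite_field_power_card[of x] q(2) by simp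
    then have "(x ^ q) ^ q = x" by (simp add: power_mult[symmetric] power2_eq_square)
    then show ?thesis by (simp add: K_def tr_def frob add.commute)
  qed
  have fibre: "card {x. tr x = tr y} = card {x. tr x = 0}" for y
  proof (rule bij_betw_same_card[of "\<lambda>x. x - y"])
    have "tr (x - y) = tr x - tr y" for x using tr_add[of "x - y" y] by simp
    then show "bij_betw (\<lambda>x. x - y) {x. tr x = tr y} {x. tr x = 0}"
      by (intro bij_betw_byWitness[where f' = "\<lambda>x. x + y"]) (auto simp: tr_add)
  qed
  have "(\<Sum>t\<in>range tr. card {x \<in> UNIV. tr x = t}) = (\<Sum>x\<in>UNIV. card {t \<in> range tr. tr x = t})"
    by (rule sum_card_swap) auto
  also have "\<dots> = (\<Sum>x\<in>(UNIV :: 'f set). 1)"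
  proof (rule sum.cong[OF refl])
    fix x
    have "{t \<in> range tr. tr x = t} = {tr x}" by auto
    then show "card {t \<in> range tr. tr x = t} = 1" by simp
  qed
  finally have "CARD('f) = (\<Sum>t\<in>range tr. card {x \<in> UNIV. tr x = t})" by simp
  also have "\<dots> = (\<Sum>t\<in>range tr. card {x. tr x = 0})"
    by (intro sum.cong refl) (auto simp: fibre)
  finally have total: "q * q = card (range tr) * card {x. tr x = 0}" using q(2) by (simp add: power2_eq_square)
  have sub: "range tr \<subseteq> K" using tr_K by auto
  then have im: "card (range tr) \<le> card K" by (intro card_mono) auto
  have "q \<le> card {x. tr x = 0}"
  proof (rule ccontr)
    assume "\<not> ?thesis"
    then have "card (range tr) * card {x. tr x = 0} < q * q"
      using im K q1 by (intro mult_le_less_imp_less) (auto simp: card_gt_0_iff)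
    with total show False by simp
  qed
  then have ker_eq: "card {x. tr x = 0} = q" using ker by simp
  then have "card (range tr) = q" using total q1 by simp
  then have "range tr = K" using sub K im by (intro card_subset_eq) auto
  moreover have "s \<in> K" using s by (simp add: K_def)
  ultimately obtain y where "s = tr y" by blast
  then show ?thesis using fibre[of y] ker_eq by (simp add: tr_def)
qed

lemma hermitian_formed_space:
  fixes h :: "'f::{field,finite} ^ 'v::finite \<Rightarrow> 'f ^ 'v \<Rightarrow> 'f"
  assumes q: "primepow q" "CARD('f) = q\<^sup>2" and v: "CARD('v) = 2 * n"
    and h: "hermitian_form q h" "nondegenerate_form h"
  shows "formed_space h (\<lambda>u. h u u = 0) n q"
proof
  have q0: "0 < q" using primepow_gt_Suc_0[OF q(1)] by simp
  note frob = finite_field_frobenius[OF q]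
  have add: "h (u + v) w = h u w + h v w" and scale: "h (a *s u) w = a * h u w"
    and conj: "h w u = h u w ^ q" for a u v w
    using h(1) unfolding hermitian_form_def by blast+
  show "CARD('v) = 2 * n" by (rule v)
  show "h (u + v) w = h u w + h v w" "h (a *s u) w = a * h u w" for a u v w by (rule add scale)+
  show refl: "h w u = 0" if "h u w = 0" for u w using that q0 conj[of w u] by (simp add: zero_power)
  show "h (a *s u) (a *s u) = 0" if "h u u = 0" for a u
  proof -
    have "h (a *s u) u = 0" using that scale by simp
    then have "h u (a *s u) = 0" by (rule refl)
    then show ?thesis using scale by simp
  qed
  show "h (u + v) (u + v) = 0" if "h u u = 0" "h v v = 0" "h u v = 0" for u v
  proof -
    have "h (u + v) u = 0" "h (u + v) v = 0" using that refl[of u v] by (simp_all add: add)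
    then have "h u (u + v) = 0" "h v (u + v) = 0" using refl by blast+
    then show ?thesis by (simp add: add)
  qed
  show "h u u = 0" if "h u u = 0" for u by (rule that)
  show "u = 0" if "\<And>w. h u w = 0" for u
    using that h(2) by (auto simp: nondegenerate_form_def)
  show "card {a. h (z + a *s w) (z + a *s w) = 0} = q" if w: "h w w = 0" "h w z \<noteq> 0" for w z
  proof -
    \<comment> \<open>The form on the line is \<open>h z z\<close> plus the trace of
      \<open>a * h w z\<close>, so the pencil count is the size of a trace fibre.\<close>
    have eq: "h (z + a *s w) (z + a *s w) = h z z + ((a * h w z) ^ q + a * h w z)" for a
    proof -
      have "h z (z + a *s w) = (h z z + a * h w z) ^ q"
        using conj[of z "z + a *s w"] by (simp add: add scale)
      also have "\<dots> = h z z + (a * h w z) ^ q" using conj[of z z] by (simp add: frob)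
      finally have 1: "h z (z + a *s w) = h z z + (a * h w z) ^ q" .
      have "h w (z + a *s w) = (h z w) ^ q"
        using conj[of w "z + a *s w"] w(1) by (simp add: add scale)
      also have "\<dots> = h w z" using conj[of w z] by simp
      finally have "h w (z + a *s w) = h w z" .
      with 1 show ?thesis using add[of z "a *s w" "z + a *s w"] scale[of a w] by (simp add: add.assoc)
    qed
    have "card {a. h (z + a *s w) (z + a *s w) = 0} = card {x. x ^ q + x = - h z z}"
    proof (rule bij_betw_same_card[of "\<lambda>a. a * h w z"])
      show "bij_betw (\<lambda>a. a * h w z) {a. h (z + a *s w) (z + a *s w) = 0} {x. x ^ q + x = - h z z}"
        using w(2) unfolding eq
        by (intro bij_betw_byWitness[where f' = "\<lambda>x. x / h w z"])
           (auto simp: eq_neg_iff_add_eq_0 add.commute)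
    qed
    also have "\<dots> = q"
    proof (rule card_trace_fibre[OF q])
      \<comment> \<open>Additivity gives \<open>(- x)^q = - (x^q)\<close> for even and odd
        \<open>q\<close> alike.\<close>
      have "(h z z + - h z z) ^ q = h z z ^ q + (- h z z) ^ q" by (rule frob)
      then have "h z z ^ q + (- h z z) ^ q = 0" using q0 by (simp add: zero_power)
      then have "h z z + (- h z z) ^ q = 0" using conj[of z z] by simp
      then show "(- h z z) ^ q = - h z z" by (simp add: add_eq_0_iff)
    qed
    finally show ?thesis .
  qed
qed

lemma hermitian_scheme:
  fixes X :: "('f::{field,finite} ^ 'v::finite) set set"
  assumes q: "primepow q" and case1: "hermitian_case q n X R b c"
  shows "\<exists>del. negative_base_scheme (real q) b c (1 - (real q)\<^sup>2) n X del R"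
proof -
  obtain h where h: "hermitian_form q h" "nondegenerate_form h"
    and X: "X = {U. totally_isotropic h U \<and> vec.dim U = n}"
    and Q: "CARD('f) = q\<^sup>2" and v: "CARD('v) = 2 * n"
    and R: "R = (\<lambda>i. {(U, W) \<in> X \<times> X. vec.dim (U \<inter> W) + i = n})" and b: "b = - real q" and c: "c = - 1"
    using case1 unfolding hermitian_case_def by blast
  interpret F: formed_space h "\<lambda>u. h u u = 0" n q
    by (rule hermitian_formed_space[OF q Q v h])
  have XF: "X = F.gens" unfolding X F.gens_def F.TS_def totally_isotropic_def by blast
  have q1: "1 < real q" using primepow_gt_Suc_0[OF q] by simp
  have q2: "1 < (real q)\<^sup>2" using q1 by simp
  have b_abs: "1 < \<bar>b ^ k\<bar>" if "1 \<le> k" for k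
    using q1 that by (simp add: b power_abs one_less_power)
  interpret P: negative_base_parameters "real q" b c "1 - (real q)\<^sup>2" n
  proof
    show "1 - (real q)\<^sup>2 \<noteq> 0" "1 - (real q)\<^sup>2 < 0" using q2 by linarith+
    show "b ^ k \<noteq> 1" if "1 \<le> k" for k using b_abs[OF that] by auto
    show "real q * b ^ r \<noteq> 1" for r using b_abs[of "Suc r"] by (auto simp: b)
    show "real q * c * b ^ k \<noteq> 1" for k using b_abs[of "Suc k"] by (auto simp: b c)
  qed (use q1 b c in auto)
  have b2: "b ^ (2 * k) = (real q)\<^sup>2 ^ k" for k by (simp add: b power_mult)
  \<comment> \<open>This converts the products in base \<open>- q\<close> into the powers of
    \<open>q^2\<close> that come from counting over a field with \<open>q^2\<close>
    elements.\<close>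
  have bb: "(b ^ k - 1) * (- 1 * b ^ k - 1) = 1 - (real q)\<^sup>2 ^ k" for k
  proof -
    have "b ^ (2 * k) = b ^ k * b ^ k" by (simp add: mult_2 power_add)
    then show ?thesis unfolding b2[symmetric] by (simp add: algebra_simps)
  qed
  have closer: "P.num_closer i = ((real q)\<^sup>2 ^ i - 1) / ((real q)\<^sup>2 - 1)" for i
    unfolding P.num_closer_def P.q_over_b bb by (metis minus_diff_eq minus_divide_divide)
  have farther: "P.num_farther i = real q * ((real q)\<^sup>2 ^ n - (real q)\<^sup>2 ^ i) / ((real q)\<^sup>2 - 1)" if "i \<le> n" for i
  proof -
    have "P.num_farther i = real q * (real q)\<^sup>2 ^ i * ((b ^ (n - i) - 1) * (- 1 * b ^ (n - i) - 1)) / (1 - (real q)\<^sup>2)"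
      unfolding P.num_farther_def b2 by (simp only: c mult.assoc)
    also have "\<dots> = real q * (real q)\<^sup>2 ^ i * (1 - (real q)\<^sup>2 ^ (n - i)) / (1 - (real q)\<^sup>2)"
      by (simp only: bb)
    also have "\<dots> = real q * ((real q)\<^sup>2 ^ i * ((real q)\<^sup>2 ^ (n - i) - 1)) / ((real q)\<^sup>2 - 1)"
      by (metis (no_types, opaque_lifting) minus_diff_eq minus_divide_divide mult.assoc mult_minus_right)
    also have "(real q)\<^sup>2 ^ i * ((real q)\<^sup>2 ^ (n - i) - 1) = (real q)\<^sup>2 ^ n - (real q)\<^sup>2 ^ i"
      using that by (simp add: right_diff_distrib power_add[symmetric])
    finally show ?thesis .
  qed
  have "negative_base_scheme (real q) b c (1 - (real q)\<^sup>2) n X F.del R"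
  proof unfold_locales
    show "finite X" by simp
    show "F.del x y = F.del y x" for x y by (rule F.del_sym)
    show "F.del x y \<le> n" for x y by (rule F.del_le)
    show "F.del x y = 0 \<longleftrightarrow> x = y" if "x \<in> X" "y \<in> X" for x y using that XF F.del_0_iff by simp
    show "R i = {(x, y) \<in> X \<times> X. F.del x y = i}" for i
    proof -
      have "vec.dim (x \<inter> y) + i = n \<longleftrightarrow> F.del x y = i" if "x \<in> X" for x y
        using F.dim_Int_del[of x y] that XF by auto
      then show ?thesis unfolding R by auto
    qed
    show "(\<Sum>z\<in>{z \<in> X. F.del y z = Suc 0}. g (F.del x z)) = P.step g (F.del x y)"
      if "x \<in> X" "y \<in> X" for g x y
    proof -
      have Qr: "real CARD('f) = (real q)\<^sup>2" using Q by simp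
      have lev: "P.num_level i = (real q - 1) * ((real q)\<^sup>2 ^ i - 1) / ((real q)\<^sup>2 - 1)" if "i \<le> n" for i
        unfolding P.num_level_def farther[OF that] farther[OF le0] closer
        by (simp add: algebra_simps diff_divide_distrib add_divide_distrib)
      show ?thesis
        using F.neighbour_sum[of x y g] that XF
        unfolding P.step_def closer lev[OF F.del_le] farther[OF F.del_le] Qr by simp
    qed
  qed
  then show ?thesis by blast
qed

section \<open>The bipartite dual polar graph and its halved graph\<close>

locale hyperbolic_space = formed_space B S m 1
  for B :: "'f::{field,finite} ^ 'v::finite \<Rightarrow> 'f ^ 'v \<Rightarrow> 'f" and S m
begin

text \<open>With \<open>e = 1\<close> no neighbour keeps its distance; \<open>up\<close> and
  \<open>down\<close> are the intersection numbers \<open>b_k\<close> and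
  \<open>c_k\<close>.\<close>

definition up :: "nat \<Rightarrow> real" where
  "up k = (real CARD('f) ^ m - real CARD('f) ^ k) / (real CARD('f) - 1)"

definition down :: "nat \<Rightarrow> real" where
  "down k = (real CARD('f) ^ k - 1) / (real CARD('f) - 1)"

lemma down_0 [simp]: "down 0 = 0"
  by (simp add: down_def)

lemma down_pos: "0 < k \<Longrightarrow> 0 < down k"
  using Q_gt_1 by (simp add: down_def one_less_power)

lemma up_down: "down k + up k = up 0"
  by (simp add: up_def down_def add_divide_distrib[symmetric])

abbreviation adjacent :: "('f ^ 'v) set \<Rightarrow> ('f ^ 'v) set set" where
  "adjacent W \<equiv> {W' \<in> gens. del W W' = Suc 0}"

lemma adjacent_sum:
  fixes g :: "nat \<Rightarrow> real"
  assumes "U \<in> gens" "W \<in> gens"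
  shows "(\<Sum>W'\<in>adjacent W. g (del U W')) = down (del U W) * g (del U W - 1) + up (del U W) * g (del U W + 1)"
  using neighbour_sum[OF assms, of g] by (simp add: up_def down_def)

lemma adjacent_parity:
  assumes U: "U \<in> gens" and W: "W \<in> gens" and W': "W' \<in> adjacent W"
  shows "even (del U W') \<longleftrightarrow> odd (del U W)"
proof (rule ccontr)
  assume *: "\<not> ?thesis"
  \<comment> \<open>The indicator of the parity of \<open>del U W\<close>. Its neighbour sum
    involves only distances of the other parity, or the factor \<open>down 0 = 0\<close>, so it is
    zero, whereas a counterexample \<open>W'\<close> would contribute.\<close>
  let ?g = "\<lambda>k. of_bool (even k \<longleftrightarrow> even (del U W)) :: real"
  have "0 < (\<Sum>W'\<in>adjacent W. ?g (del U W'))"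
    using W' * by (intro sum_pos2[of _ W']) auto
  also have "\<dots> = down (del U W) * ?g (del U W - 1) + up (del U W) * ?g (del U W + 1)"
    by (rule adjacent_sum[OF U W])
  also have "\<dots> = 0" by (cases "del U W") auto
  finally show False by simp
qed

lemma exists_closer:
  assumes U: "U \<in> gens" and W: "W \<in> gens" and k: "del U W = Suc k"
  obtains W' where "W' \<in> adjacent W" "del U W' = k"
proof -
  have "(\<Sum>W'\<in>adjacent W. of_bool (del U W' = k)) = down (Suc k)"
    using adjacent_sum[OF U W, of "\<lambda>j. of_bool (j = k)"] k by simp
  also have "\<dots> \<noteq> 0" using down_pos[of "Suc k"] by simp
  finally obtain W' where "W' \<in> adjacent W" "of_bool (del U W' = k) \<noteq> (0::real)"
    by (rule sum.not_neutral_contains_not_neutral)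
  then show thesis using that by (cases "del U W' = k") auto
qed

text \<open>Moving \<open>Z\<close> one step towards \<open>W\<close> changes the parity of both
  \<open>del W Z\<close> and \<open>del U Z\<close>.\<close>

lemma del_parity:
  assumes "U \<in> gens" "W \<in> gens" "Z \<in> gens"
  shows "even (del U W + del W Z + del U Z)"
  using assms(3)
proof (induction "del W Z" arbitrary: Z)
  case 0
  then have "W = Z" using del_0_iff assms by simp
  with 0 show ?case by simp
next
  case (Suc k)
  obtain Z' where Z': "Z' \<in> adjacent Z" "del W Z' = k"
    by (rule exists_closer[OF assms(2) Suc.prems Suc.hyps(2)[symmetric]])
  have "even (del U W + del W Z' + del U Z')" using Suc.hyps(1)[of Z'] Z' by simp
  moreover have "even (del U Z') \<longleftrightarrow> odd (del U Z)" using adjacent_parity[OF assms(1) Suc.prems Z'(1)] .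
  ultimately show ?case using Z'(2) Suc.hyps(2)[symmetric] by auto
qed

text \<open>
  Two steps in the bipartite dual polar graph either return to the start or lead to a generator
  at distance two, so the halved graph inherits its parameters from the graph.
\<close>

lemma two_step_sum:
  fixes g :: "nat \<Rightarrow> real"
  assumes U: "U \<in> gens" and W: "W \<in> gens" and i: "del U W = 2 * i"
  shows "down 2 * (\<Sum>Z\<in>{Z \<in> gens. del W Z = 2}. g (del U Z div 2))
    = down (2 * i) * down (2 * i - 1) * g (i - 1)
    + (up 0 * (up 0 - 1) - down (2 * i) * down (2 * i - 1) - up (2 * i) * up (2 * i + 1)) * g i
    + up (2 * i) * up (2 * i + 1) * g (i + 1)"
proof -
  \<comment> \<open>Lifts \<open>g\<close> from halved distances to those of the dual polar graph;
    only the values at even distances survive two steps.\<close>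
  define G where "G k = g (k div 2)" for k
  define H where "H k = down k * G (k - 1) + up k * G (k + 1)" for k
  have "(\<Sum>V\<in>adjacent W. \<Sum>Z\<in>adjacent V. G (del U Z)) = (\<Sum>V\<in>adjacent W. H (del U V))"
    using adjacent_sum[OF U, of _ G] by (intro sum.cong refl) (simp add: H_def)
  also have "\<dots> = down (2 * i) * H (2 * i - 1) + up (2 * i) * H (2 * i + 1)"
    using adjacent_sum[OF U W, of H] i by simp
  also have "down (2 * i) * H (2 * i - 1)
      = down (2 * i) * (down (2 * i - 1) * g (i - 1) + up (2 * i - 1) * g i)"
  proof (cases i)
    case (Suc i')
    have "(2 * i - 1 - 1) div 2 = i - 1" "(2 * i - 1 + 1) div 2 = i" using Suc by auto
    then show ?thesis by (simp add: H_def G_def)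
  qed simp
  also have "H (2 * i + 1) = down (2 * i + 1) * g i + up (2 * i + 1) * g (i + 1)"
    by (simp add: H_def G_def)
  finally have 1: "(\<Sum>V\<in>adjacent W. \<Sum>Z\<in>adjacent V. G (del U Z))
    = down (2 * i) * (down (2 * i - 1) * g (i - 1) + up (2 * i - 1) * g i)
    + up (2 * i) * (down (2 * i + 1) * g i + up (2 * i + 1) * g (i + 1))" .
  \<comment> \<open>The number of two-step walks from \<open>W\<close> to \<open>Z\<close>:
    \<open>down 2\<close> at distance two, the valency \<open>up 0\<close> for a return.\<close>
  have inner: "(\<Sum>V\<in>adjacent W. of_bool (del Z V = Suc 0))
      = (if del W Z = 2 then down 2 else 0) + (if Z = W then up 0 else 0)" if Z: "Z \<in> gens" for Z
  proof -
    have "(\<Sum>V\<in>adjacent W. of_bool (del Z V = Suc 0))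
        = down (del Z W) * of_bool (del Z W - 1 = Suc 0) + up (del Z W) * of_bool (del Z W + 1 = Suc 0)"
      using adjacent_sum[OF Z W, of "\<lambda>k. of_bool (k = Suc 0)"] by simp
    moreover have "del Z W = 0 \<longleftrightarrow> Z = W" using del_0_iff[OF Z W] .
    moreover have "del Z W - 1 = Suc 0 \<longleftrightarrow> del Z W = 2" by arith
    ultimately show ?thesis by (auto simp: del_sym[of W Z])
  qed
  have "(\<Sum>V\<in>adjacent W. \<Sum>Z\<in>adjacent V. G (del U Z))
      = (\<Sum>V\<in>adjacent W. \<Sum>Z\<in>gens. of_bool (del Z V = Suc 0) * G (del U Z))"
  proof (rule sum.cong[OF refl])
    fix V
    show "(\<Sum>Z\<in>adjacent V. G (del U Z)) = (\<Sum>Z\<in>gens. of_bool (del Z V = Suc 0) * G (del U Z))"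
      by (intro sum.mono_neutral_cong_left) (auto simp: del_sym[of V])
  qed
  also have "\<dots> = (\<Sum>Z\<in>gens. \<Sum>V\<in>adjacent W. of_bool (del Z V = Suc 0) * G (del U Z))"
    by (rule sum.swap)
  also have "\<dots> = (\<Sum>Z\<in>gens. (if del W Z = 2 then down 2 * G (del U Z) else 0)
      + (if Z = W then up 0 * G (del U Z) else 0))"
    unfolding sum_distrib_right[symmetric] by (intro sum.cong refl) (subst inner, auto simp: distrib_right)
  also have "\<dots> = down 2 * (\<Sum>Z\<in>{Z \<in> gens. del W Z = 2}. G (del U Z)) + up 0 * g i"
    using W i by (simp add: sum.distrib sum.inter_filter[symmetric] sum_distrib_left G_def)
  finally have 2: "(\<Sum>V\<in>adjacent W. \<Sum>Z\<in>adjacent V. G (del U Z))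
     = down 2 * (\<Sum>Z\<in>{Z \<in> gens. del W Z = 2}. G (del U Z)) + up 0 * g i" .
  have ud: "up (2 * i - 1) = up 0 - down (2 * i - 1)" "down (2 * i + 1) = up 0 - up (2 * i + 1)"
    "up (2 * i) = up 0 - down (2 * i)"
    using up_down[of "2 * i - 1"] up_down[of "2 * i + 1"] up_down[of "2 * i"] by simp_all
  have "down 2 * (\<Sum>Z\<in>{Z \<in> gens. del W Z = 2}. G (del U Z))
    = down (2 * i) * (down (2 * i - 1) * g (i - 1) + up (2 * i - 1) * g i)
    + up (2 * i) * (down (2 * i + 1) * g i + up (2 * i + 1) * g (i + 1)) - up 0 * g i"
    using 1 2 by simp
  then show ?thesis
    unfolding G_def ud by (simp add: algebra_simps)
qed

end

lemma quadratic_hyperbolic_space: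
  fixes Q :: "'f::{field,finite} ^ 'v::finite \<Rightarrow> 'f"
  assumes v: "CARD('v) = 2 * m" and Q: "quadratic_form Q" "nondegenerate_quadratic Q"
  shows "hyperbolic_space (polar_form Q) (\<lambda>u. Q u = 0) m"
proof
  have scaleQ: "Q (a *s u) = a\<^sup>2 * Q u" and add: "polar_form Q (u + v) w = polar_form Q u w + polar_form Q v w"
    and scale: "polar_form Q (a *s u) w = a * polar_form Q u w" for a u v w
    using Q(1) unfolding quadratic_form_def by blast+
  have sym: "polar_form Q u w = polar_form Q w u" for u w by (simp add: polar_form_def add.commute)
  have Q_add: "Q (u + w) = Q u + Q w + polar_form Q u w" for u w by (simp add: polar_form_def)
  show "CARD('v) = 2 * m" by (rule v)
  show "polar_form Q (u + v) w = polar_form Q u w + polar_form Q v w"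
    "polar_form Q (a *s u) w = a * polar_form Q u w" for a u v w by (rule add scale)+
  show "polar_form Q w u = 0" if "polar_form Q u w = 0" for u w using that sym by simp
  show "Q (a *s u) = 0" if "Q u = 0" for a u using that scaleQ by simp
  show "Q (u + v) = 0" if "Q u = 0" "Q v = 0" "polar_form Q u v = 0" for u v using that Q_add by simp
  show "polar_form Q u u = 0" if "Q u = 0" for u
  proof -
    \<comment> \<open>\<open>Q (u + u)\<close> is a multiple of \<open>Q u\<close>, which gives
      \<open>polar_form Q u u = 0\<close> in every characteristic.\<close>
    have "u + u = (1 + 1) *s u" by (simp only: vec.scale_left_distrib vec.scale_one)
    then have "Q (u + u) = 0" using scaleQ[of "1 + 1" u] that by simp
    then show ?thesis using that by (simp add: polar_form_def)
  qed
  show "u = 0" if "Q u = 0" "\<And>w. polar_form Q u w = 0" for u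
    using that Q(2) by (auto simp: nondegenerate_quadratic_def)
  show "card {a. Q (z + a *s w) = 0} = 1" if w: "Q w = 0" "polar_form Q w z \<noteq> 0" for w z
  proof -
    \<comment> \<open>Along a singular direction the form is linear in \<open>a\<close>, so there is
      exactly one zero.\<close>
    have "Q (z + a *s w) = Q z + a * polar_form Q w z" for a
      using Q_add[of z "a *s w"] scaleQ[of a w] w(1) sym[of z "a *s w"] scale[of a w z] by simp
    then have "{a. Q (z + a *s w) = 0} = {- Q z / polar_form Q w z}"
      using w(2) by (auto simp: field_simps add_eq_0_iff)
    then show ?thesis by simp
  qed
qed

lemma hyperbolic_scheme:
  fixes X :: "('f::{field,finite} ^ 'v::finite) set set"
  assumes q: "primepow q" and case2: "hyperbolic_case q n X R b c"
  shows "\<exists>del. distance_scheme (real q) b c ((real q - 1) * ((real q)\<^sup>2 - 1)) n X del R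
    \<and> 1 < b \<and> 1 < real q \<and> 1 \<le> real q * c"
proof -
  obtain m Qf G where Q: "CARD('f) = q" and v: "CARD('v) = 2 * m" and nm: "n = m div 2"
    and Qf: "quadratic_form Qf" "nondegenerate_quadratic Qf"
    and G: "G = {U. totally_singular Qf U \<and> vec.dim U = m}" and X: "X \<in> G // same_class_rel m G"
    and R: "R = (\<lambda>i. {(U, W) \<in> X \<times> X. vec.dim (U \<inter> W) + 2 * i = m})"
    and b: "b = (real q)\<^sup>2" and c: "c = (if even m then 1 / real q else real q)"
    using case2 unfolding hyperbolic_case_def by blast
  interpret F: hyperbolic_space "polar_form Qf" "\<lambda>u. Qf u = 0" m
    by (rule quadratic_hyperbolic_space[OF v Qf])
  have "Qf (u + w) = 0" if "vec.subspace U" "\<forall>u\<in>U. Qf u = 0" "u \<in> U" "w \<in> U" for U u w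
    using that vec.subspace_add by blast
  then have GF: "G = F.gens"
    unfolding G F.gens_def F.TS_def totally_singular_def polar_form_def by auto
  obtain U0 where U0: "U0 \<in> F.gens" and X0: "X = same_class_rel m G `` {U0}"
    using X GF by (auto elim: quotientE)
  \<comment> \<open>By this and \<open>del_parity\<close> the class of \<open>U0\<close> is closed
    under even distance, so it carries the whole halved graph around each of its points.\<close>
  have X_iff: "W \<in> X \<longleftrightarrow> W \<in> F.gens \<and> even (F.del U0 W)" for W
  proof -
    have "vec.dim (U0 \<inter> W) + F.del U0 W = m" using U0 by (rule F.dim_Int_del)
    then have "(even (vec.dim (U0 \<inter> W)) \<longleftrightarrow> even m) \<longleftrightarrow> even (F.del U0 W)" by (metis even_add)
    then show ?thesis using U0 by (auto simp: X0 same_class_rel_def GF)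
  qed
  have even_del: "even (F.del U W)" if "U \<in> X" "W \<in> X" for U W
    using F.del_parity[OF U0, of U W] that X_iff by auto
  have X_closed: "W \<in> X" if "U \<in> X" "W \<in> F.gens" "even (F.del U W)" for U W
    using F.del_parity[OF U0, of U W] that X_iff by auto
  have q1: "1 < real q" using primepow_gt_Suc_0[OF q] by simp
  have b1: "1 < b" using q1 by (simp add: b)
  have qc: "1 \<le> real q * c" using q1 b1 by (auto simp: c b power2_eq_square)
  interpret P: scheme_parameters "real q" b c "(real q - 1) * ((real q)\<^sup>2 - 1)" n
  proof
    show "b ^ k \<noteq> 1" if "1 \<le> k" for k using one_less_power[OF b1, of k] that by simp
    show "real q * b ^ r \<noteq> 1" for r
    proof -
      have "1 * 1 < real q * b ^ r" using q1 b1 by (intro mult_less_le_imp_less one_le_power) auto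
      then show ?thesis by simp
    qed
    show "real q * c * b ^ k \<noteq> 1" if "1 \<le> k" for k
    proof -
      have "1 * 1 < real q * c * b ^ k"
        using qc one_less_power[OF b1, of k] that by (intro mult_le_less_imp_less) auto
      then show ?thesis by simp
    qed
    have "real q - 1 \<noteq> 0" "(real q)\<^sup>2 - 1 \<noteq> 0" using q1 b1 b by linarith+
    then show "(real q - 1) * ((real q)\<^sup>2 - 1) \<noteq> 0" by simp
  qed (use b1 in auto)
  define r where "r = real q"
  have r1: "1 < r" using q1 by (simp add: r_def)
  have down2: "F.down 2 = r + 1"
    using r1 by (simp add: F.down_def Q r_def[symmetric] field_simps power2_eq_square)
  let ?D = "(r - 1) * (r\<^sup>2 - 1)"
  \<comment> \<open>\<open>D\<close> combines the denominators \<open>r - 1\<close> of two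
    \<open>up\<close> or \<open>down\<close> values with \<open>down 2 = r + 1\<close>, which counts
    each halved-graph neighbour's two-step walks.\<close>
  have D: "?D = (r - 1) * (r - 1) * (r + 1)" by (simp add: power2_eq_square algebra_simps)
  have br: "b ^ k = r ^ (2 * k)" for k by (simp add: b r_def power_mult)
  have closer: "P.num_closer i = F.down (2 * i) * F.down (2 * i - 1) / F.down 2" for i
  proof (cases i)
    case 0
    then show ?thesis by (simp add: P.num_closer_def)
  next
    case (Suc j)
    have "r / b * b ^ i = r * b ^ j" using b1 Suc by simp
    then have e: "r / b * r ^ (2 * i) = r ^ (2 * i - 1)" unfolding br by (simp add: Suc)
    have "P.num_closer i = (r ^ (2 * i) - 1) * (r ^ (2 * i - 1) - 1) / ((r - 1) * (r - 1) * (r + 1))"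
      unfolding P.num_closer_def unfolding r_def[symmetric] unfolding br e D ..
    also have "\<dots> = (r ^ (2 * i) - 1) / (r - 1) * ((r ^ (2 * i - 1) - 1) / (r - 1)) / (r + 1)"
      by (simp only: times_divide_times_eq divide_divide_eq_left)
    finally show ?thesis
      unfolding down2 unfolding F.down_def Q r_def .
  qed
  have farther: "P.num_farther i = F.up (2 * i) * F.up (2 * i + 1) / F.down 2" if i: "i \<le> n" for i
  proof -
    have *: "r * b ^ (2 * i) * (b ^ (n - i) - 1) * (c * b ^ (n - i) - 1)
        = (r ^ m - r ^ (2 * i)) * (r ^ m - r ^ (2 * i + 1))"
    proof -
      define I K where "I = r ^ (2 * i)" and "K = r ^ (2 * (n - i))"
      have bI: "b ^ (2 * i) = I * I" and bK: "b ^ (n - i) = K"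
        by (simp_all add: br I_def K_def power_add[symmetric])
      have rI: "r ^ (2 * i + 1) = I * r" by (simp add: I_def)
      have rm: "r * (K - 1) * (c * K - 1) * (I * I) = (r ^ m - I) * (r ^ m - I * r)"
      \<comment> \<open>\<open>m\<close> is \<open>2 * n\<close> or \<open>2 * n + 1\<close>; the
        two values of \<open>c\<close> compensate for the missing or additional factor
        \<open>r\<close> in \<open>r ^ m\<close>.\<close>
      proof (cases "even m")
        case True
        then have m: "m = 2 * i + 2 * (n - i)" using nm i by auto
        have rm: "r ^ m = I * K" unfolding I_def K_def by (subst m) (rule power_add)
        have rc: "r * c = 1" using True r1 by (simp add: c r_def)
        have "r * (K - 1) * (c * K - 1) * (I * I) = (K - 1) * (r * c * K - r) * (I * I)"
          by (simp add: algebra_simps)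
        then show ?thesis unfolding rm rc by (simp add: algebra_simps)
      next
        case False
        then have m: "m = 2 * i + 2 * (n - i) + 1" using nm i by presburger
        have rm: "r ^ m = I * K * r" unfolding I_def K_def by (subst m) (simp add: power_add)
        have "c = r" using False by (simp add: c r_def)
        then show ?thesis unfolding rm by (simp add: algebra_simps)
      qed
      show ?thesis unfolding bI bK rI I_def[symmetric] rm[symmetric] by (simp add: ac_simps)
    qed
    have "P.num_farther i = (r ^ m - r ^ (2 * i)) * (r ^ m - r ^ (2 * i + 1)) / ((r - 1) * (r - 1) * (r + 1))"
      unfolding P.num_farther_def unfolding r_def[symmetric] unfolding * D ..
    also have "\<dots> = (r ^ m - r ^ (2 * i)) / (r - 1) * ((r ^ m - r ^ (2 * i + 1)) / (r - 1)) / (r + 1)"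
      by (simp only: times_divide_times_eq divide_divide_eq_left)
    finally show ?thesis
      unfolding down2 unfolding F.up_def Q r_def .
  qed
  have level: "P.num_level i = (F.up 0 * (F.up 0 - 1) - F.down (2 * i) * F.down (2 * i - 1)
      - F.up (2 * i) * F.up (2 * i + 1)) / F.down 2" if "i \<le> n" for i
  proof -
    have "F.down 1 = 1" using r1 by (simp add: F.down_def Q r_def[symmetric])
    then have "F.up 1 = F.up 0 - 1" using F.up_down[of 1] by simp
    then show ?thesis
      unfolding P.num_level_def farther[OF that] farther[OF le0] closer
      by (simp add: diff_divide_distrib)
  qed
  have down2_pos: "0 < F.down 2" by (rule F.down_pos) simp
  have "distance_scheme (real q) b c ((real q - 1) * ((real q)\<^sup>2 - 1)) n X (\<lambda>U W. F.del U W div 2) R"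
  proof unfold_locales
    show "finite X" by simp
    show "F.del x y div 2 = F.del y x div 2" for x y by (simp add: F.del_sym)
    show "F.del x y div 2 \<le> n" for x y using F.del_le[of x y] nm by (simp add: div_le_mono)
    show "F.del x y div 2 = 0 \<longleftrightarrow> x = y" if "x \<in> X" "y \<in> X" for x y
      using even_del[OF that] F.del_0_iff[of x y] that X_iff by auto
    show "R i = {(x, y) \<in> X \<times> X. F.del x y div 2 = i}" for i
    proof -
      have "vec.dim (x \<inter> y) + 2 * i = m \<longleftrightarrow> F.del x y div 2 = i" if "x \<in> X" "y \<in> X" for x y
        using F.dim_Int_del[of x y] even_del[OF that] that X_iff by auto
      then show ?thesis unfolding R by auto
    qed
    show "(\<Sum>z\<in>{z \<in> X. F.del y z div 2 = Suc 0}. g (F.del x z div 2)) = P.step g (F.del x y div 2)"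
      if xy: "x \<in> X" "y \<in> X" for g x y
    proof -
      define i where "i = F.del x y div 2"
      have i: "F.del x y = 2 * i" using even_del[OF xy] by (simp add: i_def)
      have i_le: "i \<le> n" using F.del_le[of x y] nm by (simp add: i_def div_le_mono)
      have "z \<in> X \<and> F.del y z div 2 = Suc 0 \<longleftrightarrow> z \<in> F.gens \<and> F.del y z = 2" for z
      proof (cases "z \<in> X")
        case True
        then show ?thesis using even_del[OF xy(2) True] X_iff[of z] by (auto elim!: evenE)
      next
        case False
        then show ?thesis using X_closed[OF xy(2), of z] by auto
      qed
      then have "{z \<in> X. F.del y z div 2 = Suc 0} = {z \<in> F.gens. F.del y z = 2}" by blast
      then have "F.down 2 * (\<Sum>z\<in>{z \<in> X. F.del y z div 2 = Suc 0}. g (F.del x z div 2))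
          = F.down 2 * P.step g i"
        using F.two_step_sum[of x y i g] xy X_iff i down2_pos
        unfolding P.step_def closer level[OF i_le] farther[OF i_le]
        by (simp add: distrib_left)
      then show ?thesis using down2_pos by (simp add: i_def)
    qed
  qed
  then show ?thesis using b1 q1 qc by blast
qed

theorem theorem3p1:
  fixes X :: "('f::{field,finite} ^ 'v::finite) set set"
    and R :: "nat \<Rightarrow> (('f ^ 'v) set \<times> ('f ^ 'v) set) set"
    and q n d :: nat and b c :: real
  assumes "primepow q"
    and "hermitian_case q n X R b c \<or> hyperbolic_case q n X R b c"
    and "1 \<le> d" and "d \<le> n"
  shows
    "(\<forall>Y. is_code d X R Y \<longrightarrow>
        (odd d \<or> hyperbolic_case q n X R b c \<longrightarrow>
           real (card Y) \<le> code_bound (card X) (real q) b c n d) \<and>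
        (hermitian_case q n X R b c \<and> even d \<longrightarrow>
           real (card Y) \<le> code_bound (card X) (real q) b c n d * even_factor (real q) b n d))
     \<and>
     (\<forall>(X' :: 'x set) R' P Q Y.
        symmetric_association_scheme n X' R' \<and>
        PQ_numbers n X R P Q \<and> PQ_numbers n X' R' P Q \<and>
        is_code d X' R' Y \<longrightarrow>
        (odd d \<or> hyperbolic_case q n X R b c \<longrightarrow>
           real (card Y) \<le> code_bound (card X) (real q) b c n d) \<and>
        (hermitian_case q n X R b c \<and> even d \<longrightarrow>
           real (card Y) \<le> code_bound (card X) (real q) b c n d * even_factor (real q) b n d))"
proof (cases "hyperbolic_case q n X R b c")
  case True
  then have "CARD('f) = q" by (auto simp: hyperbolic_case_def)
  \<comment> \<open>The field has \<open>q\<close> elements in one case and \<open>q^2\<close> in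
    the other, so the cases exclude each other.\<close>
  moreover have "q \<noteq> q\<^sup>2" using primepow_gt_Suc_0[OF assms(1)] by (simp add: power2_eq_square)
  ultimately have not1: "\<not> hermitian_case q n X R b c" by (auto simp: hermitian_case_def)
  obtain del where scheme: "distance_scheme (real q) b c ((real q - 1) * ((real q)\<^sup>2 - 1)) n X del R"
    and pos: "1 < b" "1 < real q" "1 \<le> real q * c"
    using hyperbolic_scheme[OF assms(1) True] by auto
  interpret distance_scheme "real q" b c "(real q - 1) * ((real q)\<^sup>2 - 1)" n X del R
    by (rule scheme)
  have "\<exists>f. certificate d f \<and> f 0 = code_bound (card X) (real q) b c n d"
    using assms(3,4) pos by (intro single_term_certificate eig_pos_of_positive_base) auto
  from certificate_bounds[OF this assms(4), where 'y = 'x] not1 show ?thesis by blast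
next
  case False
  then have "hermitian_case q n X R b c" using assms(2) by blast
  then obtain del where scheme: "negative_base_scheme (real q) b c (1 - (real q)\<^sup>2) n X del R"
    using hermitian_scheme[OF assms(1)] by blast
  interpret negative_base_scheme "real q" b c "1 - (real q)\<^sup>2" n X del R
    by (rule scheme)
  show ?thesis
  proof (cases "even d")
    case True
    from certificate_bounds[OF even_certificate[OF True assms(3,4)] assms(4), where 'y = 'x] True False
    show ?thesis by blast
  next
    case odd: False
    from certificate_bounds[OF odd_certificate[OF odd assms(3,4)] assms(4), where 'y = 'x] odd False
    show ?thesis by blast
  qed
qed

end
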